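(* Consider the single-cell multigroup multicast massive MIMO system described in the context, with $N > \nu_j := K_{tot}-K_j$ for all $j\in\mathcal{G}$. Suppose the base station uses the multicast transmission $\sum_{j=1}^{G}\mathbf{w}_j s_j$ with the two-layered precoding vectors $$\mathbf{w}_j=\Bigl(\mathbf{I}_N-\hat{\mathbf{G}}_{-j}\bigl(\hat{\mathbf{G}}_{-j}^H\hat{\mathbf{G}}_{-j}\bigr)^{-1}\hat{\mathbf{G}}_{-j}^H\Bigr)\sum_{k=1}^{K_j}\sqrt{\mu_{jk}}\,\hat{\mathbf{g}}_{jk},\qquad \mu_{jk}=\frac{p_{jk}^{dl}}{(N-\nu_j)\gamma_{jk}},\qquad j\in\mathcal{G},$$ where $p^{dl}_{jk}\ge 0$ are the downlink powers and $P=\sum_{j=1}^{G}\sum_{k=1}^{K_j}p_{jk}^{dl}$. Then for every group $i\in\mathcal{G}$ and every user $k\in\mathcal{K}_i$, an achievable spectral efficiency for user $k$ of group $i$ is $$\mathrm{SE}_{ik}^{mu}=\Bigl(1-\frac{\tau_p}{T}\Bigr)\log_2\bigl(1+\mathrm{SINR}_{ik}^{mu}\bigr),\qquad \mathrm{SINR}_{ik}^{mu}=\frac{(N-\nu_i)\,\gamma_{ik}\,p_{ik}^{dl}}{1+\gamma_{ik}\sum_{m=1}^{K_i}p_{im}^{dl}+(\beta_{ik}-\gamma_{ik})P}.$$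
   Context: System. A base station (BS) with $N$ antennas serves $G$ multicast groups, $\mathcal{G}=\{1,\dots,G\}$; group $j$ contains the $K_j$ single-antenna users $\mathcal{K}_j=\{1,\dots,K_j\}$, each user belongs to exactly one group, and $K_{tot}=\sum_{j=1}^G K_j$. The channel is block fading: it is constant during each coherence interval of $T$ symbols and independent across intervals. The channel of user $k$ in group $j$ is $\mathbf{g}_{jk}\sim\mathcal{CN}(\mathbf{0},\beta_{jk}\mathbf{I}_N)$, independent across users, with known constants $\beta_{jk}>0$. Channel estimation. In each interval, $\tau_p$ symbols ($K_{tot}\le\tau_p\le T$) are used for uplink pilots, one orthogonal pilot per user, with pilot powers $p^u_{jk}>0$. The BS computes the MMSE estimates $$\hat{\mathbf{g}}_{jk}=\frac{\sqrt{\tau_p p_{jk}^u}\,\beta_{jk}}{1+\tau_p p_{jk}^u\beta_{jk}}\bigl(\sqrt{\tau_p p_{jk}^u}\,\mathbf{g}_{jk}+\mathbf{n}_{jk}\bigr),$$ with $\mathbf{n}_{jk}\sim\mathcal{CN}(\mathbf{0},\mathbf{I}_N)$ independent across users and independent of the channels. Thus $\hat{\mathbf{g}}_{jk}\sim\mathcal{CN}(\mathbf{0},\gamma_{jk}\mathbf{I}_N)$ with $$\gamma_{jk}=\frac{\tau_p p_{jk}^u\beta_{jk}^2}{1+\tau_p p_{jk}^u\beta_{jk}},$$ and $\tilde{\mathbf{g}}_{jk}=\hat{\mathbf{g}}_{jk}-\mathbf{g}_{jk}\sim\mathcal{CN}(\mathbf{0},(\beta_{jk}-\gamma_{jk})\mathbf{I}_N)$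 is independent of $\hat{\mathbf{g}}_{jk}$. Put $\hat{\mathbf{G}}_j=[\hat{\mathbf{g}}_{j1},\dots,\hat{\mathbf{g}}_{jK_j}]$ and let $\hat{\mathbf{G}}_{-j}=[\hat{\mathbf{G}}_1,\dots,\hat{\mathbf{G}}_{j-1},\hat{\mathbf{G}}_{j+1},\dots,\hat{\mathbf{G}}_G]$, an $N\times\nu_j$ matrix (if $G=1$ it is empty and the projection in $\mathbf{w}_1$ is $\mathbf{I}_N$). Downlink. In the remaining $T-\tau_p$ symbols of each interval the received signal of user $k$ in group $j$ is $y_{jk}=\mathbf{g}_{jk}^H\sum_{i=1}^{G}\mathbf{w}_i s_i+n$, where $s_i\sim\mathcal{CN}(0,1)$ is the data symbol of group $i$, independent across $i$, and $n\sim\mathcal{CN}(0,1)$ is noise; data symbols and noise are i.i.d. over time, and independent of each other, of the channels and of the channel estimates. Achievable spectral efficiency. A number $R$ (in bits per symbol of the coherence interval, i.e. counting all $T$ symbols) is an achievable spectral efficiency for user $k$ of group $i$ if it is a lower bound on the ergodic capacity of the channel from $s_i$ (with $\mathbb{E}|s_i|^2=1$) to $y_{ik}$, with coding over arbitrarily many independent coherence intervals, only the $T-\tau_p$ downlink symbols per interval carrying data, the other groups' signals acting as random interference, and the user knowing the channel statistics but not the realizations of the channels or of the precoders. *)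

theory Defs
  imports
    "HOL-Probability.Probability"
    "Jordan_Normal_Form.Gauss_Jordan_Elimination"
    "Jordan_Normal_Form.Schur_Decomposition"
begin

section \<open>Operational capacity of a block channel\<close>

text \<open>
  A channel is given by \<^term>\<open>Y x b t \<omega>\<close>: the output at symbol \<^term>\<open>t\<close> of coherence interval
  \<^term>\<open>b\<close> when the input sequence is \<^term>\<open>x\<close> and the outcome of all the randomness of the
  channel is \<^term>\<open>\<omega>\<close>. Data are carried by the symbols \<^term>\<open>t \<in> D\<close> of each interval.

  \<^term>\<open>block_code\<close>: \<^term>\<open>L\<close> messages are coded over \<^term>\<open>B\<close> intervals. The decoder is a fixed
  measurable function of the received symbols only, so it may be designed from the channel
  statistics but has no access to channel realizations. The normalization \<open>E|s|^2 = 1\<close> is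
  imposed on every codeword (with equality), hence also on average over the messages.
  The error requirement is on the maximum over the messages; it is phrased through the probability
  of correct decoding because \<^term>\<open>measure\<close> is 0 on non-measurable sets.
\<close>

definition block_code ::
  "'w measure \<Rightarrow> nat set \<Rightarrow> ((nat \<Rightarrow> nat \<Rightarrow> complex) \<Rightarrow> nat \<Rightarrow> nat \<Rightarrow> 'w \<Rightarrow> complex)
    \<Rightarrow> nat \<Rightarrow> nat \<Rightarrow> real \<Rightarrow> bool" where
  "block_code M D Y B L \<epsilon> \<longleftrightarrow>
    (\<exists>enc :: nat \<Rightarrow> nat \<Rightarrow> nat \<Rightarrow> complex.
     \<exists>dec \<in> measurable (\<Pi>\<^sub>M u\<in>{..<B} \<times> D. (borel :: complex measure)) (count_space (UNIV :: nat set)).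
       \<forall>m<L.
         (\<Sum>b<B. \<Sum>t\<in>D. (cmod (enc m b t))\<^sup>2) = real B * real (card D) \<and>
         measure M {\<omega> \<in> space M.
             dec (\<lambda>u\<in>{..<B} \<times> D. Y (enc m) (fst u) (snd u) \<omega>) = m} \<ge> 1 - \<epsilon>)"

text \<open>Rates are in bits per symbol, counting all \<^term>\<open>T\<close> symbols of an interval.\<close>

definition achievable_rate ::
  "'w measure \<Rightarrow> nat \<Rightarrow> nat set \<Rightarrow> ((nat \<Rightarrow> nat \<Rightarrow> complex) \<Rightarrow> nat \<Rightarrow> nat \<Rightarrow> 'w \<Rightarrow> complex)
    \<Rightarrow> real \<Rightarrow> bool" where
  "achievable_rate M T D Y R \<longleftrightarrow>
    (\<forall>\<epsilon>>0. \<forall>\<^sub>F B in sequentially.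
       \<exists>L\<ge>1. block_code M D Y B L \<epsilon> \<and> log 2 (real L) \<ge> R * (real B * real T))"

definition ergodic_capacity ::
  "'w measure \<Rightarrow> nat \<Rightarrow> nat set \<Rightarrow> ((nat \<Rightarrow> nat \<Rightarrow> complex) \<Rightarrow> nat \<Rightarrow> nat \<Rightarrow> 'w \<Rightarrow> complex)
    \<Rightarrow> ereal" where
  "ergodic_capacity M T D Y = Sup (ereal ` {R. achievable_rate M T D Y R})"

definition achievable_SE ::
  "'w measure \<Rightarrow> nat \<Rightarrow> nat set \<Rightarrow> ((nat \<Rightarrow> nat \<Rightarrow> complex) \<Rightarrow> nat \<Rightarrow> nat \<Rightarrow> 'w \<Rightarrow> complex)
    \<Rightarrow> real \<Rightarrow> bool" where
  "achievable_SE M T D Y R \<longleftrightarrow> ereal R \<le> ergodic_capacity M T D Y"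


section \<open>Random quantities of the multicast system\<close>

text \<open>Density of the circularly symmetric complex normal law \<open>CN(0, v)\<close>, for \<open>v > 0\<close>.\<close>

definition CN_density :: "real \<Rightarrow> complex \<Rightarrow> real" where
  "CN_density v x = exp (- (cmod x)\<^sup>2 / v) / (pi * v)"

text \<open>
  Labels of the scalar random variables that determine the signal received by one user. The arguments of \<^term>\<open>Channel\<close> and
  \<^term>\<open>Pilot_Noise\<close> are interval, group, user, antenna; those of \<^term>\<open>Data\<close> are interval, symbol,
  group; those of \<^term>\<open>Receiver_Noise\<close> are interval, symbol. A \<open>CN(0, v I)\<close> vector has
  independent \<open>CN(0, v)\<close> entries, so joint independence of vectors with such laws is
  joint independence of all entries. Groups and users are numbered from 1, antennas from 0.
\<close>

datatype source =
    Channel nat nat nat nat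
  | Pilot_Noise nat nat nat nat
  | Data nat nat nat
  | Receiver_Noise nat nat

definition sources :: "nat \<Rightarrow> nat \<Rightarrow> (nat \<Rightarrow> nat) \<Rightarrow> nat set \<Rightarrow> source set" where
  "sources N G K D =
     {Channel b j k a | b j k a. j \<in> {1..G} \<and> k \<in> {1..K j} \<and> a < N}
   \<union> {Pilot_Noise b j k a | b j k a. j \<in> {1..G} \<and> k \<in> {1..K j} \<and> a < N}
   \<union> {Data b t j | b t j. t \<in> D \<and> j \<in> {1..G}}
   \<union> {Receiver_Noise b t | b t. t \<in> D}"

primrec source_var :: "(nat \<Rightarrow> nat \<Rightarrow> real) \<Rightarrow> source \<Rightarrow> real" where
  "source_var \<beta> (Channel b j k a) = \<beta> j k"
| "source_var \<beta> (Pilot_Noise b j k a) = 1"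
| "source_var \<beta> (Data b t j) = 1"
| "source_var \<beta> (Receiver_Noise b t) = 1"

primrec source_rv ::
  "(nat \<Rightarrow> nat \<Rightarrow> nat \<Rightarrow> 'w \<Rightarrow> complex vec) \<Rightarrow> (nat \<Rightarrow> nat \<Rightarrow> nat \<Rightarrow> 'w \<Rightarrow> complex vec)
    \<Rightarrow> (nat \<Rightarrow> nat \<Rightarrow> nat \<Rightarrow> 'w \<Rightarrow> complex) \<Rightarrow> (nat \<Rightarrow> nat \<Rightarrow> 'w \<Rightarrow> complex)
    \<Rightarrow> source \<Rightarrow> 'w \<Rightarrow> complex" where
  "source_rv g n s z (Channel b j k a) = (\<lambda>\<omega>. vec_index (g b j k \<omega>) a)"
| "source_rv g n s z (Pilot_Noise b j k a) = (\<lambda>\<omega>. vec_index (n b j k \<omega>) a)"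
| "source_rv g n s z (Data b t j) = s b t j"
| "source_rv g n s z (Receiver_Noise b t) = z b t"

text \<open>
  The first \<open>\<tau>\<close> of the symbols \<open>1, \<dots>, T\<close> of an interval carry the pilots, the others
  (\<open>{\<tau><..T}\<close>) the downlink data. In interval \<open>b\<close>, \<open>g b j k\<close> is the channel of user \<open>k\<close> of
  group \<open>j\<close> and \<open>n b j k\<close> its pilot noise; \<open>s b t j\<close> is the symbol of group \<open>j\<close> at time \<open>t\<close>,
  and \<open>z j k b t\<close> the noise received by that user. No assumption is made on the joint law of the
  receiver noises of different users.
\<close>

locale multicast_system = prob_space M
  for M :: "'w measure" +
  fixes N G T \<tau> :: nat
    and K :: "nat \<Rightarrow> nat"
    and \<beta> p_ul :: "nat \<Rightarrow> nat \<Rightarrow> real"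
    and g n :: "nat \<Rightarrow> nat \<Rightarrow> nat \<Rightarrow> 'w \<Rightarrow> complex vec"
    and s :: "nat \<Rightarrow> nat \<Rightarrow> nat \<Rightarrow> 'w \<Rightarrow> complex"
    and z :: "nat \<Rightarrow> nat \<Rightarrow> nat \<Rightarrow> nat \<Rightarrow> 'w \<Rightarrow> complex"
  assumes pilots: "(\<Sum>j=1..G. K j) \<le> \<tau>" "\<tau> \<le> T"
    and beta_pos: "\<And>j k. j \<in> {1..G} \<Longrightarrow> k \<in> {1..K j} \<Longrightarrow> 0 < \<beta> j k"
    and p_ul_pos: "\<And>j k. j \<in> {1..G} \<Longrightarrow> k \<in> {1..K j} \<Longrightarrow> 0 < p_ul j k"
    and dims: "\<And>b j k \<omega>. j \<in> {1..G} \<Longrightarrow> k \<in> {1..K j} \<Longrightarrow> \<omega> \<in> space M \<Longrightarrow>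
                 g b j k \<omega> \<in> carrier_vec N \<and> n b j k \<omega> \<in> carrier_vec N"
    and laws: "\<And>j k x. j \<in> {1..G} \<Longrightarrow> k \<in> {1..K j} \<Longrightarrow> x \<in> sources N G K {\<tau><..T} \<Longrightarrow>
                 distributed M lborel (source_rv g n s (z j k) x)
                   (\<lambda>c. ennreal (CN_density (source_var \<beta> x) c))"
    and indep: "\<And>j k. j \<in> {1..G} \<Longrightarrow> k \<in> {1..K j} \<Longrightarrow>
                 indep_vars (\<lambda>_. borel) (source_rv g n s (z j k)) (sources N G K {\<tau><..T})"


section \<open>Channel estimation and precoding\<close>

text \<open>
  In the scalar definitions, \<open>p\<close> and \<open>\<beta>\<close> are the uplink power and the large-scale fading
  coefficient of one user.
\<close>

definition mmse_estimate :: "nat \<Rightarrow> real \<Rightarrow> real \<Rightarrow> complex vec \<Rightarrow> complex vec \<Rightarrow> complex vec" where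
  "mmse_estimate \<tau> p \<beta> g n =
     complex_of_real (sqrt (real \<tau> * p) * \<beta> / (1 + real \<tau> * p * \<beta>))
       \<cdot>\<^sub>v (complex_of_real (sqrt (real \<tau> * p)) \<cdot>\<^sub>v g + n)"

definition estimate_var :: "nat \<Rightarrow> real \<Rightarrow> real \<Rightarrow> real" where
  "estimate_var \<tau> p \<beta> = real \<tau> * p * \<beta>\<^sup>2 / (1 + real \<tau> * p * \<beta>)"

definition nu :: "nat \<Rightarrow> (nat \<Rightarrow> nat) \<Rightarrow> nat \<Rightarrow> nat" where
  "nu G K j = (\<Sum>l=1..G. K l) - K j"

text \<open>The value 0 for a singular matrix is a convention (Gram matrices below are
  almost surely invertible).\<close>

definition inv_mat :: "complex mat \<Rightarrow> complex mat" where
  "inv_mat A = (case mat_inverse A of Some B \<Rightarrow> B | None \<Rightarrow> 0\<^sub>m (dim_row A) (dim_col A))"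

definition other_estimates ::
  "nat \<Rightarrow> nat \<Rightarrow> (nat \<Rightarrow> nat) \<Rightarrow> (nat \<Rightarrow> nat \<Rightarrow> complex vec) \<Rightarrow> nat \<Rightarrow> complex mat" where
  "other_estimates N G K h j =
     mat_of_cols N (concat (map (\<lambda>l. map (h l) [1..<Suc (K l)]) (filter (\<lambda>l. l \<noteq> j) [1..<Suc G])))"

text \<open>For \<open>G = 1\<close> the matrix of the other estimates has no columns, and the projector is
  the identity.\<close>

definition nulling_projector ::
  "nat \<Rightarrow> nat \<Rightarrow> (nat \<Rightarrow> nat) \<Rightarrow> (nat \<Rightarrow> nat \<Rightarrow> complex vec) \<Rightarrow> nat \<Rightarrow> complex mat" where
  "nulling_projector N G K h j =
     (let A = other_estimates N G K h j
      in 1\<^sub>m N - A * inv_mat (mat_adjoint A * A) * mat_adjoint A)"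

definition precoder ::
  "nat \<Rightarrow> nat \<Rightarrow> (nat \<Rightarrow> nat) \<Rightarrow> (nat \<Rightarrow> nat \<Rightarrow> real) \<Rightarrow> (nat \<Rightarrow> nat \<Rightarrow> complex vec) \<Rightarrow> nat
    \<Rightarrow> complex vec" where
  "precoder N G K \<mu> h j =
     nulling_projector N G K h j *\<^sub>v
       vec N (\<lambda>a. \<Sum>k=1..K j. complex_of_real (sqrt (\<mu> j k)) * vec_index (h j k) a)"

text \<open>Signal received over the channel \<open>g\<close> with precoders \<open>w\<close>, symbols \<open>s\<close> and noise \<open>z\<close>;
  note that \<open>u \<bullet>c v\<close> conjugates \<open>v\<close>, so \<open>g\<^sup>H u = u \<bullet>c g\<close>.\<close>

definition received ::
  "nat \<Rightarrow> nat \<Rightarrow> complex vec \<Rightarrow> (nat \<Rightarrow> complex vec) \<Rightarrow> (nat \<Rightarrow> complex) \<Rightarrow> complex \<Rightarrow> complex" where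
  "received N G g w s z = vec N (\<lambda>a. \<Sum>j=1..G. vec_index (w j) a * s j) \<bullet>c g + z"

text \<open>The channel from the symbols of group \<open>i\<close> (replaced by the input sequence \<open>x\<close>) to the
  signal received by user \<open>k\<close> of that group.\<close>

definition multicast_channel ::
  "nat \<Rightarrow> nat \<Rightarrow> nat \<Rightarrow> (nat \<Rightarrow> nat) \<Rightarrow> (nat \<Rightarrow> nat \<Rightarrow> real) \<Rightarrow> (nat \<Rightarrow> nat \<Rightarrow> real) \<Rightarrow> (nat \<Rightarrow> nat \<Rightarrow> real)
    \<Rightarrow> (nat \<Rightarrow> nat \<Rightarrow> nat \<Rightarrow> 'w \<Rightarrow> complex vec) \<Rightarrow> (nat \<Rightarrow> nat \<Rightarrow> nat \<Rightarrow> 'w \<Rightarrow> complex vec)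
    \<Rightarrow> (nat \<Rightarrow> nat \<Rightarrow> nat \<Rightarrow> 'w \<Rightarrow> complex) \<Rightarrow> (nat \<Rightarrow> nat \<Rightarrow> nat \<Rightarrow> nat \<Rightarrow> 'w \<Rightarrow> complex)
    \<Rightarrow> nat \<Rightarrow> nat \<Rightarrow> (nat \<Rightarrow> nat \<Rightarrow> complex) \<Rightarrow> nat \<Rightarrow> nat \<Rightarrow> 'w \<Rightarrow> complex" where
  "multicast_channel N G \<tau> K \<beta> p_ul \<mu> g n s z i k x b t \<omega> =
     received N G (g b i k \<omega>)
       (precoder N G K \<mu>
          (\<lambda>j m. mmse_estimate \<tau> (p_ul j m) (\<beta> j m) (g b j m \<omega>) (n b j m \<omega>)))
       ((\<lambda>j. s b t j \<omega>)(i := x b t))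
       (z i k b t \<omega>)"

end

theory Submission
  imports Defs "HOL-Real_Asymp.Real_Asymp"
begin

text \<open>
  A random coding argument with a mismatched decoder. The received symbol is \<open>y = a x + v\<close>, where neither
  the gain \<open>a\<close> nor the interference \<open>v\<close> is Gaussian or known to the receiver. Decode as if the channel
  were \<open>y = h x + noise\<close> with \<open>h = E a\<close> and noise variance \<open>s2 = E|a - h|\<^sup>2 + E|v|\<^sup>2\<close>, with Gaussian inputs. For
  every fixed output sequence the exponential of the information density of that channel has mean 1
  over the input, so a wrong codeword passes a threshold test with exponentially small probability;
  for the transmitted codeword the expected information density per symbol is exactly \<open>ln (1 + h\<^sup>2 / s2)\<close>,
  because only second moments enter, and Chebyshev's inequality over the independent intervals applies.
  Feinstein's greedy selection turns this into codes of small maximal error.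

  The data symbols \<open>s\<^sub>i\<close> of the system are themselves Gaussian and independent of \<open>(a, v)\<close>, so they serve as the
  random codebook. The moments \<open>h\<close> and \<open>s2\<close> are computed exactly: the MMSE estimates and errors are
  independent Gaussians, the nulling projector is a Hermitian idempotent that depends on the estimates
  of the other groups only, annihilates them and has trace \<open>N - \<nu>\<close> almost surely, and everything else is
  Pythagoras' theorem for independent centered variables, apart from one fourth moment.
\<close>

text \<open>Two obstacles shape the argument. The gain stays fixed during an interval, so the
  outputs within one interval are not independent; the law of large numbers therefore runs over
  intervals, with the information densities of an interval summed first, and it asks for second
  moments of these sums bounded uniformly in the interval. Moreover, every codeword must have
  exactly the prescribed energy, which a Gaussian sequence has only approximately. Hence a small
  fraction of the intervals is kept out of the code: this leaves room for fluctuations of the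
  energy, the energy test becomes part of the threshold set, and the energy still missing is sent on
  one uncoded symbol. On the side of the moments, each pair (channel, pilot noise) is exchanged for
  the pair (error, estimate), again within one independent Gaussian family; later independence
  claims then become disjointness of sets of labels. Everything is polynomial in this family apart
  from the projector, whose entries are bounded by 1, so all moments exist.\<close>

section \<open>Feinstein's lemma\<close>

text \<open>Greedy construction: as long as the code is small, the decision sets used so far have
  small output probability, so the threshold set minus these sets still holds enough probability for
  some new codeword. \<open>confuse\<close> is asked for every fixed output \<open>c\<close>, not on
  average over the true output law; this is what admits a mismatched metric. The constants:
  \<open>pass\<close> loses \<open>\<epsilon> / 4\<close>, the exclusion of atypical codewords
  another \<open>\<epsilon> / 4\<close>, and the remaining \<open>\<epsilon> / 2\<close> must exceed
  \<open>4 * q / \<epsilon>\<close> times the number of codewords already chosen, which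
  \<open>size\<close> secures.\<close>

lemma (in prob_space) feinstein:
  fixes \<epsilon> q :: real
  assumes X[measurable]: "X \<in> M \<rightarrow>\<^sub>M MX" and V[measurable]: "V \<in> M \<rightarrow>\<^sub>M MV"
    and ind: "distr M (MX \<Otimes>\<^sub>M MV) (\<lambda>\<omega>. (X \<omega>, V \<omega>)) = distr M MX X \<Otimes>\<^sub>M distr M MV V"
    and y[measurable]: "y \<in> measurable (MX \<Otimes>\<^sub>M MV) MY"
    and A[measurable]: "A \<in> sets (MX \<Otimes>\<^sub>M MY)"
    and eps: "0 < \<epsilon>" "\<epsilon> < 1"
    and q: "0 < q"
    and pass: "prob {\<omega>\<in>space M. (X \<omega>, y (X \<omega>, V \<omega>)) \<in> A} \<ge> 1 - \<epsilon> / 4"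
    and confuse: "\<And>c. c \<in> space MY \<Longrightarrow> prob {\<omega>\<in>space M. (X \<omega>, c) \<in> A} \<le> q"
    and size: "8 * q * real L \<le> \<epsilon>\<^sup>2"
  shows "\<exists>cw D. (\<forall>m<L. cw m \<in> space MX \<and> D m \<in> sets MY \<and> D m \<subseteq> Pair (cw m) -` A \<and>
                       prob {\<omega>\<in>space M. y (cw m, V \<omega>) \<in> D m} \<ge> 1 - \<epsilon>) \<and>
           (\<forall>m<L. \<forall>l<L. l \<noteq> m \<longrightarrow> D m \<inter> D l = {})"
proof -
  define PX where "PX = distr M MX X"
  define PV where "PV = distr M MV V"
  define PY where "PY = distr M MY (\<lambda>\<omega>. y (X \<omega>, V \<omega>))"
  interpret PX: prob_space PX unfolding PX_def by (rule prob_space_distr) simp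
  interpret PV: prob_space PV unfolding PV_def by (rule prob_space_distr) simp
  interpret PY: prob_space PY unfolding PY_def by (rule prob_space_distr) simp
  interpret XV: pair_prob_space PX PV ..
  interpret XY: pair_prob_space PX PY ..
  have sets_eq[measurable_cong]: "sets PX = sets MX" "sets PV = sets MV" "sets PY = sets MY"
    by (auto simp: PX_def PV_def PY_def)
  have sp: "space PX = space MX" "space PV = space MV" "space PY = space MY"
    by (auto simp: PX_def PV_def PY_def)
  have joint: "PX \<Otimes>\<^sub>M PV = distr M (MX \<Otimes>\<^sub>M MV) (\<lambda>\<omega>. (X \<omega>, V \<omega>))"
    unfolding PX_def PV_def ind ..
  define E where "E B = {p \<in> space (MX \<Otimes>\<^sub>M MV). (fst p, y p) \<in> B}" for B
  have E[measurable]: "E B \<in> sets (MX \<Otimes>\<^sub>M MV)" if [measurable]: "B \<in> sets (MX \<Otimes>\<^sub>M MY)" for B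
    unfolding E_def by measurable
  have emE: "emeasure M {\<omega>\<in>space M. (X \<omega>, y (X \<omega>, V \<omega>)) \<in> B} =
      (\<integral>\<^sup>+x. emeasure PV (Pair x -` E B) \<partial>PX)" if [measurable]: "B \<in> sets (MX \<Otimes>\<^sub>M MY)" for B
  proof -
    have "(\<integral>\<^sup>+x. emeasure PV (Pair x -` E B) \<partial>PX) = emeasure (PX \<Otimes>\<^sub>M PV) (E B)"
      by (rule PV.emeasure_pair_measure_alt[symmetric]) (simp add: sets_eq cong: sets_pair_measure_cong)
    also have "\<dots> = emeasure M ((\<lambda>\<omega>. (X \<omega>, V \<omega>)) -` E B \<inter> space M)"
      unfolding joint by (rule emeasure_distr) auto
    also have "(\<lambda>\<omega>. (X \<omega>, V \<omega>)) -` E B \<inter> space M = {\<omega>\<in>space M. (X \<omega>, y (X \<omega>, V \<omega>)) \<in> B}"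
      using measurable_space[OF X] measurable_space[OF V] by (auto simp: E_def space_pair_measure)
    finally show ?thesis by simp
  qed
  have AXY: "A \<in> sets (PX \<Otimes>\<^sub>M PY)"
    by (simp add: sets_eq cong: sets_pair_measure_cong)
  \<comment> \<open>\<open>f x\<close> is the probability that an output drawn independently of the
    codeword passes the test for \<open>x\<close>. By Fubini's theorem its mean over
    \<open>x\<close> is at most \<open>q\<close>, so by Markov's inequality discarding the codewords
    with \<open>f x\<close> at least \<open>4 * q / \<epsilon>\<close> costs probability at most
    \<open>\<epsilon> / 4\<close>.\<close>
  define f where "f x = emeasure PY (Pair x -` A)" for x
  have f[measurable]: "f \<in> borel_measurable MX"
    unfolding f_def using PY.measurable_emeasure_Pair[OF AXY] by (simp add: sets_eq cong: measurable_cong_sets)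
  have "(\<integral>\<^sup>+x. f x \<partial>PX) = emeasure (PX \<Otimes>\<^sub>M PY) A"
    unfolding f_def by (rule PY.emeasure_pair_measure_alt[symmetric]) (rule AXY)
  also have "\<dots> = (\<integral>\<^sup>+c. emeasure PX ((\<lambda>x. (x, c)) -` A) \<partial>PY)"
    by (rule XY.emeasure_pair_measure_alt2) (rule AXY)
  also have "\<dots> \<le> (\<integral>\<^sup>+c. ennreal q \<partial>PY)"
  proof (rule nn_integral_mono)
    fix c assume c: "c \<in> space PY"
    have "emeasure PX ((\<lambda>x. (x, c)) -` A) = emeasure M (X -` ((\<lambda>x. (x, c)) -` A) \<inter> space M)"
      unfolding PX_def by (rule emeasure_distr) (auto intro: sets_Pair2[OF A])
    also have "X -` ((\<lambda>x. (x, c)) -` A) \<inter> space M = {\<omega>\<in>space M. (X \<omega>, c) \<in> A}" by auto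
    finally show "emeasure PX ((\<lambda>x. (x, c)) -` A) \<le> ennreal q"
      using confuse[of c] c by (simp add: sp emeasure_eq_measure ennreal_leI)
  qed
  also have "\<dots> = ennreal q"
    by (simp add: PY.emeasure_space_1)
  finally have f_le: "(\<integral>\<^sup>+x. f x \<partial>PX) \<le> ennreal q" .
  define Bad where "Bad = {x \<in> space MX. ennreal (4 * q / \<epsilon>) \<le> f x}"
  have Bad[measurable]: "Bad \<in> sets MX"
    unfolding Bad_def by measurable
  have "ennreal (4 * q / \<epsilon>) * emeasure PX Bad \<le> (\<integral>\<^sup>+x. f x \<partial>PX)"
  proof -
    have "ennreal (4 * q / \<epsilon>) * emeasure PX Bad = (\<integral>\<^sup>+x. ennreal (4 * q / \<epsilon>) * indicator Bad x \<partial>PX)"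
      by (subst nn_integral_cmult_indicator) (auto simp: sets_eq)
    also have "\<dots> \<le> (\<integral>\<^sup>+x. f x \<partial>PX)"
      by (intro nn_integral_mono) (auto simp: Bad_def indicator_def)
    finally show ?thesis .
  qed
  with f_le have "ennreal (4 * q / \<epsilon>) * emeasure PX Bad \<le> ennreal q" by (rule order_trans[rotated])
  then have "4 * q / \<epsilon> * measure PX Bad \<le> q"
    using q eps by (simp add: PX.emeasure_eq_measure ennreal_mult[symmetric] del: ennreal_mult'' )
  then have Bad_le: "measure PX Bad \<le> \<epsilon> / 4"
    using q eps by (simp add: field_simps)
  \<comment> \<open>The bound on \<open>f (cw m)\<close> strengthens the induction claim: it keeps
    the output probability of the union \<open>U\<close> of the earlier decision sets small in the
    next step.\<close>
  have "\<exists>cw D. (\<forall>m<L. cw m \<in> space MX \<and> D m \<in> sets MY \<and> D m \<subseteq> Pair (cw m) -` A \<and>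
                       prob {\<omega>\<in>space M. y (cw m, V \<omega>) \<in> D m} \<ge> 1 - \<epsilon> \<and> f (cw m) \<le> ennreal (4 * q / \<epsilon>)) \<and>
           (\<forall>m<L. \<forall>l<L. l \<noteq> m \<longrightarrow> D m \<inter> D l = {})"
    using size
  proof (induction L)
    case 0
    show ?case by auto
  next
    case (Suc L)
    have "8 * q * real L \<le> \<epsilon>\<^sup>2" using Suc.prems q by (simp add: algebra_simps)
    from Suc.IH[OF this] obtain cw D where
      code: "\<forall>m<L. cw m \<in> space MX \<and> D m \<in> sets MY \<and> D m \<subseteq> Pair (cw m) -` A \<and>
                       prob {\<omega>\<in>space M. y (cw m, V \<omega>) \<in> D m} \<ge> 1 - \<epsilon> \<and> f (cw m) \<le> ennreal (4 * q / \<epsilon>)"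
        "\<forall>m<L. \<forall>l<L. l \<noteq> m \<longrightarrow> D m \<inter> D l = {}"
      by (elim exE conjE)
    have cw: "cw m \<in> space MX \<and> D m \<in> sets MY \<and> D m \<subseteq> Pair (cw m) -` A \<and>
                       prob {\<omega>\<in>space M. y (cw m, V \<omega>) \<in> D m} \<ge> 1 - \<epsilon> \<and> f (cw m) \<le> ennreal (4 * q / \<epsilon>)"
      if "m < L" for m using code(1) that by (elim allE impE)
    have disj: "D m \<inter> D l = {}" if "m < L" "l < L" "l \<noteq> m" for m l
      using code(2) that by simp
    define U where "U = (\<Union>m<L. D m)"
    have U[measurable]: "U \<in> sets MY" unfolding U_def using cw by auto
    have PYU: "emeasure PY U \<le> ennreal (real L * (4 * q / \<epsilon>))"
    proof -
      have "emeasure PY U \<le> (\<Sum>m<L. emeasure PY (D m))"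
        unfolding U_def by (rule emeasure_subadditive_finite) (use cw in \<open>auto simp: sets_eq\<close>)
      also have "\<dots> \<le> (\<Sum>m<L. ennreal (4 * q / \<epsilon>))"
      proof (rule sum_mono)
        fix m assume "m \<in> {..<L}"
        then have m: "m < L" by simp
        have "Pair (cw m) -` A \<in> sets PY" by (simp add: sets_eq sets_Pair1[OF A])
        then have "emeasure PY (D m) \<le> emeasure PY (Pair (cw m) -` A)"
          using cw[OF m] by (intro emeasure_mono) auto
        then show "emeasure PY (D m) \<le> ennreal (4 * q / \<epsilon>)"
          using cw[OF m] unfolding f_def by auto
      qed
      also have "\<dots> = ennreal (real L * (4 * q / \<epsilon>))"
        using q eps by (simp add: ennreal_of_nat_eq_real_of_nat ennreal_mult'[symmetric])
      finally show ?thesis .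
    qed
    define F where "F = space MX \<times> U"
    have F[measurable]: "F \<in> sets (MX \<Otimes>\<^sub>M MY)" unfolding F_def by measurable
    \<comment> \<open>If no good codeword had room left, integrating the reverse inequality over the
      codeword would bound the pass probability by \<open>\<epsilon> / 4 + (1 - \<epsilon>)\<close>
      plus the output probability of \<open>U\<close>, against \<open>size\<close>.\<close>
    have "\<exists>x\<in>space MX. x \<notin> Bad \<and>
        emeasure PV (Pair x -` E A) > ennreal (1 - \<epsilon>) + emeasure PV (Pair x -` E F)"
    proof (rule ccontr)
      assume no: "\<not> ?thesis"
      have "ennreal (1 - \<epsilon> / 4) \<le> emeasure M {\<omega>\<in>space M. (X \<omega>, y (X \<omega>, V \<omega>)) \<in> A}"
        using pass by (simp add: emeasure_eq_measure ennreal_leI)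
      also have "\<dots> = (\<integral>\<^sup>+x. emeasure PV (Pair x -` E A) \<partial>PX)" by (rule emE) fact
      also have "\<dots> \<le> (\<integral>\<^sup>+x. indicator Bad x + (ennreal (1 - \<epsilon>) + emeasure PV (Pair x -` E F)) \<partial>PX)"
      proof (rule nn_integral_mono)
        fix x assume x: "x \<in> space PX"
        show "emeasure PV (Pair x -` E A) \<le>
            indicator Bad x + (ennreal (1 - \<epsilon>) + emeasure PV (Pair x -` E F))"
        proof (cases "x \<in> Bad")
          case True
          have "emeasure PV (Pair x -` E A) \<le> 1"
            using PV.prob_le_1 by (simp add: PV.emeasure_eq_measure)
          also have "\<dots> \<le> indicator Bad x + (ennreal (1 - \<epsilon>) + emeasure PV (Pair x -` E F))"
            using True by simp
          finally show ?thesis .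
        next
          case False
          with no x show ?thesis by (force simp: sp not_less)
        qed
      qed
      also have "\<dots> = emeasure PX Bad + (ennreal (1 - \<epsilon>) + (\<integral>\<^sup>+x. emeasure PV (Pair x -` E F) \<partial>PX))"
      proof -
        have m[measurable]: "(\<lambda>x. emeasure PV (Pair x -` E F)) \<in> borel_measurable PX"
          by (rule PV.measurable_emeasure_Pair) (simp add: sets_eq cong: sets_pair_measure_cong)
        have [measurable]: "Bad \<in> sets PX" by (simp add: sets_eq)
        show ?thesis
          by (simp add: nn_integral_add PX.emeasure_space_1)
      qed
      also have "(\<integral>\<^sup>+x. emeasure PV (Pair x -` E F) \<partial>PX) = emeasure PY U"
      proof -
        have "emeasure PY U = emeasure M ((\<lambda>\<omega>. y (X \<omega>, V \<omega>)) -` U \<inter> space M)"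
          unfolding PY_def by (rule emeasure_distr) auto
        also have "(\<lambda>\<omega>. y (X \<omega>, V \<omega>)) -` U \<inter> space M = {\<omega>\<in>space M. (X \<omega>, y (X \<omega>, V \<omega>)) \<in> F}"
          using measurable_space[OF X] by (auto simp: F_def)
        finally show ?thesis using emE[OF F] by simp
      qed
      also have "emeasure PX Bad + (ennreal (1 - \<epsilon>) + emeasure PY U)
          \<le> ennreal (\<epsilon> / 4) + (ennreal (1 - \<epsilon>) + ennreal (real L * (4 * q / \<epsilon>)))"
        using PYU Bad_le by (intro add_mono) (auto simp: PX.emeasure_eq_measure intro: ennreal_leI)
      finally have "ennreal (1 - \<epsilon> / 4) \<le> ennreal (\<epsilon> / 4) + (ennreal (1 - \<epsilon>) + ennreal (real L * (4 * q / \<epsilon>)))" .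
      also have "\<dots> = ennreal (\<epsilon> / 4 + (1 - \<epsilon> + real L * (4 * q / \<epsilon>)))"
        using eps q by (simp add: ennreal_plus[symmetric] del: ennreal_plus)
      finally have "ennreal (1 - \<epsilon> / 4) \<le> ennreal (\<epsilon> / 4 + (1 - \<epsilon> + real L * (4 * q / \<epsilon>)))" .
      moreover have "0 \<le> \<epsilon> / 4 + (1 - \<epsilon> + real L * (4 * q / \<epsilon>))"
        using eps q by (intro add_nonneg_nonneg) auto
      ultimately have "1 - \<epsilon> / 4 \<le> \<epsilon> / 4 + (1 - \<epsilon> + real L * (4 * q / \<epsilon>))"
        by (simp only: ennreal_le_iff)
      then have "\<epsilon> * (\<epsilon> / 2) \<le> \<epsilon> * (real L * (4 * q / \<epsilon>))"
        using eps by (intro mult_left_mono) auto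
      then have "\<epsilon>\<^sup>2 \<le> 8 * q * real L"
        using eps by (simp add: power2_eq_square algebra_simps)
      with Suc.prems q show False by (simp add: algebra_simps)
    qed
    then obtain x where x: "x \<in> space MX" "x \<notin> Bad"
      and gt: "emeasure PV (Pair x -` E A) > ennreal (1 - \<epsilon>) + emeasure PV (Pair x -` E F)" by blast
    \<comment> \<open>Removing \<open>U\<close> makes the new set disjoint from the old ones; the
      choice of \<open>x\<close> ensures that at least \<open>1 - \<epsilon>\<close> of the
      conditional probability survives the removal.\<close>
    define Dx where "Dx = Pair x -` A - U"
    have Dx[measurable]: "Dx \<in> sets MY" unfolding Dx_def using U sets_Pair1[OF A] by auto
    have "prob {\<omega>\<in>space M. y (x, V \<omega>) \<in> Dx} \<ge> 1 - \<epsilon>"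
    proof -
      have EA: "Pair x -` E A \<in> sets PV" "Pair x -` E F \<in> sets PV"
        by (simp_all add: sets_eq sets_Pair1)
      define H where "H = {v \<in> space MV. y (x, v) \<in> Dx}"
      have xm[measurable]: "x \<in> space MX" by fact
      have H[measurable]: "H \<in> sets MV" unfolding H_def by measurable
      have "Pair x -` E A \<subseteq> H \<union> Pair x -` E F"
        using x measurable_space[OF y] by (auto simp: E_def F_def H_def Dx_def space_pair_measure)
      then have "measure PV (Pair x -` E A) \<le> measure PV (H \<union> Pair x -` E F)"
        using EA by (intro PV.finite_measure_mono) (auto simp: sets_eq)
      also have "\<dots> \<le> measure PV H + measure PV (Pair x -` E F)"
        using EA by (intro measure_Un_le) (auto simp: sets_eq)
      finally have "1 - \<epsilon> < measure PV H"
        using gt eps by (simp add: PV.emeasure_eq_measure ennreal_plus[symmetric] ennreal_less_iff del: ennreal_plus)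
      also have "measure PV H = prob (V -` H \<inter> space M)"
        unfolding PV_def by (rule measure_distr) auto
      also have "V -` H \<inter> space M = {\<omega>\<in>space M. y (x, V \<omega>) \<in> Dx}"
        using measurable_space[OF V] by (auto simp: H_def)
      finally show ?thesis by simp
    qed
    moreover have "f x \<le> ennreal (4 * q / \<epsilon>)" using x by (auto simp: Bad_def)
    moreover have "Dx \<subseteq> Pair x -` A" "\<And>m. m < L \<Longrightarrow> Dx \<inter> D m = {}" "\<And>m. m < L \<Longrightarrow> D m \<inter> Dx = {}"
      by (auto simp: Dx_def U_def)
    ultimately show ?case
      using cw disj x(1) Dx
      by (intro exI[of _ "\<lambda>m. if m = L then x else cw m"] exI[of _ "\<lambda>m. if m = L then Dx else D m"])
         (simp add: less_Suc_eq)
  qed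
  then obtain cw D where
    "\<forall>m<L. cw m \<in> space MX \<and> D m \<in> sets MY \<and> D m \<subseteq> Pair (cw m) -` A \<and>
         prob {\<omega>\<in>space M. y (cw m, V \<omega>) \<in> D m} \<ge> 1 - \<epsilon> \<and> f (cw m) \<le> ennreal (4 * q / \<epsilon>)"
    "\<forall>m<L. \<forall>l<L. l \<noteq> m \<longrightarrow> D m \<inter> D l = {}"
    by (elim exE conjE)
  then show ?thesis by (intro exI[of _ cw] exI[of _ D]) simp
qed

section \<open>The complex normal law\<close>

definition CN :: "real \<Rightarrow> complex measure" where
  "CN v = density lborel (\<lambda>x. ennreal (CN_density v x))"

lemma CN_density_measurable[measurable]: "CN_density v \<in> borel_measurable borel"
  unfolding CN_density_def by measurable

lemma sets_CN[simp, measurable_cong]: "sets (CN v) = sets borel"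
  and space_CN[simp]: "space (CN v) = UNIV"
  by (auto simp: CN_def)

lemma CN_density_nonneg: "0 < v \<Longrightarrow> 0 \<le> CN_density v x"
  by (simp add: CN_density_def)

text \<open>Both sides agree on boxes, which in the complex plane are products of intervals. This is
  the bridge between the complex normal law and pairs of real normal variables.\<close>

lemma lborel_complex:
  "lborel = distr (lborel \<Otimes>\<^sub>M lborel) borel (\<lambda>(x, y). Complex x y)"
proof (rule lborel_eqI)
  have [measurable]: "(\<lambda>(x, y). Complex x y) \<in> (lborel \<Otimes>\<^sub>M lborel) \<rightarrow>\<^sub>M borel"
    unfolding Complex_eq by measurable
  fix l u :: complex
  assume le: "\<And>b. b \<in> Basis \<Longrightarrow> l \<bullet> b \<le> u \<bullet> b"
  have le': "Re l \<le> Re u" "Im l \<le> Im u"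
    using le[of 1] le[of \<i>] by (auto simp: Basis_complex_def)
  have "emeasure (distr (lborel \<Otimes>\<^sub>M lborel) borel (\<lambda>(x, y). Complex x y)) (box l u) =
      emeasure (lborel \<Otimes>\<^sub>M lborel) (box (Re l) (Re u) \<times> box (Im l) (Im u))"
    by (subst emeasure_distr)
       (auto simp: box_def Basis_complex_def space_pair_measure intro!: arg_cong2[where f=emeasure])
  also have "\<dots> = ennreal (Re u - Re l) * ennreal (Im u - Im l)"
    using le' by (subst lborel.emeasure_pair_measure_Times) auto
  also have "\<dots> = ennreal (\<Prod>b\<in>Basis. (u - l) \<bullet> b)"
    using le' by (simp add: Basis_complex_def ennreal_mult)
  finally show "emeasure (distr (lborel \<Otimes>\<^sub>M lborel) borel (\<lambda>(x, y). Complex x y)) (box l u) =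
      ennreal (\<Prod>b\<in>Basis. (u - l) \<bullet> b)" .
qed simp

lemma Complex_measurable[measurable]: "(\<lambda>(x, y). Complex x y) \<in> borel_measurable (borel \<Otimes>\<^sub>M borel)"
  unfolding Complex_eq by measurable

lemma CN_density_Complex:
  assumes "0 < v"
  shows "CN_density v (Complex x y) = normal_density 0 (sqrt (v / 2)) x * normal_density 0 (sqrt (v / 2)) y"
  using assms
  by (simp add: CN_density_def normal_density_def cmod_def exp_add[symmetric] add_divide_distrib
      real_sqrt_mult[symmetric] power2_eq_square[symmetric] field_simps)

text \<open>The law of the real or the imaginary part of a \<open>CN\<close> variable: a centered
  normal law of variance \<open>v / 2\<close>, not the folded normal law that usually goes by this
  name.\<close>

definition half_normal :: "real \<Rightarrow> real measure" where
  "half_normal v = density lborel (\<lambda>x. ennreal (normal_density 0 (sqrt (v / 2)) x))"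

lemma sets_half_normal[simp, measurable_cong]: "sets (half_normal v) = sets borel"
  and space_half_normal[simp]: "space (half_normal v) = UNIV"
  by (auto simp: half_normal_def)

lemma distr_pair_snd:
  assumes "prob_space M" and N: "sigma_finite_measure N"
  shows "distr (M \<Otimes>\<^sub>M N) N snd = N"
proof (rule measure_eqI)
  interpret M: prob_space M by fact
  fix A assume "A \<in> sets (distr (M \<Otimes>\<^sub>M N) N snd)"
  then have A: "A \<in> sets N" by simp
  then have "emeasure (distr (M \<Otimes>\<^sub>M N) N snd) A = emeasure (M \<Otimes>\<^sub>M N) (space M \<times> A)"
    using sets.sets_into_space[OF A]
    by (subst emeasure_distr) (auto simp: space_pair_measure intro!: arg_cong2[where f=emeasure])
  also have "\<dots> = emeasure N A"
    using A M.emeasure_space_1 by (subst sigma_finite_measure.emeasure_pair_measure_Times[OF N]) auto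
  finally show "emeasure (distr (M \<Otimes>\<^sub>M N) N snd) A = emeasure N A" .
qed simp

lemma CN_eq_distr:
  assumes v: "0 < v"
  shows "CN v = distr (half_normal v \<Otimes>\<^sub>M half_normal v) borel (\<lambda>(x, y). Complex x y)"
proof -
  interpret N: prob_space "half_normal v"
    unfolding half_normal_def using v by (intro prob_space_normal_density) simp
  have "distr (half_normal v \<Otimes>\<^sub>M half_normal v) borel (\<lambda>(x, y). Complex x y) =
      distr (density (lborel \<Otimes>\<^sub>M lborel)
        (\<lambda>(x, y). ennreal (normal_density 0 (sqrt (v / 2)) x) * ennreal (normal_density 0 (sqrt (v / 2)) y)))
       borel (\<lambda>(x, y). Complex x y)"
    unfolding half_normal_def
    by (subst pair_measure_density)
       (use N.sigma_finite_measure_axioms in \<open>auto simp: half_normal_def intro: lborel.sigma_finite_measure_axioms\<close>)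
  also have "\<dots> = distr (density (lborel \<Otimes>\<^sub>M lborel)
        (\<lambda>p. ennreal (CN_density v (case p of (x, y) \<Rightarrow> Complex x y)))) borel (\<lambda>(x, y). Complex x y)"
    using v by (simp add: CN_density_Complex ennreal_mult split_beta')
  also have "\<dots> = density (distr (lborel \<Otimes>\<^sub>M lborel) borel (\<lambda>(x, y). Complex x y)) (\<lambda>z. ennreal (CN_density v z))"
    by (subst density_distr) (auto simp: split_beta')
  also have "\<dots> = CN v"
    unfolding CN_def lborel_complex[symmetric] ..
  finally show ?thesis ..
qed

lemma prob_space_CN:
  assumes v: "0 < v"
  shows "prob_space (CN v)"
proof -
  interpret N: prob_space "half_normal v"
    unfolding half_normal_def using v by (intro prob_space_normal_density) simp
  interpret NN: pair_prob_space "half_normal v" "half_normal v" ..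
  show ?thesis unfolding CN_eq_distr[OF v] by (rule NN.prob_space_distr) simp
qed

text \<open>The factor is \<open>c\<^sup>2\<close> because the plane has real dimension 2. Combined
  with Fubini's theorem, this carries out the linear changes of variables below one coordinate at a
  time.\<close>

lemma nn_integral_complex_affine:
  fixes f :: "complex \<Rightarrow> ennreal"
  assumes [measurable]: "f \<in> borel_measurable borel" and c: "c \<noteq> 0"
  shows "(\<integral>\<^sup>+x. f x \<partial>lborel) = ennreal (c\<^sup>2) * (\<integral>\<^sup>+x. f (t + complex_of_real c * x) \<partial>lborel)"
  by (subst lborel_affine[OF c, of t])
     (simp add: nn_integral_density nn_integral_distr nn_integral_cmult scaleR_conv_of_real)

lemma nn_integral_CN_density:
  assumes "0 < v"
  shows "(\<integral>\<^sup>+x. ennreal (CN_density v (x - m)) \<partial>lborel) = 1"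
proof -
  interpret prob_space "CN v" by (rule prob_space_CN) fact
  have "(\<integral>\<^sup>+x. ennreal (CN_density v (x - m)) \<partial>lborel) = (\<integral>\<^sup>+x. ennreal (CN_density v x) \<partial>lborel)"
    by (subst nn_integral_complex_affine[where c=1 and t=m]) auto
  also have "\<dots> = emeasure (CN v) (space (CN v))"
    by (simp add: CN_def emeasure_density)
  finally show ?thesis by (simp only: emeasure_space_1)
qed

text \<open>A quarter turn maps boxes to boxes, so the invariance can be read off from the measures
  of boxes.\<close>

lemma lborel_mult_ii: "distr lborel borel ((*) \<i>) = (lborel :: complex measure)"
proof (rule lborel_eqI[symmetric])
  fix l u :: complex
  assume le: "\<And>b. b \<in> Basis \<Longrightarrow> l \<bullet> b \<le> u \<bullet> b"
  have le': "Re l \<le> Re u" "Im l \<le> Im u"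
    using le[of 1] le[of \<i>] by (auto simp: Basis_complex_def)
  have "emeasure (distr lborel borel ((*) \<i>)) (box l u) =
      emeasure lborel (box (Complex (Im l) (- Re u)) (Complex (Im u) (- Re l)))"
    by (subst emeasure_distr)
       (auto simp: box_def Basis_complex_def intro!: arg_cong2[where f=emeasure])
  also have "\<dots> = ennreal (\<Prod>b\<in>Basis. (u - l) \<bullet> b)"
    using le' by (subst emeasure_lborel_box) (auto simp: Basis_complex_def mult.commute)
  finally show "emeasure (distr lborel borel ((*) \<i>)) (box l u) = ennreal (\<Prod>b\<in>Basis. (u - l) \<bullet> b)" .
qed simp

lemma CN_mult_ii: "distr (CN v) borel ((*) \<i>) = CN v"
proof -
  have "CN v = density (distr lborel borel ((*) \<i>)) (\<lambda>x. ennreal (CN_density v x))"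
    by (simp add: CN_def lborel_mult_ii)
  also have "\<dots> = distr (density lborel (\<lambda>x. ennreal (CN_density v (\<i> * x)))) borel ((*) \<i>)"
    by (subst density_distr) auto
  also have "\<dots> = distr (CN v) borel ((*) \<i>)"
    by (simp add: CN_def CN_density_def norm_mult)
  finally show ?thesis ..
qed

lemma borel_measurable_cnj[measurable (raw)]:
  "f \<in> borel_measurable M \<Longrightarrow> (\<lambda>x. cnj (f x)) \<in> borel_measurable M"
  by (rule borel_measurable_continuous_on[where f=cnj]) (auto intro: continuous_intros)

text \<open>Invariance of the law under a quarter turn multiplies the moment by
  \<open>\<i> ^ p * (- \<i>) ^ q\<close>; a number left unchanged by a factor other than 1 is
  zero.\<close>

lemma CN_moment_zero:
  assumes "\<i> ^ p * (- \<i>) ^ q \<noteq> 1"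
  shows "(\<integral>x. x ^ p * cnj x ^ q \<partial>CN v) = 0"
proof -
  have "(\<integral>x. x ^ p * cnj x ^ q \<partial>CN v) = (\<integral>x. x ^ p * cnj x ^ q \<partial>distr (CN v) borel ((*) \<i>))"
    by (simp add: CN_mult_ii)
  also have "\<dots> = (\<integral>x. (\<i> * x) ^ p * cnj (\<i> * x) ^ q \<partial>CN v)"
    by (subst integral_distr) auto
  also have "\<dots> = (\<integral>x. (\<i> ^ p * (- \<i>) ^ q) * (x ^ p * cnj x ^ q) \<partial>CN v)"
  proof (rule Bochner_Integration.integral_cong[OF refl])
    fix x
    have "cnj (\<i> * x) = (- \<i>) * cnj x" by simp
    then show "(\<i> * x) ^ p * cnj (\<i> * x) ^ q = (\<i> ^ p * (- \<i>) ^ q) * (x ^ p * cnj x ^ q)"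
      by (simp only: power_mult_distrib mult_ac)
  qed
  also have "\<dots> = (\<i> ^ p * (- \<i>) ^ q) * (\<integral>x. x ^ p * cnj x ^ q \<partial>CN v)"
    by (rule integral_mult_right_zero)
  finally have "(1 - \<i> ^ p * (- \<i>) ^ q) * (\<integral>x. x ^ p * cnj x ^ q \<partial>CN v) = 0"
    by (simp only: left_diff_distrib mult_1) simp
  then show ?thesis using assms by (simp only: mult_eq_0_iff) auto
qed

lemma norm_add_power_le:
  fixes x y :: "'a::real_normed_vector"
  shows "norm (x + y) ^ p \<le> 2 ^ p * (norm x ^ p + norm y ^ p)"
proof -
  have "norm (x + y) ^ p \<le> (2 * max (norm x) (norm y)) ^ p"
    by (rule power_mono) (use norm_triangle_ineq[of x y] in auto)
  also have "\<dots> = 2 ^ p * max (norm x) (norm y) ^ p"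
    by (simp add: power_mult_distrib)
  also have "max (norm x) (norm y) ^ p \<le> norm x ^ p + norm y ^ p"
    by (cases "norm x \<le> norm y") (auto simp: max_def)
  finally show ?thesis by simp
qed

text \<open>Everything reduces to the real normal moments of the two independent parts of variance
  \<open>v / 2\<close>. The value \<open>2 * v\<^sup>2\<close> of the fourth moment is
  \<open>3 + 2 + 3\<close> times \<open>(v / 2)\<^sup>2\<close>, the middle term coming from the
  mixed product.\<close>

lemma
  assumes v: "0 < v"
  shows integrable_CN_power: "integrable (CN v) (\<lambda>x. cmod x ^ p)"
    and CN_moment2: "(\<integral>x. (cmod x)\<^sup>2 \<partial>CN v) = v"
    and CN_moment4: "(\<integral>x. (cmod x) ^ 4 \<partial>CN v) = 2 * v\<^sup>2"
proof -
  define N where "N = half_normal v"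
  interpret N: prob_space N
    unfolding N_def half_normal_def using v by (intro prob_space_normal_density) simp
  have [measurable_cong, simp]: "sets N = sets borel" "space N = UNIV" by (auto simp: N_def)
  interpret NN: pair_prob_space N N ..
  have s: "0 < sqrt (v / 2)" using v by simp
  have iN: "integrable N (\<lambda>x. \<bar>x\<bar> ^ p)" for p
    unfolding N_def half_normal_def
    using integrable_normal_moment_abs[OF s, of 0 p] by (subst integrable_density) auto
  have iN': "integrable N (\<lambda>x. x ^ p)" for p
    unfolding N_def half_normal_def
    using integrable_normal_moment[OF s, of 0 p] by (subst integrable_density) auto
  have m2: "(\<integral>x. x\<^sup>2 \<partial>N) = v / 2"
    unfolding N_def half_normal_def
    using integral_normal_moment_even[OF s, of 0 1] v by (subst integral_density) (auto)
  have m4: "(\<integral>x. x ^ 4 \<partial>N) = 3 * (v / 2)\<^sup>2"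
    unfolding N_def half_normal_def
    using integral_normal_moment_even[OF s, of 0 2] v
    by (subst integral_density) (auto simp: fact_numeral power2_eq_square field_simps)
  have fst: "distr (N \<Otimes>\<^sub>M N) N fst = N" by (rule N.distr_pair_fst)
  have snd: "distr (N \<Otimes>\<^sub>M N) N snd = N"
    by (rule distr_pair_snd) unfold_locales
  have if1: "integrable (N \<Otimes>\<^sub>M N) (\<lambda>p. f (fst p))" "(\<integral>p. f (fst p) \<partial>(N \<Otimes>\<^sub>M N)) = (\<integral>x. f x \<partial>N)"
    if "integrable N f" for f :: "real \<Rightarrow> real"
    using that integrable_distr[of fst "N \<Otimes>\<^sub>M N" N f] integral_distr[of fst "N \<Otimes>\<^sub>M N" N f]
    by (auto simp: fst)
  have if2: "integrable (N \<Otimes>\<^sub>M N) (\<lambda>p. f (snd p))" "(\<integral>p. f (snd p) \<partial>(N \<Otimes>\<^sub>M N)) = (\<integral>x. f x \<partial>N)"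
    if "integrable N f" for f :: "real \<Rightarrow> real"
    using that integrable_distr[of snd "N \<Otimes>\<^sub>M N" N f] integral_distr[of snd "N \<Otimes>\<^sub>M N" N f]
    by (auto simp: snd)
  have ind: "NN.indep_var N fst N snd"
    unfolding NN.indep_var_distribution_eq by (simp add: fst snd)
  have ind2: "NN.indep_var borel (\<lambda>p. (fst p)\<^sup>2) borel (\<lambda>p. (snd p)\<^sup>2)"
    using NN.indep_var_compose[OF ind, of "\<lambda>x. x\<^sup>2" borel "\<lambda>x. x\<^sup>2" borel] by (simp add: comp_def)
  have cross: "integrable (N \<Otimes>\<^sub>M N) (\<lambda>p. (fst p)\<^sup>2 * (snd p)\<^sup>2)"
       "(\<integral>p. (fst p)\<^sup>2 * (snd p)\<^sup>2 \<partial>(N \<Otimes>\<^sub>M N)) = (v / 2)\<^sup>2"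
    using NN.indep_var_integrable[OF ind2 if1(1)[OF iN'] if2(1)[OF iN']]
      NN.indep_var_lebesgue_integral[OF ind2 if1(1)[OF iN'] if2(1)[OF iN']]
      if1(2)[OF iN'[of 2]] if2(2)[OF iN'[of 2]]
    by (auto simp: m2 power2_eq_square[of "v / 2"])
  have Cm[measurable]: "(\<lambda>p. Complex (fst p) (snd p)) \<in> borel_measurable (N \<Otimes>\<^sub>M N)"
    unfolding Complex_eq by measurable
  have CN: "CN v = distr (N \<Otimes>\<^sub>M N) borel (\<lambda>p. Complex (fst p) (snd p))"
    using CN_eq_distr[OF v] by (simp add: N_def split_beta')
  show "integrable (CN v) (\<lambda>x. cmod x ^ p)"
    unfolding CN
  proof (subst integrable_distr_eq)
    show "integrable (N \<Otimes>\<^sub>M N) (\<lambda>q. cmod (Complex (fst q) (snd q)) ^ p)"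
    proof (rule Bochner_Integration.integrable_bound)
      show "integrable (N \<Otimes>\<^sub>M N) (\<lambda>q. 2 ^ p * (\<bar>fst q\<bar> ^ p + \<bar>snd q\<bar> ^ p))"
        by (intro Bochner_Integration.integrable_add integrable_mult_right if1(1)[OF iN] if2(1)[OF iN])
      show "AE q in N \<Otimes>\<^sub>M N. norm (cmod (Complex (fst q) (snd q)) ^ p) \<le> norm (2 ^ p * (\<bar>fst q\<bar> ^ p + \<bar>snd q\<bar> ^ p))"
        using norm_add_power_le[of "complex_of_real (fst _)" "\<i> * complex_of_real (snd _)" p]
        by (intro AE_I2) (simp add: Complex_eq norm_mult)
    qed measurable
  qed auto
  have sq: "(cmod (Complex x y))\<^sup>2 = x\<^sup>2 + y\<^sup>2" for x y by (simp add: cmod_def)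
  have "(\<integral>x. (cmod x)\<^sup>2 \<partial>CN v) = (\<integral>q. (fst q)\<^sup>2 + (snd q)\<^sup>2 \<partial>(N \<Otimes>\<^sub>M N))"
    unfolding CN by (subst integral_distr) (auto simp: sq)
  also have "\<dots> = v"
    using if1[OF iN'[of 2]] if2[OF iN'[of 2]] m2 by simp
  finally show "(\<integral>x. (cmod x)\<^sup>2 \<partial>CN v) = v" .
  have qu: "(cmod (Complex x y)) ^ 4 = x ^ 4 + (2 * (x\<^sup>2 * y\<^sup>2) + y ^ 4)" for x y
  proof -
    have "(cmod (Complex x y)) ^ 4 = ((cmod (Complex x y))\<^sup>2)\<^sup>2" by simp
    also have "\<dots> = (x\<^sup>2 + y\<^sup>2)\<^sup>2" by (simp only: sq)
    also have "\<dots> = x ^ 4 + (2 * (x\<^sup>2 * y\<^sup>2) + y ^ 4)"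
      by (simp add: power2_eq_square power4_eq_xxxx algebra_simps)
    finally show ?thesis .
  qed
  have "(\<integral>x. (cmod x) ^ 4 \<partial>CN v) =
      (\<integral>q. (fst q) ^ 4 + (2 * ((fst q)\<^sup>2 * (snd q)\<^sup>2) + (snd q) ^ 4) \<partial>(N \<Otimes>\<^sub>M N))"
    unfolding CN by (subst integral_distr) (auto simp: qu)
  also have "\<dots> = 3 * (v / 2)\<^sup>2 + (2 * (v / 2)\<^sup>2 + 3 * (v / 2)\<^sup>2)"
    using if1[OF iN'[of 4]] if2[OF iN'[of 4]] m4 cross by simp
  also have "\<dots> = 2 * v\<^sup>2" by (simp add: power2_eq_square)
  finally show "(\<integral>x. (cmod x) ^ 4 \<partial>CN v) = 2 * v\<^sup>2" .
qed

text \<open>Distinct exponents up to 2 differ by 1 or 2, hence not by a multiple of 4, and the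
  quarter turn already forces the value 0. Equal exponents give \<open>1\<close>, \<open>v\<close>
  and \<open>2 * v\<^sup>2\<close>, which is \<open>fact p * v ^ p\<close>.\<close>

lemma CN_moments:
  assumes "0 < v" "p \<le> 2" "q \<le> 2"
  shows "(\<integral>x. x ^ p * cnj x ^ q \<partial>CN v) = (if p = q then of_real (fact p * v ^ p) else 0)"
proof (cases "p = q")
  case False
  have "p \<in> {0,1,2}" "q \<in> {0,1,2}" using assms by auto
  with False have "\<i> ^ p * (- \<i>) ^ q \<noteq> 1" by (auto simp: complex_eq_iff power2_eq_square)
  then show ?thesis using False CN_moment_zero[of p q v] by simp
next
  case True
  interpret prob_space "CN v" by (rule prob_space_CN) fact
  have *: "x * cnj x = of_real ((cmod x)\<^sup>2)" for x
    by (simp only: complex_norm_square)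
  have "p = 0 \<or> p = 1 \<or> p = 2" using assms by auto
  then show ?thesis
  proof (elim disjE)
    assume p: "p = 2"
    have "x\<^sup>2 * (cnj x)\<^sup>2 = of_real (cmod x ^ 4)" for x
      unfolding power_mult_distrib[symmetric] * by (simp only: of_real_power[symmetric]) simp
    then have "(\<integral>x. x ^ p * cnj x ^ q \<partial>CN v) = (\<integral>x. of_real (cmod x ^ 4) \<partial>CN v)"
      using True p by simp
    also have "\<dots> = of_real (2 * v\<^sup>2)" by (simp only: integral_complex_of_real CN_moment4[OF assms(1)])
    finally show ?thesis using True p by simp
  next
    assume p: "p = 1"
    with True have q: "q = 1" by simp
    from p have "(\<integral>x. x ^ p * cnj x ^ q \<partial>CN v) = (\<integral>x. of_real ((cmod x)\<^sup>2) \<partial>CN v)"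
      using True by (simp only: power_one_right *)
    also have "\<dots> = of_real v" by (simp only: integral_complex_of_real CN_moment2[OF assms(1)])
    finally show ?thesis using p q by simp
  qed (use True prob_space in auto)
qed


text \<open>The substitution behind the formula is \<open>w = c * (r * x + y)\<close>,
  \<open>e = w - x\<close>, whose inverse has Jacobian \<open>(1 / c)\<^sup>2\<close>. For this
  value of \<open>c\<close> the mixed terms of the two quadratic forms in the exponent cancel: it is
  the orthogonality of the linear MMSE estimate \<open>w\<close> and its error \<open>e\<close>,
  seen on densities.\<close>

lemma CN_density_shear:
  fixes r \<beta> :: real
  assumes "0 < r" "0 < \<beta>"
  defines "c \<equiv> r * \<beta> / (1 + r\<^sup>2 * \<beta>)"
  shows "(1 / c)\<^sup>2 * (CN_density \<beta> (w - e) * CN_density 1 (complex_of_real (1 / c) * w - complex_of_real r * (w - e))) =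
     CN_density (r\<^sup>2 * \<beta>\<^sup>2 / (1 + r\<^sup>2 * \<beta>)) w * CN_density (\<beta> / (1 + r\<^sup>2 * \<beta>)) e"
proof -
  define k where "k = 1 + r\<^sup>2 * \<beta>"
  have k: "0 < k" using assms by (simp add: k_def add_pos_pos)
  have c: "1 / c = k / (r * \<beta>)" by (simp add: c_def k_def)
  have w: "complex_of_real (1 / c) * w - complex_of_real r * (w - e) = complex_of_real (1 / (r * \<beta>)) * w + complex_of_real r * e"
  proof -
    have "1 / c = 1 / (r * \<beta>) + r" using assms unfolding c k_def by (simp add: field_simps power2_eq_square)
    then have "complex_of_real (1 / c) = complex_of_real (1 / (r * \<beta>)) + complex_of_real r" by (simp only: of_real_add)
    then show ?thesis by (simp only: ring_distribs) simp
  qed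
  define W where "W = (cmod w)\<^sup>2"
  define E where "E = (cmod e)\<^sup>2"
  define X where "X = Re w * Re e + Im w * Im e"
  have n1: "(cmod (w - e))\<^sup>2 = W + E - 2 * X"
    by (simp add: W_def E_def X_def cmod_power2) (simp add: power2_eq_square algebra_simps)
  have n2: "(cmod (complex_of_real a * w + complex_of_real r * e))\<^sup>2 = a\<^sup>2 * W + r\<^sup>2 * E + 2 * a * r * X" for a
    by (simp add: W_def E_def X_def cmod_power2) (simp add: power2_eq_square algebra_simps)
  have e: "- (W + E - 2 * X) / \<beta> + - ((1 / (r * \<beta>))\<^sup>2 * W + r\<^sup>2 * E + 2 * (1 / (r * \<beta>)) * r * X) / 1 =
      - W / (r\<^sup>2 * \<beta>\<^sup>2 / k) + - E / (\<beta> / k)"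
    using assms k by (simp add: field_simps power2_eq_square) (simp add: k_def power2_eq_square algebra_simps)
  have pre: "(k / (r * \<beta>))\<^sup>2 * (u / (pi * \<beta>) * (t / (pi * 1))) = u * t / (pi * (r\<^sup>2 * \<beta>\<^sup>2 / k)) / (pi * (\<beta> / k))" for u t
    using assms(1,2) k by (simp add: field_simps power2_eq_square)
  have "exp (- (W + E - 2 * X) / \<beta>) * exp (- ((1 / (r * \<beta>))\<^sup>2 * W + r\<^sup>2 * E + 2 * (1 / (r * \<beta>)) * r * X) / 1) =
      exp (- W / (r\<^sup>2 * \<beta>\<^sup>2 / k)) * exp (- E / (\<beta> / k))"
    by (simp only: exp_add[symmetric] e)
  then show ?thesis
    unfolding CN_density_def w n1 n2
    unfolding c k_def[symmetric] W_def[symmetric] E_def[symmetric] pre by simp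
qed

text \<open>The joint law of estimate and error is computed by two substitutions in a single complex
  variable with an exchange of the integrals between them: \<open>y\<close> becomes \<open>w\<close>
  for fixed \<open>x\<close>, then \<open>x\<close> becomes \<open>e = w - x\<close> for fixed
  \<open>w\<close>. With \<open>r\<^sup>2\<close> the pilot energy, the two variances are the
  \<open>\<gamma>\<close> and \<open>\<beta> - \<gamma>\<close> of the system model.\<close>

lemma (in prob_space) mmse_decomposition:
  fixes r \<beta> :: real
  assumes r: "0 < r" "0 < \<beta>"
    and X: "distr M borel X = CN \<beta>" and Y: "distr M borel Y = CN 1"
    and ind: "indep_var borel X borel Y"
  defines "H \<equiv> \<lambda>\<omega>. complex_of_real (r * \<beta> / (1 + r\<^sup>2 * \<beta>)) * (complex_of_real r * X \<omega> + Y \<omega>)"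
  shows "indep_var borel H borel (\<lambda>\<omega>. H \<omega> - X \<omega>)"
    and "distr M borel H = CN (r\<^sup>2 * \<beta>\<^sup>2 / (1 + r\<^sup>2 * \<beta>))"
    and "distr M borel (\<lambda>\<omega>. H \<omega> - X \<omega>) = CN (\<beta> / (1 + r\<^sup>2 * \<beta>))"
proof -
  define c where "c = r * \<beta> / (1 + r\<^sup>2 * \<beta>)"
  have k: "0 < 1 + r\<^sup>2 * \<beta>" using r by (simp add: add_pos_pos)
  have c: "0 < c" using r k by (simp add: c_def)
  define \<gamma> where "\<gamma> = r\<^sup>2 * \<beta>\<^sup>2 / (1 + r\<^sup>2 * \<beta>)"
  define \<delta> where "\<delta> = \<beta> / (1 + r\<^sup>2 * \<beta>)"
  have pos: "0 < \<gamma>" "0 < \<delta>" using r k by (auto simp: \<gamma>_def \<delta>_def)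
  have [measurable]: "X \<in> borel_measurable M" "Y \<in> borel_measurable M"
    using ind by (auto dest: indep_var_rv1 indep_var_rv2)
  have H[measurable]: "H \<in> borel_measurable M" unfolding H_def by measurable
  interpret G: prob_space "CN \<gamma>" by (rule prob_space_CN) fact
  interpret D: prob_space "CN \<delta>" by (rule prob_space_CN) fact
  interpret B: prob_space "CN \<beta>" by (rule prob_space_CN) fact
  interpret I: prob_space "CN 1" by (rule prob_space_CN) simp
  interpret GD: pair_prob_space "CN \<gamma>" "CN \<delta>" ..
  have XY: "distr M (borel \<Otimes>\<^sub>M borel) (\<lambda>\<omega>. (X \<omega>, Y \<omega>)) = CN \<beta> \<Otimes>\<^sub>M CN 1"
    using ind unfolding indep_var_distribution_eq X Y by simp
  have J: "distr M (borel \<Otimes>\<^sub>M borel) (\<lambda>\<omega>. (H \<omega>, H \<omega> - X \<omega>)) = CN \<gamma> \<Otimes>\<^sub>M CN \<delta>" (is "?J = _")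
  proof (rule measure_eqI)
    show "sets ?J = sets (CN \<gamma> \<Otimes>\<^sub>M CN \<delta>)" by (simp cong: sets_pair_measure_cong)
    fix A assume "A \<in> sets ?J"
    then have A[measurable]: "A \<in> sets (borel \<Otimes>\<^sub>M borel)" by simp
    define F where "F = (\<lambda>x y. indicator A (complex_of_real c * (complex_of_real r * x + y),
        complex_of_real c * (complex_of_real r * x + y) - x) :: ennreal)"
    have F[measurable]: "(\<lambda>(x, y). F x y) \<in> borel_measurable (borel \<Otimes>\<^sub>M borel)"
      unfolding F_def by measurable
    have "emeasure ?J A = (\<integral>\<^sup>+p. indicator A p \<partial>?J)" by simp
    also have "\<dots> = (\<integral>\<^sup>+\<omega>. F (X \<omega>) (Y \<omega>) \<partial>M)"
      by (subst nn_integral_distr) (auto simp: F_def H_def c_def)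
    also have "\<dots> = (\<integral>\<^sup>+p. (case p of (x, y) \<Rightarrow> F x y) \<partial>(CN \<beta> \<Otimes>\<^sub>M CN 1))"
      unfolding XY[symmetric] by (subst nn_integral_distr) auto
    also have "\<dots> = (\<integral>\<^sup>+x. \<integral>\<^sup>+y. F x y \<partial>CN 1 \<partial>CN \<beta>)"
      by (subst I.nn_integral_fst[symmetric]) (auto cong: measurable_cong_sets sets_pair_measure_cong)
    also have "\<dots> = (\<integral>\<^sup>+x. ennreal (CN_density \<beta> x) * (\<integral>\<^sup>+y. ennreal (CN_density 1 y) * F x y \<partial>lborel) \<partial>lborel)"
      unfolding CN_def by (simp add: nn_integral_density)
    also have "\<dots> = (\<integral>\<^sup>+x. \<integral>\<^sup>+y. ennreal (CN_density \<beta> x) * (ennreal (CN_density 1 y) * F x y) \<partial>lborel \<partial>lborel)"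
      by (simp add: nn_integral_cmult)
    also have "\<dots> = (\<integral>\<^sup>+x. \<integral>\<^sup>+w. ennreal ((1 / c)\<^sup>2) * (ennreal (CN_density \<beta> x) * (ennreal (CN_density 1 (complex_of_real (1 / c) * w - complex_of_real r * x)) *
        indicator A (w, w - x))) \<partial>lborel \<partial>lborel)"
    proof (rule nn_integral_cong)
      fix x
      have F': "F x (- (complex_of_real r * x) + complex_of_real (1 / c) * w) = indicator A (w, w - x)" for w
        using c by (simp add: F_def)
      show "(\<integral>\<^sup>+y. ennreal (CN_density \<beta> x) * (ennreal (CN_density 1 y) * F x y) \<partial>lborel) =
        (\<integral>\<^sup>+w. ennreal ((1 / c)\<^sup>2) * (ennreal (CN_density \<beta> x) * (ennreal (CN_density 1 (complex_of_real (1 / c) * w - complex_of_real r * x)) *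
        indicator A (w, w - x))) \<partial>lborel)"
        using c
        by (subst nn_integral_complex_affine[where c="1 / c" and t="- (complex_of_real r * x)"])
           (simp_all only: F', simp_all add: nn_integral_cmult)
    qed
    also have "\<dots> = (\<integral>\<^sup>+w. \<integral>\<^sup>+x. ennreal ((1 / c)\<^sup>2) * (ennreal (CN_density \<beta> x) * (ennreal (CN_density 1 (complex_of_real (1 / c) * w - complex_of_real r * x)) *
        indicator A (w, w - x))) \<partial>lborel \<partial>lborel)"
      by (rule lborel_pair.Fubini') measurable
    also have "\<dots> = (\<integral>\<^sup>+w. \<integral>\<^sup>+e. ennreal (CN_density \<gamma> w) * (ennreal (CN_density \<delta> e) * indicator A (w, e)) \<partial>lborel \<partial>lborel)"
    proof (rule nn_integral_cong)
      fix w :: complex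
      have "(\<integral>\<^sup>+x. ennreal ((1 / c)\<^sup>2) * (ennreal (CN_density \<beta> x) * (ennreal (CN_density 1 (complex_of_real (1 / c) * w - complex_of_real r * x)) *
        indicator A (w, w - x))) \<partial>lborel) =
        (\<integral>\<^sup>+e. ennreal ((1 / c)\<^sup>2) * (ennreal (CN_density \<beta> (w - e)) * (ennreal (CN_density 1 (complex_of_real (1 / c) * w - complex_of_real r * (w - e))) *
        indicator A (w, e))) \<partial>lborel)"
        by (subst nn_integral_complex_affine[where c="-1" and t=w]) auto
      also have "\<dots> = (\<integral>\<^sup>+e. ennreal (CN_density \<gamma> w) * (ennreal (CN_density \<delta> e) * indicator A (w, e)) \<partial>lborel)"
      proof (rule nn_integral_cong)
        fix e :: complex
        have "ennreal ((1 / c)\<^sup>2) * (ennreal (CN_density \<beta> (w - e)) * ennreal (CN_density 1 (complex_of_real (1 / c) * w - complex_of_real r * (w - e)))) =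
           ennreal (CN_density \<gamma> w) * ennreal (CN_density \<delta> e)"
          using CN_density_shear[OF r, of w e] r pos
          by (simp only: ennreal_mult'[symmetric] CN_density_nonneg zero_le_power2 zero_less_one mult_nonneg_nonneg c_def \<gamma>_def \<delta>_def ennreal_mult[symmetric])
        then show "ennreal ((1 / c)\<^sup>2) * (ennreal (CN_density \<beta> (w - e)) * (ennreal (CN_density 1 (complex_of_real (1 / c) * w - complex_of_real r * (w - e))) *
          indicator A (w, e))) = ennreal (CN_density \<gamma> w) * (ennreal (CN_density \<delta> e) * indicator A (w, e))"
          by (simp only: mult.assoc[symmetric])
      qed
      finally show "(\<integral>\<^sup>+x. ennreal ((1 / c)\<^sup>2) * (ennreal (CN_density \<beta> x) * (ennreal (CN_density 1 (complex_of_real (1 / c) * w - complex_of_real r * x)) *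
        indicator A (w, w - x))) \<partial>lborel) = (\<integral>\<^sup>+e. ennreal (CN_density \<gamma> w) * (ennreal (CN_density \<delta> e) * indicator A (w, e)) \<partial>lborel)" .
    qed
    also have "\<dots> = (\<integral>\<^sup>+w. \<integral>\<^sup>+e. indicator A (w, e) \<partial>CN \<delta> \<partial>CN \<gamma>)"
      unfolding CN_def by (simp add: nn_integral_density nn_integral_cmult)
    also have "\<dots> = (\<integral>\<^sup>+p. indicator A p \<partial>(CN \<gamma> \<Otimes>\<^sub>M CN \<delta>))"
      by (subst D.nn_integral_fst[symmetric]) (auto cong: measurable_cong_sets sets_pair_measure_cong)
    also have "\<dots> = emeasure (CN \<gamma> \<Otimes>\<^sub>M CN \<delta>) A"
      by (rule nn_integral_indicator) (simp cong: sets_pair_measure_cong)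
    finally show "emeasure ?J A = emeasure (CN \<gamma> \<Otimes>\<^sub>M CN \<delta>) A" .
  qed
  have "distr M borel H = distr ?J borel fst"
    by (subst distr_distr) (auto simp: comp_def)
  also have "\<dots> = CN \<gamma>"
    unfolding J using D.distr_pair_fst[of "CN \<gamma>"] by (simp cong: distr_cong)
  finally show H': "distr M borel H = CN (r\<^sup>2 * \<beta>\<^sup>2 / (1 + r\<^sup>2 * \<beta>))" by (simp add: \<gamma>_def)
  have "distr M borel (\<lambda>\<omega>. H \<omega> - X \<omega>) = distr ?J borel snd"
    by (subst distr_distr) (auto simp: comp_def)
  also have "\<dots> = CN \<delta>"
    unfolding J using distr_pair_snd[OF G.prob_space_axioms D.sigma_finite_measure_axioms] by (simp cong: distr_cong)
  finally show D': "distr M borel (\<lambda>\<omega>. H \<omega> - X \<omega>) = CN (\<beta> / (1 + r\<^sup>2 * \<beta>))" by (simp add: \<delta>_def)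
  show "indep_var borel H borel (\<lambda>\<omega>. H \<omega> - X \<omega>)"
    unfolding indep_var_distribution_eq using J H' D' by (simp add: \<gamma>_def \<delta>_def)
qed

section \<open>Mismatched decoding\<close>

text \<open>Chebyshev's inequality. Pairwise independence removes the off-diagonal covariances, and
  centering can only lower a second moment, so the raw bound \<open>C\<close> also bounds each
  variance.\<close>

lemma (in prob_space) weak_law_pairwise:
  fixes W :: "nat \<Rightarrow> 'a \<Rightarrow> real"
  assumes W[measurable]: "\<And>b. W b \<in> borel_measurable M"
    and sq: "\<And>b. integrable M (\<lambda>\<omega>. (W b \<omega>)\<^sup>2)" "\<And>b. expectation (\<lambda>\<omega>. (W b \<omega>)\<^sup>2) \<le> C"
    and mean: "\<And>b. expectation (W b) = m"
    and ind: "\<And>b b'. b \<noteq> b' \<Longrightarrow> indep_var borel (W b) borel (W b')"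
    and pos: "0 < \<delta>" "0 < n"
  shows "prob {\<omega>\<in>space M. real n * \<delta> \<le> \<bar>(\<Sum>b<n. W b \<omega>) - real n * m\<bar>} \<le> C / (real n * \<delta>\<^sup>2)"
proof -
  have intW: "integrable M (W b)" for b
    by (rule square_integrable_imp_integrable) (use sq in auto)
  define Z where "Z b \<omega> = W b \<omega> - m" for b \<omega>
  have Z[measurable]: "Z b \<in> borel_measurable M" for b unfolding Z_def by measurable
  have intZ: "integrable M (Z b)" and EZ: "expectation (Z b) = 0" for b
    using intW mean[of b] by (auto simp: Z_def[abs_def] prob_space)
  have intZ2: "integrable M (\<lambda>\<omega>. (Z b \<omega>)\<^sup>2)" for b
    using sq(1)[of b] intW[of b] by (simp add: Z_def power2_diff)
  have EZ2: "expectation (\<lambda>\<omega>. (Z b \<omega>)\<^sup>2) \<le> C" for b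
  proof -
    have "expectation (\<lambda>\<omega>. (Z b \<omega>)\<^sup>2) = expectation (\<lambda>\<omega>. (W b \<omega>)\<^sup>2) - m\<^sup>2"
      using sq(1)[of b] intW[of b] mean[of b] by (simp add: Z_def power2_diff prob_space) (simp add: power2_eq_square)
    also have "\<dots> \<le> C" using sq(2)[of b] by (simp add: algebra_simps add_increasing2)
    finally show ?thesis .
  qed
  have cross: "integrable M (\<lambda>\<omega>. Z b \<omega> * Z b' \<omega>) \<and>
      expectation (\<lambda>\<omega>. Z b \<omega> * Z b' \<omega>) \<le> (if b = b' then C else 0)" for b b'
  proof (cases "b = b'")
    case True
    then show ?thesis using intZ2[of b] EZ2[of b] by (simp add: power2_eq_square)
  next
    case False
    have "indep_var borel (Z b) borel (Z b')"
      using indep_var_compose[OF ind[OF False], of "\<lambda>x. x - m" borel "\<lambda>x. x - m" borel]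
      by (simp add: comp_def Z_def[abs_def])
    from indep_var_integrable[OF this intZ intZ] indep_var_lebesgue_integral[OF this intZ intZ]
    show ?thesis using False by (simp add: EZ)
  qed
  have eq: "(\<Sum>b<n. W b \<omega>) - real n * m = (\<Sum>b<n. Z b \<omega>)" for \<omega>
    by (simp add: Z_def sum_subtractf)
  have sq_eq: "(\<Sum>b<n. Z b \<omega>)\<^sup>2 = (\<Sum>b<n. \<Sum>b'<n. Z b \<omega> * Z b' \<omega>)" for \<omega>
    by (simp add: power2_eq_square sum_product)
  have intS: "integrable M (\<lambda>\<omega>. (\<Sum>b<n. Z b \<omega>)\<^sup>2)"
    unfolding sq_eq using cross by (intro Bochner_Integration.integrable_sum) auto
  have "expectation (\<lambda>\<omega>. (\<Sum>b<n. Z b \<omega>)\<^sup>2) = (\<Sum>b<n. \<Sum>b'<n. expectation (\<lambda>\<omega>. Z b \<omega> * Z b' \<omega>))"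
    unfolding sq_eq using cross by (simp add: Bochner_Integration.integral_sum Bochner_Integration.integrable_sum)
  also have "\<dots> \<le> (\<Sum>b<n. \<Sum>b'<n. if b = b' then C else 0)"
    using cross by (intro sum_mono) auto
  also have "\<dots> = real n * C" by simp
  finally have ES: "expectation (\<lambda>\<omega>. (\<Sum>b<n. Z b \<omega>)\<^sup>2) \<le> real n * C" .
  have "{\<omega>\<in>space M. real n * \<delta> \<le> \<bar>(\<Sum>b<n. W b \<omega>) - real n * m\<bar>} =
      {\<omega>\<in>space M. (real n * \<delta>)\<^sup>2 \<le> (\<Sum>b<n. Z b \<omega>)\<^sup>2}"
    using pos unfolding eq by (intro Collect_cong conj_cong refl) (simp add: abs_le_square_iff[symmetric])
  also have "prob \<dots> \<le> expectation (\<lambda>\<omega>. (\<Sum>b<n. Z b \<omega>)\<^sup>2) / (real n * \<delta>)\<^sup>2"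
    using pos by (intro integral_Markov_inequality_measure[where A = "{}"] intS) auto
  also have "\<dots> \<le> (real n * C) / (real n * \<delta>)\<^sup>2"
    using ES by (intro divide_right_mono) auto
  also have "\<dots> = C / (real n * \<delta>\<^sup>2)"
    using pos by (simp add: power2_eq_square)
  finally show ?thesis .
qed

text \<open>The information density of a scalar Gaussian channel with gain \<open>h\<close> and noise variance
  \<open>s2\<close>; it serves as a decoding metric only, the actual channel being a different one.\<close>

definition info_density :: "real \<Rightarrow> real \<Rightarrow> complex \<Rightarrow> complex \<Rightarrow> real" where
  "info_density h s2 x y =
     ln (1 + h\<^sup>2 / s2) + (cmod y)\<^sup>2 / (h\<^sup>2 + s2) - (cmod (y - of_real h * x))\<^sup>2 / s2"

lemma info_density_measurable[measurable]:
  "(\<lambda>(x, y). info_density h s2 x y) \<in> borel_measurable (borel \<Otimes>\<^sub>M borel)"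
  unfolding info_density_def by measurable

text \<open>For the auxiliary Gaussian channel the exponential of the information density is the
  ratio of the conditional to the marginal output density. Multiplied by the input density it
  becomes, by Bayes' rule, the posterior density of the input given \<open>y\<close>: normal with
  mean \<open>m\<close> and variance \<open>s2 / (h\<^sup>2 + s2)\<close>, hence of total mass 1
  whatever \<open>y\<close> is.\<close>

lemma CN_exp_info_density:
  assumes s2: "0 < s2"
  shows "(\<integral>\<^sup>+x. ennreal (exp (info_density h s2 x y)) \<partial>CN 1) = 1"
proof -
  define k where "k = h\<^sup>2 + s2"
  have k: "0 < k" using s2 by (simp add: k_def add_nonneg_pos)
  define m where "m = of_real (h / k) * y"
  have eq: "CN_density 1 x * exp (info_density h s2 x y) = CN_density (s2 / k) (x - m)" for x
  proof -
    define X where "X = (cmod x)\<^sup>2"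
    define Y where "Y = (cmod y)\<^sup>2"
    define P where "P = Re x * Re y + Im x * Im y"
    have n1: "(cmod (y - of_real h * x))\<^sup>2 = Y + h\<^sup>2 * X - 2 * h * P"
      unfolding X_def Y_def P_def by (simp add: cmod_power2) (simp add: power2_eq_square algebra_simps)
    have n2: "(cmod (x - m))\<^sup>2 = X + (h / k)\<^sup>2 * Y - 2 * (h / k) * P"
      unfolding X_def Y_def P_def m_def of_real_mult
      by (simp add: cmod_power2) (simp add: power2_eq_square algebra_simps diff_divide_distrib add_divide_distrib)
    have l: "exp (ln (1 + h\<^sup>2 / s2)) = k / s2"
      using s2 k by (subst exp_ln) (auto simp: k_def field_simps add_pos_nonneg)
    have e: "- X + (Y / k - (Y + h\<^sup>2 * X - 2 * h * P) / s2) = - (X + (h / k)\<^sup>2 * Y - 2 * (h / k) * P) / (s2 / k)"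
    proof -
      have "(- X + (Y / k - (Y + h\<^sup>2 * X - 2 * h * P) / s2)) * (s2 * k) = - (k * (h\<^sup>2 + s2) * X - 2 * h * P * k + Y * (k - s2))"
        using s2 k by (simp add: field_simps)
      also have "\<dots> = - (X + (h / k)\<^sup>2 * Y - 2 * (h / k) * P) / (s2 / k) * (s2 * k)"
        using s2 k unfolding k_def[symmetric] by (simp add: field_simps power2_eq_square) (simp add: k_def algebra_simps power2_eq_square)
      finally show ?thesis using s2 k by (metis mult_right_cancel mult_eq_0_iff less_irrefl)
    qed
    have "CN_density 1 x * exp (info_density h s2 x y) =
        exp (ln (1 + h\<^sup>2 / s2)) * exp (- X + (Y / k - (Y + h\<^sup>2 * X - 2 * h * P) / s2)) / pi"
      unfolding CN_density_def info_density_def n1 X_def[symmetric] Y_def[symmetric] k_def[symmetric]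
      by (simp add: exp_add[symmetric] exp_diff[symmetric] mult_exp_exp algebra_simps)
    also have "\<dots> = CN_density (s2 / k) (x - m)"
      unfolding l e CN_density_def n2 using s2 k by (simp add: field_simps)
    finally show ?thesis .
  qed
  have "(\<integral>\<^sup>+x. ennreal (exp (info_density h s2 x y)) \<partial>CN 1) =
      (\<integral>\<^sup>+x. ennreal (CN_density 1 x * exp (info_density h s2 x y)) \<partial>lborel)"
    unfolding CN_def by (subst nn_integral_density) (auto simp: ennreal_mult' CN_density_nonneg)
  also have "\<dots> = 1"
    unfolding eq using s2 k by (intro nn_integral_CN_density) simp
  finally show ?thesis .
qed

text \<open>Markov's inequality for the exponential, whose mean over independent inputs is a product
  of ones. Since the output \<open>c\<close> is an arbitrary fixed sequence, this bounds the chance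
  that a wrong codeword passes, irrespective of the true channel.\<close>

lemma (in prob_space) info_density_tail:
  assumes I: "finite I" and s2: "0 < s2"
    and ind: "indep_vars (\<lambda>_. borel) X I"
    and law: "\<And>u. u \<in> I \<Longrightarrow> distr M borel (X u) = CN 1"
  shows "prob {\<omega>\<in>space M. \<theta> \<le> (\<Sum>u\<in>I. info_density h s2 (X u \<omega>) (c u))} \<le> exp (- \<theta>)"
proof -
  have X[measurable]: "X u \<in> borel_measurable M" if "u \<in> I" for u
    using ind that unfolding indep_vars_def by auto
  define f where "f u x = exp (info_density h s2 x (c u))" for u x
  have f[measurable]: "f u \<in> borel_measurable borel" for u unfolding f_def by measurable
  have "indep_vars (\<lambda>_. borel) (\<lambda>u. f u \<circ> X u) I"
    by (rule indep_vars_compose[OF ind]) simp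
  then have ind': "indep_vars (\<lambda>_. borel) (\<lambda>u \<omega>. ennreal (f u (X u \<omega>))) I"
    using indep_vars_compose2[of "\<lambda>_. borel" "\<lambda>u \<omega>. f u (X u \<omega>)" I "\<lambda>_. ennreal" "\<lambda>_. borel"] by (simp add: comp_def)
  have "(\<integral>\<^sup>+\<omega>. ennreal (exp (\<Sum>u\<in>I. info_density h s2 (X u \<omega>) (c u))) \<partial>M) =
      (\<integral>\<^sup>+\<omega>. (\<Prod>u\<in>I. ennreal (f u (X u \<omega>))) \<partial>M)"
    using I by (simp add: f_def exp_sum prod_ennreal)
  also have "\<dots> = (\<Prod>u\<in>I. \<integral>\<^sup>+\<omega>. ennreal (f u (X u \<omega>)) \<partial>M)"
    by (rule indep_vars_nn_integral[OF I ind']) auto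
  also have "\<dots> = (\<Prod>u\<in>I. 1)"
  proof (rule prod.cong[OF refl])
    fix u assume u: "u \<in> I"
    have "(\<integral>\<^sup>+\<omega>. ennreal (f u (X u \<omega>)) \<partial>M) = (\<integral>\<^sup>+x. ennreal (f u x) \<partial>distr M borel (X u))"
      using u by (subst nn_integral_distr) auto
    then show "(\<integral>\<^sup>+\<omega>. ennreal (f u (X u \<omega>)) \<partial>M) = 1"
      using u CN_exp_info_density[OF s2] by (simp add: law f_def)
  qed
  finally have E: "(\<integral>\<^sup>+\<omega>. ennreal (exp (\<Sum>u\<in>I. info_density h s2 (X u \<omega>) (c u))) \<partial>M) = 1" by simp
  define S where "S \<omega> = (\<Sum>u\<in>I. info_density h s2 (X u \<omega>) (c u))" for \<omega>
  have S[measurable]: "S \<in> borel_measurable M" unfolding S_def by measurable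
  have "ennreal (exp \<theta>) * emeasure M {\<omega>\<in>space M. \<theta> \<le> S \<omega>} =
      (\<integral>\<^sup>+\<omega>. ennreal (exp \<theta>) * indicator {\<omega>\<in>space M. \<theta> \<le> S \<omega>} \<omega> \<partial>M)"
    by (subst nn_integral_cmult_indicator) auto
  also have "\<dots> \<le> (\<integral>\<^sup>+\<omega>. ennreal (exp (S \<omega>)) \<partial>M)"
    by (intro nn_integral_mono) (auto simp: indicator_def intro!: ennreal_leI)
  also have "\<dots> = 1" using E by (simp add: S_def)
  finally have "exp \<theta> * prob {\<omega>\<in>space M. \<theta> \<le> S \<omega>} \<le> 1"
    by (simp add: emeasure_eq_measure ennreal_mult'[symmetric])
  then show ?thesis
    unfolding S_def by (simp add: exp_minus field_simps)
qed

text \<open>The conditions on the metric concern the sums \<open>W b\<close> over whole intervals,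
  because the symbols of an interval share the gain \<open>a b\<close>. The independence
  \<open>ind\<close> of inputs and channel state is what identifies the conditional law given a
  codeword with the law of the channel driven by that codeword, as \<open>feinstein\<close>
  requires. The code occupies the first \<open>m\<close> of the \<open>B\<close> intervals; the rest
  serves to meet the energy constraint with equality.\<close>

theorem (in prob_space) achievable_rate_mismatched:
  fixes a :: "nat \<Rightarrow> 'a \<Rightarrow> complex" and v xi :: "nat \<Rightarrow> nat \<Rightarrow> 'a \<Rightarrow> complex"
  assumes D: "finite D" "D \<noteq> {}"
    and Y: "\<And>x b t \<omega>. t \<in> D \<Longrightarrow> \<omega> \<in> space M \<Longrightarrow> Y x b t \<omega> = a b \<omega> * x b t + v b t \<omega>"
    and xi_law: "\<And>b t. t \<in> D \<Longrightarrow> distr M borel (xi b t) = CN 1"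
    and xi_ind: "indep_vars (\<lambda>_. borel) (\<lambda>u. xi (fst u) (snd u)) (UNIV \<times> D)"
    and a: "\<And>b. a b \<in> borel_measurable M" and v: "\<And>b t. t \<in> D \<Longrightarrow> v b t \<in> borel_measurable M"
    and ind: "\<And>B. distr M (PiM ({..<B} \<times> D) (\<lambda>_. borel) \<Otimes>\<^sub>M PiM ({..<B} \<times> D) (\<lambda>_. borel \<Otimes>\<^sub>M borel))
          (\<lambda>\<omega>. (\<lambda>u\<in>{..<B} \<times> D. xi (fst u) (snd u) \<omega>, \<lambda>u\<in>{..<B} \<times> D. (a (fst u) \<omega>, v (fst u) (snd u) \<omega>))) =
        distr M (PiM ({..<B} \<times> D) (\<lambda>_. borel)) (\<lambda>\<omega>. \<lambda>u\<in>{..<B} \<times> D. xi (fst u) (snd u) \<omega>) \<Otimes>\<^sub>M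
        distr M (PiM ({..<B} \<times> D) (\<lambda>_. borel \<Otimes>\<^sub>M borel)) (\<lambda>\<omega>. \<lambda>u\<in>{..<B} \<times> D. (a (fst u) \<omega>, v (fst u) (snd u) \<omega>))"
    and pos: "0 < s2" "h \<noteq> 0"
  defines "W \<equiv> \<lambda>b \<omega>. \<Sum>t\<in>D. info_density h s2 (xi b t \<omega>) (a b \<omega> * xi b t \<omega> + v b t \<omega>)"
  assumes W_sq: "\<And>b. integrable M (\<lambda>\<omega>. (W b \<omega>)\<^sup>2)" "\<And>b. expectation (\<lambda>\<omega>. (W b \<omega>)\<^sup>2) \<le> C"
    and W_mean: "\<And>b. expectation (W b) = real (card D) * ln (1 + h\<^sup>2 / s2)"
    and W_ind: "\<And>b b'. b \<noteq> b' \<Longrightarrow> indep_var borel (W b) borel (W b')"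
    and R: "R * real T * ln 2 < real (card D) * ln (1 + h\<^sup>2 / s2)"
  shows "achievable_rate M T D Y R"
proof -
  define d where "d = real (card D)"
  have d: "0 < d" using D by (simp add: d_def card_gt_0_iff)
  define c where "c = d * ln (1 + h\<^sup>2 / s2)"
  have "1 < 1 + h\<^sup>2 / s2" using pos by simp
  then have "0 < ln (1 + h\<^sup>2 / s2)" by (rule ln_gt_zero)
  then have c: "0 < c" using d by (simp add: c_def)
  have xi_m[measurable]: "xi b t \<in> borel_measurable M" if "t \<in> D" for b t
    using xi_ind that unfolding indep_vars_def by force
  note [measurable] = a v
  have W_m[measurable]: "W b \<in> borel_measurable M" for b
    unfolding W_def by measurable
  \<comment> \<open>The energy of the Gaussian input in interval \<open>b\<close>. It gets a law of
    large numbers of its own, since codewords have to respect an energy budget.\<close>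
  define E where "E b \<omega> = (\<Sum>t\<in>D. (cmod (xi b t \<omega>))\<^sup>2)" for b \<omega>
  have E_m[measurable]: "E b \<in> borel_measurable M" for b unfolding E_def by measurable
  have xi_pow: "integrable M (\<lambda>\<omega>. cmod (xi b t \<omega>) ^ p)" if "t \<in> D" for b t p
    using integrable_CN_power[of 1 p] that unfolding xi_law[OF that, symmetric, of b]
    by (simp add: integrable_distr_eq)
  have xi_2: "expectation (\<lambda>\<omega>. (cmod (xi b t \<omega>))\<^sup>2) = 1" if "t \<in> D" for b t
    using CN_moment2[of 1] that unfolding xi_law[OF that, symmetric, of b]
    by (simp add: integral_distr)
  have xi_4: "expectation (\<lambda>\<omega>. (cmod (xi b t \<omega>)) ^ 4) = 2" if "t \<in> D" for b t
    using CN_moment4[of 1] that unfolding xi_law[OF that, symmetric, of b]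
    by (simp add: integral_distr)
  have E_mean: "expectation (E b) = d" for b
    unfolding E_def[abs_def] using xi_pow xi_2 by (simp add: Bochner_Integration.integral_sum d_def)
  have E_le: "(E b \<omega>)\<^sup>2 \<le> d * (\<Sum>t\<in>D. cmod (xi b t \<omega>) ^ 4)" for b \<omega>
  proof -
    have "(E b \<omega>)\<^sup>2 \<le> (\<Sum>t\<in>D. 1\<^sup>2) * (\<Sum>t\<in>D. ((cmod (xi b t \<omega>))\<^sup>2)\<^sup>2)"
      using Cauchy_Schwarz_ineq_sum[of "\<lambda>_. 1" "\<lambda>t. (cmod (xi b t \<omega>))\<^sup>2" D] by (simp add: E_def)
    then show ?thesis by (simp add: d_def)
  qed
  have E_sq: "integrable M (\<lambda>\<omega>. (E b \<omega>)\<^sup>2)" "expectation (\<lambda>\<omega>. (E b \<omega>)\<^sup>2) \<le> 2 * d\<^sup>2" for b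
  proof -
    have i: "integrable M (\<lambda>\<omega>. d * (\<Sum>t\<in>D. cmod (xi b t \<omega>) ^ 4))"
      using xi_pow by (intro integrable_mult_right Bochner_Integration.integrable_sum) auto
    show i': "integrable M (\<lambda>\<omega>. (E b \<omega>)\<^sup>2)"
      by (rule Bochner_Integration.integrable_bound[OF i]) (use E_le[of b] d in \<open>auto simp: abs_of_nonneg sum_nonneg\<close>)
    have "expectation (\<lambda>\<omega>. (E b \<omega>)\<^sup>2) \<le> expectation (\<lambda>\<omega>. d * (\<Sum>t\<in>D. cmod (xi b t \<omega>) ^ 4))"
      by (rule integral_mono[OF i' i E_le])
    also have "\<dots> = 2 * d\<^sup>2"
      using xi_pow xi_4 by (simp add: Bochner_Integration.integral_sum power2_eq_square d_def)
    finally show "expectation (\<lambda>\<omega>. (E b \<omega>)\<^sup>2) \<le> 2 * d\<^sup>2" .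
  qed
  have E_ind: "indep_var borel (E b) borel (E b')" if "b \<noteq> b'" for b b'
  proof -
    have "indep_var (PiM ({b} \<times> D) (\<lambda>_. borel)) (\<lambda>\<omega>. \<lambda>u\<in>{b} \<times> D. xi (fst u) (snd u) \<omega>)
       (PiM ({b'} \<times> D) (\<lambda>_. borel)) (\<lambda>\<omega>. \<lambda>u\<in>{b'} \<times> D. xi (fst u) (snd u) \<omega>)"
      by (rule indep_var_restrict[OF xi_ind]) (use that in auto)
    moreover have "(\<lambda>x. \<Sum>t\<in>D. (cmod (x (b, t)))\<^sup>2) \<in> borel_measurable (PiM ({b} \<times> D) (\<lambda>_. borel))" for b :: nat
      by (intro borel_measurable_sum borel_measurable_power borel_measurable_norm measurable_component_singleton) auto
    ultimately have "indep_var borel ((\<lambda>x. \<Sum>t\<in>D. (cmod (x (b, t)))\<^sup>2) \<circ> (\<lambda>\<omega>. \<lambda>u\<in>{b} \<times> D. xi (fst u) (snd u) \<omega>))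
       borel ((\<lambda>x. \<Sum>t\<in>D. (cmod (x (b', t)))\<^sup>2) \<circ> (\<lambda>\<omega>. \<lambda>u\<in>{b'} \<times> D. xi (fst u) (snd u) \<omega>))"
      by (intro indep_var_compose)
    then show ?thesis by (simp add: comp_def E_def[abs_def])
  qed
  \<comment> \<open>The target rate \<open>\<rho>\<close> and the bound \<open>c\<close> to be
    approached are both measured in nats per interval.\<close>
  define \<rho> where "\<rho> = R * real T * ln 2"
  \<comment> \<open>One small \<open>\<delta>\<close> serves three purposes: it is the fraction of
    intervals left without code, the gap between the mean \<open>c\<close> and the decoding
    threshold per interval, and the relative slack granted to the energy. The rate that survives is
    \<open>(1 - \<delta>) * (c - \<delta>)\<close>, which must still exceed
    \<open>\<rho>\<close>.\<close>
  have "((\<lambda>\<delta>. (1 - \<delta>) * (c - \<delta>)) \<longlongrightarrow> (1 - 0) * (c - 0)) (at_right 0)"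
    by (intro tendsto_intros)
  moreover have "\<rho> < (1 - 0) * (c - 0)" using R by (simp add: \<rho>_def c_def d_def)
  ultimately have "\<forall>\<^sub>F \<delta> in at_right 0. \<rho> < (1 - \<delta>) * (c - \<delta>)"
    by (rule order_tendstoD(1))
  moreover have "\<forall>\<^sub>F \<delta> in at_right 0. \<delta> < min 1 c"
    using c by (auto simp: eventually_at_right_field intro: exI[of _ "min 1 c"])
  moreover have "\<forall>\<^sub>F \<delta>::real in at_right 0. 0 < \<delta>" by (rule eventually_at_right_less)
  ultimately have "\<forall>\<^sub>F \<delta> in at_right 0. \<rho> < (1 - \<delta>) * (c - \<delta>) \<and> \<delta> < min 1 c \<and> 0 < \<delta>"
    by eventually_elim simp
  then obtain \<delta> where \<delta>: "\<rho> < (1 - \<delta>) * (c - \<delta>)" "\<delta> < 1" "\<delta> < c" "0 < \<delta>"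
    using eventually_happens'[of "at_right (0::real)"] by (fastforce simp: trivial_limit_at_right_real)
  define \<alpha> where "\<alpha> = (1 - \<delta>) * (c - \<delta>)"
  have \<alpha>: "0 < \<alpha>" "\<rho> < \<alpha>" using \<delta> by (auto simp: \<alpha>_def)
  show ?thesis
    unfolding achievable_rate_def
  proof (intro allI impI)
    fix \<epsilon>0 :: real assume "0 < \<epsilon>0"
    \<comment> \<open>\<open>feinstein\<close> asks for an error below 1. This also keeps
      \<open>1 - \<epsilon>\<close> positive, so that no decision set can be empty.\<close>
    define \<epsilon> where "\<epsilon> = min \<epsilon>0 (1/2)"
    have \<epsilon>: "0 < \<epsilon>" "\<epsilon> < 1" "\<epsilon> \<le> \<epsilon>0" using \<open>0 < \<epsilon>0\<close> by (auto simp: \<epsilon>_def)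
    define n where "n B = nat \<lfloor>(1 - \<delta>) * real B\<rfloor>" for B
    have n_le: "real (n B) \<le> (1 - \<delta>) * real B" and n_ge: "(1 - \<delta>) * real B - 1 \<le> real (n B)" for B
    proof -
      have "0 \<le> (1 - \<delta>) * real B" using \<delta> by simp
      then show "real (n B) \<le> (1 - \<delta>) * real B" "(1 - \<delta>) * real B - 1 \<le> real (n B)"
        unfolding n_def by linarith+
    qed
    have n_lim: "filterlim (\<lambda>B. real (n B)) at_top sequentially"
    proof (rule filterlim_at_top_mono)
      show "filterlim (\<lambda>B. (1 - \<delta>) * real B - 1) at_top sequentially"
        using \<delta> by real_asymp
      show "\<forall>\<^sub>F B in sequentially. (1 - \<delta>) * real B - 1 \<le> real (n B)" using n_ge by simp
    qed
    have ev1: "\<forall>\<^sub>F B in sequentially. 0 < real (n B)"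
      using n_lim by (rule filterlim_at_top_dense[THEN iffD1, rule_format])
    \<comment> \<open>This bound and the next make each of the two Chebyshev failure probabilities
      at most \<open>\<epsilon> / 8\<close>, together the \<open>\<epsilon> / 4\<close> that
      \<open>feinstein\<close> allows.\<close>
    have ev2: "\<forall>\<^sub>F B in sequentially. 8 * C / (\<epsilon> * \<delta>\<^sup>2) < real (n B)"
      using n_lim by (rule filterlim_at_top_dense[THEN iffD1, rule_format])
    have ev3: "\<forall>\<^sub>F B in sequentially. 8 * (2 * d\<^sup>2) / (\<epsilon> * (\<delta> * d)\<^sup>2) < real (n B)"
      using n_lim by (rule filterlim_at_top_dense[THEN iffD1, rule_format])
    \<comment> \<open>The factor \<open>exp (- (c - \<delta>))\<close> pays for the interval lost in
      rounding \<open>n B\<close> down, and \<open>\<epsilon>\<^sup>2 / 8\<close> comes from the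
      size condition of \<open>feinstein\<close>. One half of
      \<open>\<kappa> * exp (\<alpha> * real B)\<close> will dominate the wanted number of messages,
      the other half absorbs the rounding of \<open>L\<close>.\<close>
    define \<kappa> where "\<kappa> = exp (- (c - \<delta>)) * \<epsilon>\<^sup>2 / 8"
    have \<kappa>: "0 < \<kappa>" using \<epsilon> by (simp add: \<kappa>_def)
    have "filterlim (\<lambda>B. \<kappa> / 2 * exp (\<alpha> * real B)) at_top sequentially"
      using \<kappa> \<alpha> by real_asymp
    then have ev4: "\<forall>\<^sub>F B in sequentially. 2 < \<kappa> / 2 * exp (\<alpha> * real B)"
      by (rule filterlim_at_top_dense[THEN iffD1, rule_format])
    have "filterlim (\<lambda>B. \<kappa> / 2 * exp ((\<alpha> - \<rho>) * real B)) at_top sequentially"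
      using \<kappa> \<alpha> by real_asymp
    then have ev5: "\<forall>\<^sub>F B in sequentially. 1 < \<kappa> / 2 * exp ((\<alpha> - \<rho>) * real B)"
      by (rule filterlim_at_top_dense[THEN iffD1, rule_format])
    from ev1 ev2 ev3 ev4 ev5 eventually_gt_at_top[of 0]
    show "\<forall>\<^sub>F B in sequentially. \<exists>L\<ge>1. block_code M D Y B L \<epsilon>0 \<and> R * (real B * real T) \<le> log 2 (real L)"
    proof eventually_elim
      case (elim B)
      define m where "m = n B"
      have m: "0 < m" "m < B"
      proof -
        show "0 < m" using elim by (simp add: m_def)
        have "(1 - \<delta>) * real B < 1 * real B" using \<delta> elim by (intro mult_strict_right_mono) auto
        with n_le[of B] show "m < B" unfolding m_def by linarith
      qed
      define q where "q = exp (- (real m * (c - \<delta>)))"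
      have q: "0 < q" by (simp add: q_def)
      define L where "L = nat \<lfloor>\<epsilon>\<^sup>2 / (8 * q)\<rfloor>"
      have L0: "0 \<le> \<epsilon>\<^sup>2 / (8 * q)" using q by simp
      have "real L \<le> \<epsilon>\<^sup>2 / (8 * q)" and L_ge: "\<epsilon>\<^sup>2 / (8 * q) - 1 \<le> real L"
        using L0 unfolding L_def by linarith+
      then have L_le: "8 * q * real L \<le> \<epsilon>\<^sup>2" using q by (simp add: field_simps)
      have "((1 - \<delta>) * real B - 1) * (c - \<delta>) \<le> real m * (c - \<delta>)"
        using n_ge[of B] \<delta> unfolding m_def by (intro mult_right_mono) auto
      then have "\<alpha> * real B - (c - \<delta>) \<le> real m * (c - \<delta>)"
        by (simp add: \<alpha>_def algebra_simps)
      then have "exp (\<alpha> * real B - (c - \<delta>)) \<le> exp (real m * (c - \<delta>))" by simp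
      then have "exp (- (c - \<delta>)) * exp (\<alpha> * real B) \<le> 1 / q"
        by (simp add: mult_exp_exp q_def exp_minus[of "real m * (c - \<delta>)"] inverse_eq_divide[symmetric])
      then have "\<epsilon>\<^sup>2 / 8 * (exp (- (c - \<delta>)) * exp (\<alpha> * real B)) \<le> \<epsilon>\<^sup>2 / 8 * (1 / q)"
        by (intro mult_left_mono) auto
      then have qge: "\<kappa> * exp (\<alpha> * real B) \<le> \<epsilon>\<^sup>2 / (8 * q)"
        by (simp add: \<kappa>_def mult_ac)
      have "exp (\<rho> * real B) \<le> exp (\<rho> * real B) * (\<kappa> / 2 * exp ((\<alpha> - \<rho>) * real B))"
        using mult_left_mono[of 1 "\<kappa> / 2 * exp ((\<alpha> - \<rho>) * real B)" "exp (\<rho> * real B)"] elim by simp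
      also have "\<dots> = \<kappa> / 2 * exp (\<alpha> * real B)"
        by (simp add: mult_exp_exp algebra_simps)
      finally have Lexp: "exp (\<rho> * real B) + 1 \<le> real L"
        using qge L_ge elim by linarith
      then have L1: "1 \<le> L" by (smt (verit) exp_gt_zero of_nat_less_1_iff not_less of_nat_0_less_iff less_one)
      have "\<rho> * real B \<le> ln (real L)"
        using Lexp L1 by (subst ln_ge_iff) auto
      then have rate: "R * (real B * real T) \<le> log 2 (real L)"
        by (simp add: log_def \<rho>_def field_simps)

      define I where "I = {..<m} \<times> D"
      have I: "finite I" using D by (simp add: I_def)
      define X where "X \<omega> = (\<lambda>u\<in>I. xi (fst u) (snd u) \<omega>)" for \<omega>
      define V where "V \<omega> = (\<lambda>u\<in>I. (a (fst u) \<omega>, v (fst u) (snd u) \<omega>))" for \<omega>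
      define y where "y p = (\<lambda>u\<in>I. fst (snd p u) * fst p u + snd (snd p u))" for p :: "(nat \<times> nat \<Rightarrow> complex) \<times> (nat \<times> nat \<Rightarrow> complex \<times> complex)"
      define MX where "MX = PiM I (\<lambda>_. borel :: complex measure)"
      define MV where "MV = PiM I (\<lambda>_. borel \<Otimes>\<^sub>M borel :: (complex \<times> complex) measure)"
      have cmp[measurable]: "(\<lambda>x. x u) \<in> MX \<rightarrow>\<^sub>M borel" "(\<lambda>x. x u) \<in> MV \<rightarrow>\<^sub>M (borel \<Otimes>\<^sub>M borel)" if "u \<in> I" for u
        using that by (auto simp: MX_def MV_def)
      have X_m: "X \<in> M \<rightarrow>\<^sub>M MX" and V_m: "V \<in> M \<rightarrow>\<^sub>M MV"
        unfolding X_def V_def MX_def MV_def by (intro measurable_restrict; auto simp: I_def)+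
      have XV: "distr M (MX \<Otimes>\<^sub>M MV) (\<lambda>\<omega>. (X \<omega>, V \<omega>)) = distr M MX X \<Otimes>\<^sub>M distr M MV V"
        using ind[of m] unfolding MX_def MV_def X_def V_def I_def .
      have y_m: "y \<in> MX \<Otimes>\<^sub>M MV \<rightarrow>\<^sub>M MX"
      proof -
        have "y \<in> MX \<Otimes>\<^sub>M MV \<rightarrow>\<^sub>M PiM I (\<lambda>_. borel :: complex measure)"
          unfolding y_def by measurable
        then show ?thesis by (simp add: MX_def)
      qed
      \<comment> \<open>With the energy test inside the threshold set, every codeword that has a
        nonempty decision set obeys the budget \<open>real B * d\<close>. This is the budget of all
        \<open>B\<close> intervals although only \<open>m\<close> of them are coded, so typical
        inputs pass.\<close>
      define A where "A = {p \<in> space (MX \<Otimes>\<^sub>M MX). real m * (c - \<delta>) \<le> (\<Sum>u\<in>I. info_density h s2 (fst p u) (snd p u)) \<and>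
          (\<Sum>u\<in>I. (cmod (fst p u))\<^sup>2) \<le> real B * d}"
      have A_m: "A \<in> sets (MX \<Otimes>\<^sub>M MX)"
        unfolding A_def by measurable
      have pass: "prob {\<omega>\<in>space M. (X \<omega>, y (X \<omega>, V \<omega>)) \<in> A} \<ge> 1 - \<epsilon> / 4"
      proof -
        define U1 where "U1 = {\<omega>\<in>space M. real m * \<delta> \<le> \<bar>(\<Sum>b<m. W b \<omega>) - real m * c\<bar>}"
        define U2 where "U2 = {\<omega>\<in>space M. real m * (\<delta> * d) \<le> \<bar>(\<Sum>b<m. E b \<omega>) - real m * d\<bar>}"
        have U_m[measurable]: "U1 \<in> sets M" "U2 \<in> sets M" unfolding U1_def U2_def by measurable
        have "prob U1 \<le> C / (real m * \<delta>\<^sup>2)"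
          unfolding U1_def by (rule weak_law_pairwise) (use W_sq W_mean W_ind \<delta> m in \<open>auto simp: c_def d_def\<close>)
        also have "\<dots> \<le> \<epsilon> / 8"
          using elim \<epsilon> \<delta> m unfolding m_def by (simp add: field_simps)
        finally have U1: "prob U1 \<le> \<epsilon> / 8" .
        have "prob U2 \<le> 2 * d\<^sup>2 / (real m * (\<delta> * d)\<^sup>2)"
          unfolding U2_def by (rule weak_law_pairwise) (use E_sq E_mean E_ind \<delta> d m in auto)
        also have "\<dots> \<le> \<epsilon> / 8"
          using elim \<epsilon> \<delta> m d unfolding m_def by (simp add: field_simps)
        finally have U2: "prob U2 \<le> \<epsilon> / 8" .
        have "space M - (U1 \<union> U2) \<subseteq> {\<omega>\<in>space M. (X \<omega>, y (X \<omega>, V \<omega>)) \<in> A}"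
        proof
          fix \<omega> assume "\<omega> \<in> space M - (U1 \<union> U2)"
          then have \<omega>: "\<omega> \<in> space M" "real m * \<delta> > \<bar>(\<Sum>b<m. W b \<omega>) - real m * c\<bar>"
              "real m * (\<delta> * d) > \<bar>(\<Sum>b<m. E b \<omega>) - real m * d\<bar>"
            by (auto simp: U1_def U2_def not_le)
          have sp: "X \<omega> \<in> space MX" "y (X \<omega>, V \<omega>) \<in> space MX"
            by (auto simp: X_def y_def MX_def space_PiM)
          have s1: "(\<Sum>u\<in>I. info_density h s2 (X \<omega> u) (y (X \<omega>, V \<omega>) u)) = (\<Sum>b<m. W b \<omega>)"
            unfolding W_def sum.cartesian_product I_def[symmetric]
            by (intro sum.cong) (auto simp: X_def y_def V_def)
          have s2: "(\<Sum>u\<in>I. (cmod (X \<omega> u))\<^sup>2) = (\<Sum>b<m. E b \<omega>)"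
            unfolding E_def sum.cartesian_product I_def[symmetric]
            by (intro sum.cong) (auto simp: X_def)
          \<comment> \<open>Here the idle fraction pays for the fluctuation of the energy:
            \<open>(1 - \<delta>) * (1 + \<delta>)\<close> is at most 1.\<close>
          have "(\<Sum>b<m. E b \<omega>) \<le> real m * d * (1 + \<delta>)" using \<omega>(3) by (simp add: algebra_simps abs_less_iff)
          also have "\<dots> \<le> (1 - \<delta>) * real B * d * (1 + \<delta>)"
            using n_le[of B] d \<delta> unfolding m_def by (intro mult_right_mono) auto
          also have "\<dots> = (1 - \<delta>\<^sup>2) * (real B * d)" by (simp add: power2_eq_square algebra_simps)
          also have "\<dots> \<le> 1 * (real B * d)" using d by (intro mult_right_mono) auto
          finally have "(\<Sum>b<m. E b \<omega>) \<le> real B * d" by simp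
          moreover have "real m * (c - \<delta>) \<le> (\<Sum>b<m. W b \<omega>)" using \<omega>(2) by (simp add: algebra_simps abs_less_iff)
          ultimately show "\<omega> \<in> {\<omega>\<in>space M. (X \<omega>, y (X \<omega>, V \<omega>)) \<in> A}"
            using \<omega>(1) sp by (simp add: A_def s1 s2 space_pair_measure)
        qed
        moreover have "{\<omega>\<in>space M. (X \<omega>, y (X \<omega>, V \<omega>)) \<in> A} \<in> sets M"
        proof -
          note [measurable] = X_m V_m y_m A_m
          show ?thesis by measurable
        qed
        ultimately have "prob (space M - (U1 \<union> U2)) \<le> prob {\<omega>\<in>space M. (X \<omega>, y (X \<omega>, V \<omega>)) \<in> A}"
          by (intro finite_measure_mono)
        moreover have "prob (space M - (U1 \<union> U2)) = 1 - prob (U1 \<union> U2)"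
          by (rule prob_compl) simp
        moreover have "prob (U1 \<union> U2) \<le> prob U1 + prob U2" by (rule measure_Un_le) auto
        ultimately show ?thesis using U1 U2 by linarith
      qed
      have confuse: "prob {\<omega>\<in>space M. (X \<omega>, r) \<in> A} \<le> q" if r: "r \<in> space MX" for r
      proof -
        have im: "indep_vars (\<lambda>_. borel) (\<lambda>u. xi (fst u) (snd u)) I"
          by (rule indep_vars_subset[OF xi_ind]) (auto simp: I_def)
        have "prob {\<omega>\<in>space M. (X \<omega>, r) \<in> A} \<le> prob {\<omega>\<in>space M. real m * (c - \<delta>) \<le> (\<Sum>u\<in>I. info_density h s2 (xi (fst u) (snd u) \<omega>) (r u))}"
        proof (rule finite_measure_mono)
          show "{\<omega>\<in>space M. (X \<omega>, r) \<in> A} \<subseteq> {\<omega>\<in>space M. real m * (c - \<delta>) \<le> (\<Sum>u\<in>I. info_density h s2 (xi (fst u) (snd u) \<omega>) (r u))}"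
            by (auto simp: A_def X_def cong: sum.cong)
          have "xi (fst u) (snd u) \<in> borel_measurable M" if "u \<in> I" for u using that by (auto simp: I_def)
          then show "{\<omega>\<in>space M. real m * (c - \<delta>) \<le> (\<Sum>u\<in>I. info_density h s2 (xi (fst u) (snd u) \<omega>) (r u))} \<in> sets M"
            by measurable
        qed
        also have "\<dots> \<le> exp (- (real m * (c - \<delta>)))"
          using I pos(1) im by (rule info_density_tail) (auto simp: I_def xi_law)
        finally show ?thesis by (simp add: q_def)
      qed
      have "\<exists>cw G. (\<forall>i<L. cw i \<in> space MX \<and> G i \<in> sets MX \<and> G i \<subseteq> Pair (cw i) -` A \<and>
          prob {\<omega>\<in>space M. y (cw i, V \<omega>) \<in> G i} \<ge> 1 - \<epsilon>) \<and> (\<forall>i<L. \<forall>l<L. l \<noteq> i \<longrightarrow> G i \<inter> G l = {})"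
        by (rule feinstein[OF X_m V_m XV y_m A_m \<epsilon>(1,2) q pass confuse L_le])
      then
      obtain cw G where cw: "\<forall>i<L. cw i \<in> space MX \<and> G i \<in> sets MX \<and> G i \<subseteq> Pair (cw i) -` A \<and>
          prob {\<omega>\<in>space M. y (cw i, V \<omega>) \<in> G i} \<ge> 1 - \<epsilon>"
        and disj: "\<forall>i<L. \<forall>l<L. l \<noteq> i \<longrightarrow> G i \<inter> G l = {}" by (elim exE conjE)
      have power: "(\<Sum>u\<in>I. (cmod (cw i u))\<^sup>2) \<le> real B * d" if "i < L" for i
      proof -
        have "G i \<noteq> {}"
        proof
          assume "G i = {}"
          with cw that have "1 - \<epsilon> \<le> 0" by force
          with \<epsilon> show False by simp
        qed
        then show ?thesis using cw that by (force simp: A_def)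
      qed
      obtain t0 where t0: "t0 \<in> D" using D by auto
      define res where "res i = real B * d - (\<Sum>u\<in>I. (cmod (cw i u))\<^sup>2)" for i
      \<comment> \<open>Interval \<open>B - 1\<close> lies outside the code since
        \<open>m < B\<close>. Its symbol \<open>t0\<close> sends the missing energy
        \<open>res i\<close>, nonnegative by \<open>power\<close>, and the other uncoded symbols are
        silent.\<close>
      define enc where "enc i b t = (if b < m then cw i (b, t) else if b = B - 1 \<and> t = t0
          then complex_of_real (sqrt (res i)) else 0)" for i b t
      \<comment> \<open>The alternative \<open>L \<le> i\<close> gives the least index a value when
        no decision set contains the output. Restricting to \<open>I\<close> discards the uncoded
        symbols, so the padding cannot disturb the decision.\<close>
      define dec where "dec r = (LEAST i. restrict r I \<in> G i \<or> L \<le> i)" for r :: "nat \<times> nat \<Rightarrow> complex"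
      have "block_code M D Y B L \<epsilon>0"
        unfolding block_code_def
      proof (intro exI[of _ enc] bexI[of _ dec] allI impI conjI)
        have G_m: "G i \<in> sets MX" if "i < L" for i using cw that by simp
        have res_m: "(\<lambda>r. restrict r I) \<in> PiM ({..<B} \<times> D) (\<lambda>_. borel) \<rightarrow>\<^sub>M MX"
          unfolding MX_def by (rule measurable_restrict_subset) (use m in \<open>auto simp: I_def\<close>)
        have pr: "Measurable.pred (PiM ({..<B} \<times> D) (\<lambda>_. borel)) (\<lambda>r. restrict r I \<in> G i \<or> L \<le> i)" for i
        proof (cases "i < L")
          case True
          note [measurable] = res_m G_m[OF True]
          show ?thesis by measurable
        qed simp
        show dec_m: "dec \<in> PiM ({..<B} \<times> D) (\<lambda>_. borel) \<rightarrow>\<^sub>M count_space UNIV"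
          unfolding dec_def by (rule measurable_Least) (rule pr)
        fix i assume i: "i < L"
        have "(\<Sum>b<B. \<Sum>t\<in>D. (cmod (enc i b t))\<^sup>2) =
            (\<Sum>b<m. \<Sum>t\<in>D. (cmod (enc i b t))\<^sup>2) + (\<Sum>b=m..<B. \<Sum>t\<in>D. (cmod (enc i b t))\<^sup>2)"
          using m by (simp add: sum.atLeastLessThan_concat[of 0 m B, symmetric] lessThan_atLeast0)
        also have "(\<Sum>b<m. \<Sum>t\<in>D. (cmod (enc i b t))\<^sup>2) = (\<Sum>u\<in>I. (cmod (cw i u))\<^sup>2)"
          unfolding sum.cartesian_product I_def by (intro sum.cong) (auto simp: enc_def)
        also have "(\<Sum>b=m..<B. \<Sum>t\<in>D. (cmod (enc i b t))\<^sup>2) = (\<Sum>b=m..<B. if b = B - 1 then res i else 0)"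
        proof (intro sum.cong refl)
          fix b assume "b \<in> {m..<B}"
          then have "(\<Sum>t\<in>D. (cmod (enc i b t))\<^sup>2) = (\<Sum>t\<in>D. if t = t0 then (if b = B - 1 then res i else 0) else 0)"
            using power[OF i] by (intro sum.cong) (auto simp: enc_def res_def)
          then show "(\<Sum>t\<in>D. (cmod (enc i b t))\<^sup>2) = (if b = B - 1 then res i else 0)"
            using D t0 by simp
        qed
        also have "\<dots> = res i" using m by simp
        finally show "(\<Sum>b<B. \<Sum>t\<in>D. (cmod (enc i b t))\<^sup>2) = real B * real (card D)"
          by (simp add: res_def d_def)
        define yy where "yy \<omega> = (\<lambda>u\<in>{..<B} \<times> D. Y (enc i) (fst u) (snd u) \<omega>)" for \<omega>
        have yy_m: "yy \<in> M \<rightarrow>\<^sub>M PiM ({..<B} \<times> D) (\<lambda>_. borel)"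
        proof -
          have "(\<lambda>\<omega>. \<lambda>u\<in>{..<B} \<times> D. a (fst u) \<omega> * enc i (fst u) (snd u) + v (fst u) (snd u) \<omega>) \<in> M \<rightarrow>\<^sub>M PiM ({..<B} \<times> D) (\<lambda>_. borel)"
            by (intro measurable_restrict) auto
          moreover have "yy \<omega> = (\<lambda>u\<in>{..<B} \<times> D. a (fst u) \<omega> * enc i (fst u) (snd u) + v (fst u) (snd u) \<omega>)" if "\<omega> \<in> space M" for \<omega>
            unfolding yy_def using that by (intro restrict_ext) (auto simp: Y)
          ultimately show ?thesis by (subst measurable_cong) auto
        qed
        have "1 - \<epsilon>0 \<le> 1 - \<epsilon>" using \<epsilon> by simp
        also have "\<dots> \<le> prob {\<omega>\<in>space M. y (cw i, V \<omega>) \<in> G i}" using cw i by simp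
        also have "\<dots> \<le> prob {\<omega>\<in>space M. dec (yy \<omega>) = i}"
        proof (rule finite_measure_mono)
          show "{\<omega>\<in>space M. dec (yy \<omega>) = i} \<in> sets M"
            using measurable_compose[OF yy_m dec_m] by measurable
          show "{\<omega>\<in>space M. y (cw i, V \<omega>) \<in> G i} \<subseteq> {\<omega>\<in>space M. dec (yy \<omega>) = i}"
          proof safe
            fix \<omega> assume \<omega>: "\<omega> \<in> space M" "y (cw i, V \<omega>) \<in> G i"
            have "restrict (yy \<omega>) I = y (cw i, V \<omega>)"
              unfolding y_def yy_def using m \<omega>(1)
              by (auto simp: fun_eq_iff restrict_def I_def Y V_def enc_def)
            with \<omega>(2) have *: "restrict (yy \<omega>) I \<in> G i" by simp
            show "dec (yy \<omega>) = i"
              unfolding dec_def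
            proof (rule Least_equality)
              fix j assume j: "restrict (yy \<omega>) I \<in> G j \<or> L \<le> j"
              show "i \<le> j"
              proof (cases "j < L")
                case True
                with j have "restrict (yy \<omega>) I \<in> G j" by simp
                with * disj i True have "j = i" by blast
                then show ?thesis by simp
              qed (use i in simp)
            qed (use * in simp)
          qed
        qed
        finally show "1 - \<epsilon>0 \<le> prob {\<omega> \<in> space M. dec (\<lambda>u\<in>{..<B} \<times> D. Y (enc i) (fst u) (snd u) \<omega>) = i}"
          by (simp add: yy_def)
      qed
      with L1 rate show ?case by blast
    qed
  qed
qed

section \<open>Projectors built from Gram matrices\<close>

lemma mat_adjoint_dim[simp]: "dim_row (mat_adjoint A) = dim_col A" "dim_col (mat_adjoint A) = dim_row A"
  unfolding mat_adjoint_def by simp_all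

lemma mat_adjoint_carrier[simp]: "A \<in> carrier_mat n m \<Longrightarrow> mat_adjoint A \<in> carrier_mat m n"
  by (rule carrier_matI) simp_all

lemma mat_adjoint_index[simp]:
  "i < dim_col A \<Longrightarrow> j < dim_row A \<Longrightarrow> mat_adjoint A $$ (i, j) = cnj (A $$ (j, i))"
  unfolding mat_adjoint_def by (simp add: mat_of_rows_index)

lemma mat_adjoint_adjoint[simp]: "mat_adjoint (mat_adjoint A) = (A :: complex mat)"
  by (rule eq_matI) auto

lemma index_mult_mat_sum:
  assumes "A \<in> carrier_mat n m" "B \<in> carrier_mat m l" "i < n" "j < l"
  shows "(A * B) $$ (i, j) = (\<Sum>k<m. A $$ (i, k) * B $$ (k, j))"
  using assms by (simp add: scalar_prod_def atLeast0LessThan)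

lemma index_mult_mat_vec_sum:
  assumes "A \<in> carrier_mat n m" "v \<in> carrier_vec m" "i < n"
  shows "vec_index (A *\<^sub>v v) i = (\<Sum>k<m. A $$ (i, k) * vec_index v k)"
  using assms by (simp add: scalar_prod_def atLeast0LessThan)

lemma mat_adjoint_mult:
  fixes A B :: "complex mat"
  assumes "A \<in> carrier_mat n m" "B \<in> carrier_mat m l"
  shows "mat_adjoint (A * B) = mat_adjoint B * mat_adjoint A"
proof (rule eq_matI)
  fix i j assume "i < dim_row (mat_adjoint B * mat_adjoint A)" "j < dim_col (mat_adjoint B * mat_adjoint A)"
  then have ij: "i < l" "j < n" using assms by auto
  have "mat_adjoint (A * B) $$ (i, j) = cnj ((A * B) $$ (j, i))"
    using ij assms by (intro mat_adjoint_index) auto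
  also have "\<dots> = (\<Sum>k<m. cnj (A $$ (j, k) * B $$ (k, i)))"
    using ij by (simp add: index_mult_mat_sum[OF assms])
  also have "\<dots> = (\<Sum>k<m. mat_adjoint B $$ (i, k) * mat_adjoint A $$ (k, j))"
    using ij assms by (intro sum.cong) (simp_all add: mult.commute)
  also have "\<dots> = (mat_adjoint B * mat_adjoint A) $$ (i, j)"
    using ij assms by (intro index_mult_mat_sum[symmetric]) simp_all
  finally show "mat_adjoint (A * B) $$ (i, j) = (mat_adjoint B * mat_adjoint A) $$ (i, j)" .
qed (use assms in simp_all)

lemma inv_mat_carrier:
  assumes "A \<in> carrier_mat n n" shows "inv_mat A \<in> carrier_mat n n"
  using assms mat_inverse(2)[OF assms] by (auto simp: inv_mat_def split: option.split)

lemma inv_mat_singular: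
  assumes "A \<in> carrier_mat n n" "det A = 0" shows "inv_mat A = 0\<^sub>m n n"
proof (cases "mat_inverse A")
  case None
  then show ?thesis using assms by (auto simp: inv_mat_def)
next
  case (Some B)
  from mat_inverse(2)[OF assms(1) this] have "det A * det B = 1"
    using det_mult[OF assms(1), of B] by simp
  with assms show ?thesis by simp
qed

lemma inv_mat_regular:
  assumes "A \<in> carrier_mat n n" "det A \<noteq> 0"
  shows "inv_mat A * A = 1\<^sub>m n" "A * inv_mat A = 1\<^sub>m n"
proof -
  have "mat_inverse A \<noteq> None"
    using mat_inverse(1)[OF assms(1), of "()"] det_non_zero_imp_unit[OF assms, of "()"] by auto
  then obtain B where "mat_inverse A = Some B" by auto
  with mat_inverse(2)[OF assms(1) this] show "inv_mat A * A = 1\<^sub>m n" "A * inv_mat A = 1\<^sub>m n"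
    by (auto simp: inv_mat_def)
qed

text \<open>Cramer's rule, extended by the convention for singular matrices. It exhibits each entry
  of the inverse as a quotient of polynomials in the entries of the matrix, from which measurability
  follows.\<close>

lemma inv_mat_index:
  assumes A: "A \<in> carrier_mat n n" and ij: "i < n" "j < n"
  shows "inv_mat A $$ (i, j) = (if det A = 0 then 0 else cofactor A j i / det A)"
proof (cases "det A = 0")
  case True
  then show ?thesis using inv_mat_singular[OF A] ij by simp
next
  case False
  have c: "inv_mat A \<in> carrier_mat n n" "adj_mat A \<in> carrier_mat n n"
    using inv_mat_carrier[OF A] adj_mat[OF A] by auto
  have "adj_mat A = (inv_mat A * A) * adj_mat A"
    using c inv_mat_regular[OF A False] by simp
  also have "\<dots> = inv_mat A * (A * adj_mat A)"
    using c A by (intro assoc_mult_mat[of _ n n _ n _ n])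
  also have "\<dots> = det A \<cdot>\<^sub>m inv_mat A"
    unfolding adj_mat(2)[OF A] using c by (simp add: mult_smult_distrib[of _ n n _ n])
  finally have "adj_mat A $$ (i, j) = det A * inv_mat A $$ (i, j)"
    using c ij by simp
  then show ?thesis using False A ij by (simp add: adj_mat_def)
qed

section \<open>Symmetry, idempotence, nulling and trace of the projector, entry by entry\<close>

context
  fixes A :: "complex mat" and N m :: nat
  assumes A: "A \<in> carrier_mat N m"
begin

private abbreviation "Gm \<equiv> mat_adjoint A * A"
private abbreviation "Pr \<equiv> 1\<^sub>m N - A * inv_mat Gm * mat_adjoint A"

lemma gram_carrier: "Gm \<in> carrier_mat m m"
  by (rule mult_carrier_mat[OF mat_adjoint_carrier[OF A] A])

lemma gram_adjoint: "mat_adjoint Gm = Gm"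
  using A by (subst mat_adjoint_mult[of _ m N _ m]) auto

lemma inv_gram_carrier: "inv_mat Gm \<in> carrier_mat m m"
  by (rule inv_mat_carrier[OF gram_carrier])

text \<open>In the singular case the inverse is zero by convention, which is Hermitian as well. Thus
  symmetry and idempotence of the projector hold at every outcome and its entries are bounded
  without an exceptional set; nulling and trace are where an invertible Gram matrix comes
  in.\<close>

lemma inv_gram_adjoint: "mat_adjoint (inv_mat Gm) = inv_mat Gm"
proof (cases "det Gm = 0")
  case True
  show ?thesis unfolding inv_mat_singular[OF gram_carrier True] by (rule eq_matI) auto
next
  case False
  note r = inv_mat_regular[OF gram_carrier False]
  define B where "B = inv_mat Gm"
  have B: "B \<in> carrier_mat m m" unfolding B_def by (rule inv_gram_carrier)
  have "mat_adjoint (Gm * B) = mat_adjoint (1\<^sub>m m)" using r by (simp add: B_def)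
  then have "mat_adjoint B * Gm = mat_adjoint (1\<^sub>m m)"
    using mat_adjoint_mult[OF gram_carrier B] by (simp add: gram_adjoint)
  also have "mat_adjoint (1\<^sub>m m) = (1\<^sub>m m :: complex mat)" by (rule eq_matI) auto
  finally have "mat_adjoint B * Gm = 1\<^sub>m m" .
  then have "mat_adjoint B * (Gm * B) = B"
    using B gram_carrier by (subst assoc_mult_mat[symmetric, of _ m m _ m _ m]) auto
  then show ?thesis using r B by (simp add: B_def)
qed

lemma inv_gram_absorb: "inv_mat Gm * Gm * inv_mat Gm = inv_mat Gm"
proof (cases "det Gm = 0")
  case True
  show ?thesis unfolding inv_mat_singular[OF gram_carrier True] by (simp add: left_mult_zero_mat[OF gram_carrier])
next
  case False
  then show ?thesis using inv_mat_regular[OF gram_carrier False] inv_gram_carrier by simp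
qed

lemma projector_range_carrier: "A * inv_mat Gm * mat_adjoint A \<in> carrier_mat N N"
  by (rule mult_carrier_mat[OF mult_carrier_mat[OF A inv_gram_carrier] mat_adjoint_carrier[OF A]])

lemma projector_range_index:
  assumes "a < N" "b < N"
  shows "(A * inv_mat Gm * mat_adjoint A) $$ (a, b) =
    (\<Sum>c<m. \<Sum>d<m. A $$ (a, d) * inv_mat Gm $$ (d, c) * cnj (A $$ (b, c)))"
proof -
  define B where "B = inv_mat Gm"
  have B: "B \<in> carrier_mat m m" unfolding B_def by (rule inv_gram_carrier)
  have "(A * B * mat_adjoint A) $$ (a, b) = (\<Sum>c<m. (A * B) $$ (a, c) * mat_adjoint A $$ (c, b))"
    using A B assms by (intro index_mult_mat_sum) auto
  also have "\<dots> = (\<Sum>c<m. (\<Sum>d<m. A $$ (a, d) * B $$ (d, c)) * cnj (A $$ (b, c)))"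
  proof (intro sum.cong refl arg_cong2[where f="(*)"])
    fix c assume "c \<in> {..<m}"
    then show "(A * B) $$ (a, c) = (\<Sum>d<m. A $$ (a, d) * B $$ (d, c))" "mat_adjoint A $$ (c, b) = cnj (A $$ (b, c))"
      using assms A index_mult_mat_sum[OF A B] by auto
  qed
  finally show ?thesis by (simp add: B_def sum_distrib_right)
qed

lemma projector_hermitian:
  assumes "a < N" "b < N"
  shows "Pr $$ (a, b) = cnj (Pr $$ (b, a))"
proof -
  define E where "E = A * inv_mat Gm * mat_adjoint A"
  have E: "E \<in> carrier_mat N N" unfolding E_def by (rule projector_range_carrier)
  have "mat_adjoint E = E"
  proof -
    have "mat_adjoint E = A * mat_adjoint (A * inv_mat Gm)"
      unfolding E_def using A inv_gram_carrier
      by (subst mat_adjoint_mult[of _ N m _ N]) auto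
    also have "mat_adjoint (A * inv_mat Gm) = inv_mat Gm * mat_adjoint A"
      using A inv_gram_carrier by (subst mat_adjoint_mult[of _ N m _ m]) (auto simp: inv_gram_adjoint)
    also have "A * (inv_mat Gm * mat_adjoint A) = E"
      unfolding E_def using A inv_gram_carrier
      by (intro assoc_mult_mat[symmetric, of _ N m _ m _ N]) auto
    finally show ?thesis .
  qed
  then have "E $$ (a, b) = cnj (E $$ (b, a))"
    using mat_adjoint_index[of a E b] E assms by simp
  then show ?thesis using assms E unfolding E_def[symmetric] by simp
qed

text \<open>Reassociation brings \<open>inv_mat Gm * Gm * inv_mat Gm\<close> together inside
  \<open>E * E\<close>, so the range part \<open>E\<close> is idempotent, and with it its
  complement.\<close>

lemma projector_idem:
  assumes "a < N" "b < N"
  shows "(\<Sum>c<N. Pr $$ (a, c) * Pr $$ (c, b)) = Pr $$ (a, b)"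
proof -
  define E where "E = A * inv_mat Gm * mat_adjoint A"
  have E: "E \<in> carrier_mat N N" unfolding E_def by (rule projector_range_carrier)
  define B where "B = inv_mat Gm"
  define C where "C = mat_adjoint A"
  have B: "B \<in> carrier_mat m m" unfolding B_def by (rule inv_gram_carrier)
  have C: "C \<in> carrier_mat m N" unfolding C_def using A by simp
  have AB: "A * B \<in> carrier_mat N m" and CA: "C * A \<in> carrier_mat m m" using A B C by auto
  have Eq: "E = A * B * C" by (simp add: E_def B_def C_def)
  have "E * E = A * B * (C * (A * B * C))"
    unfolding Eq
    using AB C by (intro assoc_mult_mat[of _ N m _ N _ N]) auto
  also have "C * (A * B * C) = C * (A * B) * C"
    using AB C by (intro assoc_mult_mat[symmetric, of _ m N _ m _ N]) auto
  also have "C * (A * B) = C * A * B"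
    using A B C by (intro assoc_mult_mat[symmetric, of _ m N _ m _ m]) auto
  also have "A * B * (C * A * B * C) = A * B * (C * A * B) * C"
    using AB B C CA by (intro assoc_mult_mat[symmetric, of _ N m _ m _ N]) auto
  also have "A * B * (C * A * B) = A * (B * (C * A * B))"
    using A B CA by (intro assoc_mult_mat[of _ N m _ m _ m]) auto
  also have "B * (C * A * B) = B * (C * A) * B"
    using B CA by (intro assoc_mult_mat[symmetric, of _ m m _ m _ m]) auto
  also have "\<dots> = B" unfolding B_def C_def by (rule inv_gram_absorb)
  also have "A * B * C = E" by (simp add: E_def B_def C_def)
  finally have EE: "E * E = E" .
  have sum: "(\<Sum>c<N. E $$ (a, c) * E $$ (c, b)) = E $$ (a, b)"
    using arg_cong[OF EE, of "\<lambda>X. X $$ (a, b)"] assms E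
    by (simp add: scalar_prod_def atLeast0LessThan)
  have "(\<Sum>c<N. Pr $$ (a, c) * Pr $$ (c, b)) =
     (\<Sum>c<N. ((if a = c then 1 else 0) - E $$ (a, c)) * ((if c = b then 1 else 0) - E $$ (c, b)))"
    using assms E unfolding E_def[symmetric] by (intro sum.cong) auto
  also have "\<dots> = (\<Sum>c<N. (if c = a then (if a = b then 1 else 0) - E $$ (a, b) else 0)
       - (if c = b then E $$ (a, b) else 0) + E $$ (a, c) * E $$ (c, b))"
    by (intro sum.cong) (auto simp: algebra_simps)
  also have "\<dots> = (if a = b then 1 else 0) - E $$ (a, b)"
    using assms by (simp add: sum.distrib sum_subtractf sum)
  finally show ?thesis using assms E unfolding E_def[symmetric] by simp
qed

lemma projector_nulls:
  assumes "det Gm \<noteq> 0" "a < N" "c < m"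
  shows "(\<Sum>b<N. Pr $$ (a, b) * A $$ (b, c)) = 0"
proof -
  define E where "E = A * inv_mat Gm * mat_adjoint A"
  have E: "E \<in> carrier_mat N N" unfolding E_def by (rule projector_range_carrier)
  define B where "B = inv_mat Gm"
  define C where "C = mat_adjoint A"
  have B: "B \<in> carrier_mat m m" unfolding B_def by (rule inv_gram_carrier)
  have C: "C \<in> carrier_mat m N" unfolding C_def using A by simp
  have AB: "A * B \<in> carrier_mat N m" and CA: "C * A \<in> carrier_mat m m" using A B C by auto
  have Eq: "E = A * B * C" by (simp add: E_def B_def C_def)
  have "E * A = A * B * (C * A)"
    unfolding Eq
    using A AB C by (intro assoc_mult_mat[of _ N m _ N _ m]) auto
  also have "\<dots> = A * (B * (C * A))"
    using A B CA by (intro assoc_mult_mat[of _ N m _ m _ m]) auto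
  also have "B * (C * A) = 1\<^sub>m m"
    unfolding B_def C_def using inv_mat_regular[OF gram_carrier assms(1)] by simp
  also have "A * 1\<^sub>m m = A" using A by simp
  finally have EA: "E * A = A" .
  have sum: "(\<Sum>b<N. E $$ (a, b) * A $$ (b, c)) = A $$ (a, c)"
    using arg_cong[OF EA, of "\<lambda>X. X $$ (a, c)"] assms E A
    by (simp add: scalar_prod_def atLeast0LessThan)
  have "(\<Sum>b<N. Pr $$ (a, b) * A $$ (b, c)) = (\<Sum>b<N. (if b = a then A $$ (a, c) else 0) - E $$ (a, b) * A $$ (b, c))"
    using assms E unfolding E_def[symmetric] by (intro sum.cong) (auto simp: algebra_simps)
  also have "\<dots> = 0" using assms by (simp add: sum_subtractf sum)
  finally show ?thesis .
qed

text \<open>Cyclicity of the trace: the range part has the trace of \<open>Gm * inv_mat Gm\<close>,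
  the identity of size \<open>m\<close>.\<close>

lemma projector_trace:
  assumes "det Gm \<noteq> 0"
  shows "(\<Sum>a<N. Pr $$ (a, a)) = of_nat N - of_nat m"
proof -
  define B where "B = inv_mat Gm"
  have B: "B \<in> carrier_mat m m" unfolding B_def by (rule inv_gram_carrier)
  have "(\<Sum>a<N. (A * inv_mat Gm * mat_adjoint A) $$ (a, a)) =
      (\<Sum>a<N. \<Sum>c<m. \<Sum>d<m. A $$ (a, d) * B $$ (d, c) * cnj (A $$ (a, c)))"
    by (intro sum.cong refl) (simp only: projector_range_index B_def lessThan_iff)
  also have "\<dots> = (\<Sum>c<m. \<Sum>d<m. \<Sum>a<N. A $$ (a, d) * B $$ (d, c) * cnj (A $$ (a, c)))"
    by (subst sum.swap) (intro sum.cong refl sum.swap)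
  also have "\<dots> = (\<Sum>c<m. \<Sum>d<m. Gm $$ (c, d) * B $$ (d, c))"
  proof (intro sum.cong refl)
    fix c d assume "c \<in> {..<m}" "d \<in> {..<m}"
    then have "Gm $$ (c, d) = (\<Sum>a<N. cnj (A $$ (a, c)) * A $$ (a, d))"
      using A by (subst index_mult_mat_sum[of _ m N _ m]) auto
    then show "(\<Sum>a<N. A $$ (a, d) * B $$ (d, c) * cnj (A $$ (a, c))) = Gm $$ (c, d) * B $$ (d, c)"
      by (simp add: sum_distrib_left mult_ac)
  qed
  also have "\<dots> = (\<Sum>c<m. (Gm * B) $$ (c, c))"
    by (intro sum.cong refl index_mult_mat_sum[OF gram_carrier B, symmetric]) auto
  also have "\<dots> = of_nat m"
    using inv_mat_regular[OF gram_carrier assms] by (simp add: B_def)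
  finally have t: "(\<Sum>a<N. (A * inv_mat Gm * mat_adjoint A) $$ (a, a)) = of_nat m" .
  have "(\<Sum>a<N. Pr $$ (a, a)) = (\<Sum>a<N. 1 - (A * inv_mat Gm * mat_adjoint A) $$ (a, a))"
    using projector_range_carrier by (intro sum.cong) auto
  then show ?thesis by (simp add: sum_subtractf t)
qed

text \<open>If \<open>v\<close> lies in the kernel of the Gram matrix, then \<open>A\<close> maps
  \<open>v\<close> to a vector of norm zero, so the first \<open>m\<close> rows of \<open>A\<close>
  annihilate \<open>v\<close>. Looking at this square block reduces almost sure invertibility to a
  determinant with independent Gaussian entries.\<close>

lemma gram_nonsingular:
  assumes m: "m \<le> N" and top: "det (mat m m (\<lambda>ij. A $$ ij)) \<noteq> 0"
  shows "det Gm \<noteq> 0"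
proof
  assume "det Gm = 0"
  then obtain v where v: "v \<in> carrier_vec m" "v \<noteq> 0\<^sub>v m" "Gm *\<^sub>v v = 0\<^sub>v m"
    using det_0_iff_vec_prod_zero[OF gram_carrier] by auto
  define u where "u i = (\<Sum>j<m. A $$ (i, j) * vec_index v j)" for i
  have G0: "(\<Sum>i<N. cnj (A $$ (i, k)) * u i) = 0" if "k < m" for k
  proof -
    have "0 = vec_index (Gm *\<^sub>v v) k" using v that by simp
    also have "\<dots> = (\<Sum>j<m. Gm $$ (k, j) * vec_index v j)"
      by (rule index_mult_mat_vec_sum[OF gram_carrier v(1) that])
    also have "\<dots> = (\<Sum>j<m. (\<Sum>i<N. cnj (A $$ (i, k)) * A $$ (i, j)) * vec_index v j)"
    proof (rule sum.cong[OF refl])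
      fix j assume "j \<in> {..<m}"
      then show "Gm $$ (k, j) * vec_index v j = (\<Sum>i<N. cnj (A $$ (i, k)) * A $$ (i, j)) * vec_index v j"
        using A that by (subst index_mult_mat_sum[of _ m N _ m]) auto
    qed
    also have "\<dots> = (\<Sum>i<N. cnj (A $$ (i, k)) * u i)"
      unfolding sum_distrib_right u_def sum_distrib_left by (subst sum.swap) (simp add: mult.assoc)
    finally show ?thesis by simp
  qed
  have "(\<Sum>i<N. cnj (u i) * u i) = (\<Sum>i<N. \<Sum>k<m. cnj (vec_index v k) * (cnj (A $$ (i, k)) * u i))"
  proof (rule sum.cong[OF refl])
    fix i
    have "cnj (u i) = (\<Sum>k<m. cnj (vec_index v k) * cnj (A $$ (i, k)))"
      by (simp add: u_def mult.commute)
    then show "cnj (u i) * u i = (\<Sum>k<m. cnj (vec_index v k) * (cnj (A $$ (i, k)) * u i))"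
      by (simp add: sum_distrib_right mult.assoc)
  qed
  also have "\<dots> = (\<Sum>k<m. cnj (vec_index v k) * (\<Sum>i<N. cnj (A $$ (i, k)) * u i))"
    by (subst sum.swap) (simp add: sum_distrib_left)
  also have "\<dots> = 0" by (simp add: G0)
  finally have "(\<Sum>i<N. complex_of_real ((cmod (u i))\<^sup>2)) = 0"
    by (simp only: complex_norm_square mult.commute)
  then have "(\<Sum>i<N. (cmod (u i))\<^sup>2) = 0"
    by (simp only: of_real_sum[symmetric] of_real_eq_0_iff)
  then have u0: "u i = 0" if "i < N" for i
    using that by (subst (asm) sum_nonneg_eq_0_iff) auto
  have "mat m m (\<lambda>ij. A $$ ij) *\<^sub>v v = 0\<^sub>v m"
    using v m u0 by (intro eq_vecI) (auto simp: scalar_prod_def atLeast0LessThan u_def)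
  with v det_0_iff_vec_prod_zero[of "mat m m (\<lambda>ij. A $$ ij)" m] top show False by auto
qed

end

text \<open>For a Hermitian idempotent, row \<open>a\<close> has squared norm \<open>P a a\<close>.
  Hence the square of \<open>cmod (P a a)\<close> is at most \<open>cmod (P a a)\<close> itself,
  which bounds the diagonal by 1 and then every entry of the row.\<close>

lemma hermitian_projector_bounds:
  fixes P :: "nat \<Rightarrow> nat \<Rightarrow> complex"
  assumes herm: "\<And>a b. a < N \<Longrightarrow> b < N \<Longrightarrow> P a b = cnj (P b a)"
    and idem: "\<And>a b. a < N \<Longrightarrow> b < N \<Longrightarrow> (\<Sum>c<N. P a c * P c b) = P a b"
    and a: "a < N"
  shows "complex_of_real (\<Sum>c<N. (cmod (P a c))\<^sup>2) = P a a"
    and "b < N \<Longrightarrow> cmod (P a b) \<le> 1"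
proof -
  have eq: "complex_of_real (\<Sum>c<N. (cmod (P a c))\<^sup>2) = P a a" if a: "a < N" for a
  proof -
    have *: "complex_of_real ((cmod (P a c))\<^sup>2) = P a c * P c a" if "c < N" for c
    proof -
      have "P c a = cnj (P a c)" by (rule herm) fact+
      then show ?thesis using complex_norm_square[of "P a c"] by simp
    qed
    have "complex_of_real (\<Sum>c<N. (cmod (P a c))\<^sup>2) = (\<Sum>c<N. complex_of_real ((cmod (P a c))\<^sup>2))"
      by (rule of_real_sum)
    also have "\<dots> = (\<Sum>c<N. P a c * P c a)"
      by (rule sum.cong[OF refl], rule *, erule lessThan_iff[THEN iffD1])
    also have "\<dots> = P a a" by (rule idem[OF a a])
    finally show ?thesis .
  qed
  show "complex_of_real (\<Sum>c<N. (cmod (P a c))\<^sup>2) = P a a" by (rule eq) fact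
  have le: "(cmod (P a c))\<^sup>2 \<le> cmod (P a a)" if "c < N" for c
  proof -
    have "(cmod (P a c))\<^sup>2 \<le> (\<Sum>c<N. (cmod (P a c))\<^sup>2)"
      using that by (intro member_le_sum) auto
    also have "\<dots> = cmod (complex_of_real (\<Sum>c<N. (cmod (P a c))\<^sup>2))"
      by (simp only: norm_of_real) (simp add: sum_nonneg)
    also have "\<dots> = cmod (P a a)" by (simp only: eq[OF a])
    finally show ?thesis .
  qed
  have diag: "cmod (P a a) \<le> 1"
  proof (rule ccontr)
    assume "\<not> cmod (P a a) \<le> 1"
    then have "cmod (P a a) * 1 < cmod (P a a) * cmod (P a a)" by (intro mult_strict_left_mono) auto
    with le[OF a] show False by (simp add: power2_eq_square)
  qed
  show "cmod (P a b) \<le> 1" if "b < N"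
  proof -
    have "(cmod (P a b))\<^sup>2 \<le> 1" using le[OF that] diag by simp
    then show ?thesis by (simp add: abs_square_le_1)
  qed
qed

section \<open>Families of independent complex normal variables\<close>

locale gaussian_family = prob_space M
  for M :: "'w measure" +
  fixes Z :: "'i \<Rightarrow> 'w \<Rightarrow> complex" and S :: "'i set" and var :: "'i \<Rightarrow> real"
  assumes indep_Z: "indep_vars (\<lambda>_. borel) Z S"
    and law_Z: "\<And>i. i \<in> S \<Longrightarrow> distr M borel (Z i) = CN (var i)"
    and var_pos: "\<And>i. i \<in> S \<Longrightarrow> 0 < var i"
begin

lemma Z_measurable: "i \<in> S \<Longrightarrow> Z i \<in> borel_measurable M"
  using indep_Z by (auto simp: indep_vars_def)

text \<open>The sigma-algebra generated by the variables with labels in \<open>I\<close>.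
  Measurability with respect to it encodes being a function of these variables, so that independence
  of composite quantities becomes disjointness of label sets.\<close>

definition Sg :: "'i set \<Rightarrow> 'w measure" where
  "Sg I = vimage_algebra (space M) (\<lambda>\<omega>. \<lambda>i\<in>I. Z i \<omega>) (PiM I (\<lambda>_. borel))"

lemma space_Sg[simp]: "space (Sg I) = space M"
  by (simp add: Sg_def)

lemma restrict_Z_measurable: "I \<subseteq> S \<Longrightarrow> (\<lambda>\<omega>. \<lambda>i\<in>I. Z i \<omega>) \<in> M \<rightarrow>\<^sub>M PiM I (\<lambda>_. borel)"
  by (intro measurable_restrict Z_measurable) auto

lemma restrict_Z_Sg: "(\<lambda>\<omega>. \<lambda>i\<in>I. Z i \<omega>) \<in> Sg I \<rightarrow>\<^sub>M PiM I (\<lambda>_. borel)"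
  unfolding Sg_def by (intro measurable_vimage_algebra1) (auto simp: space_PiM)

lemma Z_Sg: "i \<in> I \<Longrightarrow> Z i \<in> borel_measurable (Sg I)"
  using measurable_compose[OF restrict_Z_Sg measurable_component_singleton, of i I] by simp

lemma sets_Sg: "sets (Sg I) = {(\<lambda>\<omega>. \<lambda>i\<in>I. Z i \<omega>) -` A \<inter> space M | A. A \<in> sets (PiM I (\<lambda>_. borel))}"
  unfolding Sg_def by (rule sets_vimage_algebra2) (auto simp: space_PiM)

lemma measurable_Sg_mono:
  assumes "I \<subseteq> J" "f \<in> Sg I \<rightarrow>\<^sub>M N" shows "f \<in> Sg J \<rightarrow>\<^sub>M N"
proof -
  have "(\<lambda>\<omega>. \<lambda>i\<in>I. Z i \<omega>) \<in> Sg J \<rightarrow>\<^sub>M PiM I (\<lambda>_. borel)"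
    using assms(1) by (intro measurable_restrict Z_Sg) auto
  then have "sets (Sg I) \<subseteq> sets (Sg J)"
    unfolding sets_Sg[of I] by (auto dest: measurable_sets)
  then have "Sg J \<rightarrow>\<^sub>M N \<supseteq> Sg I \<rightarrow>\<^sub>M N"
    by (auto simp: measurable_def)
  with assms show ?thesis by auto
qed

lemma measurable_Sg_M:
  assumes "I \<subseteq> S" "f \<in> Sg I \<rightarrow>\<^sub>M N" shows "f \<in> M \<rightarrow>\<^sub>M N"
proof -
  have "sets (Sg I) \<subseteq> sets M"
    unfolding sets_Sg[of I] using restrict_Z_measurable[OF assms(1)] by (auto dest: measurable_sets)
  then have "M \<rightarrow>\<^sub>M N \<supseteq> Sg I \<rightarrow>\<^sub>M N"
    by (auto simp: measurable_def)
  with assms show ?thesis by auto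
qed

lemma prob_Sg_indep:
  assumes IJ: "I \<subseteq> S" "J \<subseteq> S" "I \<inter> J = {}" and A: "A \<in> sets (Sg I)" and B: "B \<in> sets (Sg J)"
  shows "prob (A \<inter> B) = prob A * prob B"
proof -
  from A B obtain A' B' where
    A': "A' \<in> sets (PiM I (\<lambda>_. borel))" "A = (\<lambda>\<omega>. \<lambda>i\<in>I. Z i \<omega>) -` A' \<inter> space M" and
    B': "B' \<in> sets (PiM J (\<lambda>_. borel))" "B = (\<lambda>\<omega>. \<lambda>i\<in>J. Z i \<omega>) -` B' \<inter> space M"
    unfolding sets_Sg by auto
  have "indep_var (PiM I (\<lambda>_. borel)) (\<lambda>\<omega>. \<lambda>i\<in>I. Z i \<omega>) (PiM J (\<lambda>_. borel)) (\<lambda>\<omega>. \<lambda>i\<in>J. Z i \<omega>)"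
    by (rule indep_var_restrict[OF indep_Z]) (use IJ in auto)
  from indep_varD[OF this A'(1) B'(1)] show ?thesis
    unfolding A' B' by (simp add: Int_def vimage_def conj_ac)
qed

lemma distr_Sg_indep:
  assumes IJ: "I \<subseteq> S" "J \<subseteq> S" "I \<inter> J = {}" and f: "f \<in> Sg I \<rightarrow>\<^sub>M N1" and g: "g \<in> Sg J \<rightarrow>\<^sub>M N2"
  shows "distr M (N1 \<Otimes>\<^sub>M N2) (\<lambda>\<omega>. (f \<omega>, g \<omega>)) = distr M N1 f \<Otimes>\<^sub>M distr M N2 g"
proof -
  have [measurable]: "f \<in> M \<rightarrow>\<^sub>M N1" "g \<in> M \<rightarrow>\<^sub>M N2"
    using measurable_Sg_M[OF IJ(1) f] measurable_Sg_M[OF IJ(2) g] .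
  interpret F: prob_space "distr M N1 f" by (rule prob_space_distr) simp
  interpret G: prob_space "distr M N2 g" by (rule prob_space_distr) simp
  show ?thesis
  proof (rule pair_measure_eqI[symmetric])
    show "sigma_finite_measure (distr M N1 f)" "sigma_finite_measure (distr M N2 g)" by unfold_locales
    show "sets (distr M N1 f \<Otimes>\<^sub>M distr M N2 g) = sets (distr M (N1 \<Otimes>\<^sub>M N2) (\<lambda>\<omega>. (f \<omega>, g \<omega>)))"
      by (simp cong: sets_pair_measure_cong)
    fix A B assume "A \<in> sets (distr M N1 f)" "B \<in> sets (distr M N2 g)"
    then have AB[measurable]: "A \<in> sets N1" "B \<in> sets N2" by auto
    have "(\<lambda>\<omega>. (f \<omega>, g \<omega>)) -` (A \<times> B) \<inter> space M = (f -` A \<inter> space M) \<inter> (g -` B \<inter> space M)" by auto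
    moreover have "prob ((f -` A \<inter> space M) \<inter> (g -` B \<inter> space M)) = prob (f -` A \<inter> space M) * prob (g -` B \<inter> space M)"
      using measurable_sets[OF f AB(1)] measurable_sets[OF g AB(2)] by (intro prob_Sg_indep[OF IJ]) auto
    ultimately show "emeasure (distr M N1 f) A * emeasure (distr M N2 g) B =
        emeasure (distr M (N1 \<Otimes>\<^sub>M N2) (\<lambda>\<omega>. (f \<omega>, g \<omega>))) (A \<times> B)"
      by (simp add: emeasure_distr emeasure_eq_measure ennreal_mult)
  qed
qed

lemma indep_var_Sg:
  assumes IJ: "I \<subseteq> S" "J \<subseteq> S" "I \<inter> J = {}" and f: "f \<in> Sg I \<rightarrow>\<^sub>M N1" and g: "g \<in> Sg J \<rightarrow>\<^sub>M N2"
  shows "indep_var N1 f N2 g"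
  unfolding indep_var_distribution_eq
  using distr_Sg_indep[OF assms] measurable_Sg_M[OF IJ(1) f] measurable_Sg_M[OF IJ(2) g] by simp

lemma Sg_expectation_mult:
  fixes f g :: "'w \<Rightarrow> complex"
  assumes IJ: "I \<subseteq> S" "J \<subseteq> S" "I \<inter> J = {}"
    and fg: "f \<in> borel_measurable (Sg I)" "g \<in> borel_measurable (Sg J)" "integrable M f" "integrable M g"
  shows "integrable M (\<lambda>\<omega>. f \<omega> * g \<omega>)"
    and "expectation (\<lambda>\<omega>. f \<omega> * g \<omega>) = expectation f * expectation g"
  using indep_var_integrable[OF indep_var_Sg[OF IJ fg(1,2)] fg(3,4)]
    indep_var_lebesgue_integral[OF indep_var_Sg[OF IJ fg(1,2)] fg(3,4)] by auto

text \<open>Given \<open>f\<close>, which is independent of \<open>Z i\<close>, equality asks an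
  atomless law to hit a single point; Fubini's theorem applied to the diagonal makes this
  precise.\<close>

lemma AE_Z_neq:
  assumes i: "i \<in> S" "i \<notin> I" and I: "I \<subseteq> S" and f: "f \<in> borel_measurable (Sg I)"
  shows "AE \<omega> in M. Z i \<omega> \<noteq> f \<omega>"
proof -
  have IJ: "I \<subseteq> S" "{i} \<subseteq> S" "I \<inter> {i} = {}" using i I by auto
  have Zm[measurable]: "Z i \<in> borel_measurable M" using Z_measurable i by simp
  have fm[measurable]: "f \<in> borel_measurable M" by (rule measurable_Sg_M[OF I f])
  interpret C: prob_space "CN (var i)" by (rule prob_space_CN[OF var_pos[OF i(1)]])
  interpret F: prob_space "distr M borel f" by (rule prob_space_distr) simp
  define D where "D = {p :: complex \<times> complex. fst p = snd p}"
  have D[measurable]: "D \<in> sets (borel \<Otimes>\<^sub>M borel)"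
    unfolding D_def borel_prod by (intro borel_closed closed_Collect_eq continuous_intros)
  have sing: "emeasure (CN (var i)) {x} = 0" for x
    unfolding CN_def by (subst emeasure_density) (auto simp: nn_integral_null_set null_setsI)
  have "emeasure M {\<omega>\<in>space M. Z i \<omega> = f \<omega>} = emeasure (distr M (borel \<Otimes>\<^sub>M borel) (\<lambda>\<omega>. (f \<omega>, Z i \<omega>))) D"
    by (subst emeasure_distr) (use D in \<open>auto intro!: arg_cong2[where f=emeasure]\<close>, auto simp: D_def)
  also have "\<dots> = emeasure (distr M borel f \<Otimes>\<^sub>M CN (var i)) D"
    using distr_Sg_indep[OF IJ f Z_Sg[of i "{i}"]] law_Z[OF i(1)] by simp
  also have "\<dots> = (\<integral>\<^sup>+x. emeasure (CN (var i)) (Pair x -` D) \<partial>distr M borel f)"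
    by (rule C.emeasure_pair_measure_alt) (simp cong: sets_pair_measure_cong)
  also have "\<dots> = (\<integral>\<^sup>+x. emeasure (CN (var i)) {x} \<partial>distr M borel f)"
    by (intro nn_integral_cong arg_cong2[where f=emeasure]) (auto simp: D_def)
  finally have "emeasure M {\<omega>\<in>space M. Z i \<omega> = f \<omega>} = 0" by (simp add: sing)
  then show ?thesis
    by (intro AE_I[of _ _ "{\<omega>\<in>space M. Z i \<omega> = f \<omega>}"]) auto
qed

end

section \<open>Measurability of determinants and cofactors\<close>

lemma det_measurable:
  fixes A :: "'w \<Rightarrow> complex mat"
  assumes "\<And>\<omega>. \<omega> \<in> space M \<Longrightarrow> A \<omega> \<in> carrier_mat n n"
    and [measurable]: "\<And>i j. i < n \<Longrightarrow> j < n \<Longrightarrow> (\<lambda>\<omega>. A \<omega> $$ (i, j)) \<in> borel_measurable M"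
  shows "(\<lambda>\<omega>. det (A \<omega>)) \<in> borel_measurable M"
proof -
  have "(\<lambda>\<omega>. \<Sum>p\<in>{p. p permutes {0..<n}}. signof p * (\<Prod>i=0..<n. A \<omega> $$ (i, p i))) \<in> borel_measurable M"
  proof (intro borel_measurable_sum borel_measurable_times borel_measurable_const borel_measurable_prod)
    fix p i assume "p \<in> {p. p permutes {0..<n}}" "i \<in> {0..<n}"
    then show "(\<lambda>\<omega>. A \<omega> $$ (i, p i)) \<in> borel_measurable M"
      using permutes_in_image[of p "{0..<n}" i] by (intro assms(2)) auto
  qed
  then show ?thesis
    by (rule measurable_cong[THEN iffD2, rotated]) (rule det_def'[OF assms(1)])
qed

text \<open>Row \<open>k\<close> and column \<open>l\<close> are exempt from the measurability
  assumption. Consequently the cofactors along the first column are functions of the entries other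
  than the corner one, which the almost sure statement on determinants exploits.\<close>

lemma cofactor_measurable:
  fixes A :: "'w \<Rightarrow> complex mat"
  assumes "\<And>\<omega>. \<omega> \<in> space M \<Longrightarrow> A \<omega> \<in> carrier_mat n n"
    and "\<And>i j. i < n \<Longrightarrow> j < n \<Longrightarrow> i \<noteq> k \<Longrightarrow> j \<noteq> l \<Longrightarrow> (\<lambda>\<omega>. A \<omega> $$ (i, j)) \<in> borel_measurable M"
    and kl: "k < n" "l < n"
  shows "(\<lambda>\<omega>. cofactor (A \<omega>) k l) \<in> borel_measurable M"
proof -
  have "(\<lambda>\<omega>. det (mat_delete (A \<omega>) k l)) \<in> borel_measurable M"
  proof (rule det_measurable[where n="n - 1"])
    show "mat_delete (A \<omega>) k l \<in> carrier_mat (n - 1) (n - 1)" if "\<omega> \<in> space M" for \<omega>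
      using assms(1)[OF that] by (rule mat_delete_carrier)
    fix i j assume ij: "i < n - 1" "j < n - 1"
    have "(\<lambda>\<omega>. A \<omega> $$ (if i < k then i else Suc i, if j < l then j else Suc j)) \<in> borel_measurable M"
      using ij kl by (intro assms(2)) auto
    moreover have "mat_delete (A \<omega>) k l $$ (i, j) = A \<omega> $$ (if i < k then i else Suc i, if j < l then j else Suc j)"
      if "\<omega> \<in> space M" for \<omega>
      using assms(1)[OF that] ij by (simp add: mat_delete_def)
    ultimately show "(\<lambda>\<omega>. mat_delete (A \<omega>) k l $$ (i, j)) \<in> borel_measurable M"
      by (subst measurable_cong) auto
  qed
  then show ?thesis unfolding cofactor_def by measurable
qed

section \<open>Almost sure invertibility of square Gaussian matrices\<close>

context gaussian_family
begin

text \<open>Laplace expansion along the first column writes the determinant as the corner entry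
  times its cofactor plus \<open>R\<close>, where cofactor and \<open>R\<close> are functions of the
  remaining entries. The cofactor is almost surely nonzero by induction, so a vanishing determinant
  would pin the corner entry to a value independent of it.\<close>

lemma AE_det_neq_0:
  assumes "inj_on (\<lambda>(r, c). F r c) ({..<n} \<times> {..<n})" "\<And>r c. r < n \<Longrightarrow> c < n \<Longrightarrow> F r c \<in> S"
  shows "AE \<omega> in M. det (mat n n (\<lambda>(r, c). Z (F r c) \<omega>)) \<noteq> 0"
  using assms
proof (induction n arbitrary: F)
  case 0
  show ?case by simp
next
  case (Suc n)
  define A where "A \<omega> = mat (Suc n) (Suc n) (\<lambda>(r, c). Z (F r c) \<omega>)" for \<omega>
  have Ac: "A \<omega> \<in> carrier_mat (Suc n) (Suc n)" for \<omega> by (simp add: A_def)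
  have del: "mat_delete (A \<omega>) 0 0 = mat n n (\<lambda>(r, c). Z (F (Suc r) (Suc c)) \<omega>)" for \<omega>
    unfolding mat_delete_def A_def by (rule eq_matI) auto
  have "AE \<omega> in M. det (mat n n (\<lambda>(r, c). Z (F (Suc r) (Suc c)) \<omega>)) \<noteq> 0"
    by (rule Suc.IH) (use Suc.prems in \<open>auto simp: inj_on_def\<close>)
  then have IH: "AE \<omega> in M. cofactor (A \<omega>) 0 0 \<noteq> 0"
    unfolding cofactor_def del by simp
  define I where "I = (\<lambda>(r, c). F r c) ` ({..<Suc n} \<times> {..<Suc n}) - {F 0 0}"
  have IS: "I \<subseteq> S" using Suc.prems(2) by (auto simp: I_def)
  have FI: "F r c \<in> I" if "r < Suc n" "c < Suc n" "(r, c) \<noteq> (0, 0)" for r c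
  proof -
    have "F r c \<noteq> F 0 0" using inj_onD[OF Suc.prems(1), of "(r, c)" "(0, 0)"] that by auto
    then show ?thesis using that by (auto simp: I_def)
  qed
  define R where "R \<omega> = (\<Sum>i\<in>{1..n}. A \<omega> $$ (i, 0) * cofactor (A \<omega>) i 0)" for \<omega>
  have ent: "(\<lambda>\<omega>. A \<omega> $$ (r, c)) \<in> borel_measurable (Sg I)" if "r < Suc n" "c < Suc n" "(r, c) \<noteq> (0, 0)" for r c
    using that Z_Sg[OF FI[OF that]] by (simp add: A_def)
  have cof: "(\<lambda>\<omega>. cofactor (A \<omega>) i 0) \<in> borel_measurable (Sg I)" if "i < Suc n" for i
    by (rule cofactor_measurable[where n="Suc n"]) (use Ac ent that in auto)
  have "R \<in> borel_measurable (Sg I)"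
    unfolding R_def by (intro borel_measurable_sum borel_measurable_times ent cof) auto
  then have "(\<lambda>\<omega>. - R \<omega> / cofactor (A \<omega>) 0 0) \<in> borel_measurable (Sg I)"
    using cof[of 0] by measurable
  then have "AE \<omega> in M. Z (F 0 0) \<omega> \<noteq> - R \<omega> / cofactor (A \<omega>) 0 0"
    by (rule AE_Z_neq[rotated -1]) (use Suc.prems(2) IS in \<open>auto simp: I_def\<close>)
  with IH have "AE \<omega> in M. det (A \<omega>) \<noteq> 0"
  proof eventually_elim
    case (elim \<omega>)
    have "det (A \<omega>) = (\<Sum>i<Suc n. A \<omega> $$ (i, 0) * cofactor (A \<omega>) i 0)"
      by (rule laplace_expansion_column[OF Ac]) simp
    also have "{..<Suc n} = insert 0 {1..n}" by auto
    finally have "det (A \<omega>) = Z (F 0 0) \<omega> * cofactor (A \<omega>) 0 0 + R \<omega>"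
      by (simp add: R_def A_def)
    with elim show ?case by (auto simp: field_simps eq_neg_iff_add_eq_0)
  qed
  then show ?case by (simp add: A_def)
qed

end

text \<open>A class closed under sums, products and conjugation, so that integrability of every
  polynomial expression follows from its shape. The bound \<open>C\<close> is chosen before the
  interval index \<open>b\<close>, which gives the uniformity that the weak law over intervals asks
  for.\<close>

definition bounded_moments :: "'w measure \<Rightarrow> (nat \<Rightarrow> 'w \<Rightarrow> complex) \<Rightarrow> bool" where
  "bounded_moments M f \<longleftrightarrow> (\<forall>b. f b \<in> borel_measurable M) \<and>
     (\<forall>p. \<exists>C. \<forall>b. integrable M (\<lambda>\<omega>. cmod (f b \<omega>) ^ p) \<and> (\<integral>\<omega>. cmod (f b \<omega>) ^ p \<partial>M) \<le> C)"

lemma bounded_moments_measurable: "bounded_moments M f \<Longrightarrow> f b \<in> borel_measurable M"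
  and bounded_moments_integrable_power: "bounded_moments M f \<Longrightarrow> integrable M (\<lambda>\<omega>. cmod (f b \<omega>) ^ p)"
  by (auto simp: bounded_moments_def)

lemma bounded_moments_integrable: "bounded_moments M f \<Longrightarrow> integrable M (f b)"
  using bounded_moments_integrable_power[of M f b 1] bounded_moments_measurable[of M f b] by (simp add: integrable_norm_iff)

lemma bounded_moments_dominated:
  assumes g: "bounded_moments M g" and f: "\<And>b. f b \<in> borel_measurable M"
    and le: "\<And>b \<omega>. \<omega> \<in> space M \<Longrightarrow> cmod (f b \<omega>) \<le> cmod (g b \<omega>)"
  shows "bounded_moments M f"
  unfolding bounded_moments_def
proof (intro conjI allI)
  fix p
  obtain C where C: "\<And>b. integrable M (\<lambda>\<omega>. cmod (g b \<omega>) ^ p)" "\<And>b. (\<integral>\<omega>. cmod (g b \<omega>) ^ p \<partial>M) \<le> C"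
    using g unfolding bounded_moments_def by metis
  have le': "cmod (f b \<omega>) ^ p \<le> cmod (g b \<omega>) ^ p" if "\<omega> \<in> space M" for b \<omega>
    using le[OF that] by (intro power_mono) auto
  have i: "integrable M (\<lambda>\<omega>. cmod (f b \<omega>) ^ p)" for b
    using f by (intro Bochner_Integration.integrable_bound[OF C(1)[of b]]) (auto intro!: AE_I2 le')
  moreover have "(\<integral>\<omega>. cmod (f b \<omega>) ^ p \<partial>M) \<le> C" for b
    using integral_mono[OF i[of b] C(1)[of b] le'] C(2)[of b] by linarith
  ultimately show "\<exists>C. \<forall>b. integrable M (\<lambda>\<omega>. cmod (f b \<omega>) ^ p) \<and> (\<integral>\<omega>. cmod (f b \<omega>) ^ p \<partial>M) \<le> C" by blast
qed (rule f)

lemma bounded_moments_cnj: "bounded_moments M f \<Longrightarrow> bounded_moments M (\<lambda>b \<omega>. cnj (f b \<omega>))"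
  by (simp add: bounded_moments_def borel_measurable_cnj)

lemma bounded_moments_add:
  assumes f: "bounded_moments M f" and g: "bounded_moments M g"
  shows "bounded_moments M (\<lambda>b \<omega>. f b \<omega> + g b \<omega>)"
  unfolding bounded_moments_def
proof (intro conjI allI)
  note [measurable] = bounded_moments_measurable[OF f] bounded_moments_measurable[OF g]
  show "(\<lambda>\<omega>. f b \<omega> + g b \<omega>) \<in> borel_measurable M" for b by measurable
  fix p
  obtain C where C: "\<And>b. integrable M (\<lambda>\<omega>. cmod (f b \<omega>) ^ p)" "\<And>b. (\<integral>\<omega>. cmod (f b \<omega>) ^ p \<partial>M) \<le> C"
    using f unfolding bounded_moments_def by metis
  obtain E where E: "\<And>b. integrable M (\<lambda>\<omega>. cmod (g b \<omega>) ^ p)" "\<And>b. (\<integral>\<omega>. cmod (g b \<omega>) ^ p \<partial>M) \<le> E"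
    using g unfolding bounded_moments_def by metis
  have I: "integrable M (\<lambda>\<omega>. 2 ^ p * (cmod (f b \<omega>) ^ p + cmod (g b \<omega>) ^ p))" for b
    using C(1) E(1) by (intro integrable_mult_right Bochner_Integration.integrable_add)
  have i: "integrable M (\<lambda>\<omega>. cmod (f b \<omega> + g b \<omega>) ^ p)" for b
    by (rule Bochner_Integration.integrable_bound[OF I[of b]]) (auto intro!: AE_I2 norm_add_power_le order_trans[OF norm_add_power_le])
  moreover have "(\<integral>\<omega>. cmod (f b \<omega> + g b \<omega>) ^ p \<partial>M) \<le> 2 ^ p * (C + E)" for b
  proof -
    have "(\<integral>\<omega>. cmod (f b \<omega> + g b \<omega>) ^ p \<partial>M) \<le> (\<integral>\<omega>. 2 ^ p * (cmod (f b \<omega>) ^ p + cmod (g b \<omega>) ^ p) \<partial>M)"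
      by (rule integral_mono[OF i I]) (rule norm_add_power_le)
    also have "\<dots> \<le> 2 ^ p * (C + E)" using C E by (simp add: add_mono)
    finally show ?thesis .
  qed
  ultimately show "\<exists>C. \<forall>b. integrable M (\<lambda>\<omega>. cmod (f b \<omega> + g b \<omega>) ^ p) \<and> (\<integral>\<omega>. cmod (f b \<omega> + g b \<omega>) ^ p \<partial>M) \<le> C" by blast
qed

text \<open>The moment of order \<open>p\<close> of a product is controlled by the moments of order
  \<open>2 * p\<close> of the factors; closure under products is thus the reason for asking all
  orders in the class.\<close>

lemma bounded_moments_mult:
  assumes f: "bounded_moments M f" and g: "bounded_moments M g"
  shows "bounded_moments M (\<lambda>b \<omega>. f b \<omega> * g b \<omega>)"
  unfolding bounded_moments_def
proof (intro conjI allI)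
  note [measurable] = bounded_moments_measurable[OF f] bounded_moments_measurable[OF g]
  show "(\<lambda>\<omega>. f b \<omega> * g b \<omega>) \<in> borel_measurable M" for b by measurable
  fix p
  obtain C where C: "\<And>b. integrable M (\<lambda>\<omega>. cmod (f b \<omega>) ^ (2 * p))" "\<And>b. (\<integral>\<omega>. cmod (f b \<omega>) ^ (2 * p) \<partial>M) \<le> C"
    using f unfolding bounded_moments_def by metis
  obtain E where E: "\<And>b. integrable M (\<lambda>\<omega>. cmod (g b \<omega>) ^ (2 * p))" "\<And>b. (\<integral>\<omega>. cmod (g b \<omega>) ^ (2 * p) \<partial>M) \<le> E"
    using g unfolding bounded_moments_def by metis
  have le: "cmod (f b \<omega> * g b \<omega>) ^ p \<le> cmod (f b \<omega>) ^ (2 * p) + cmod (g b \<omega>) ^ (2 * p)" for b \<omega>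
  proof -
    have "0 \<le> (cmod (f b \<omega>) ^ p - cmod (g b \<omega>) ^ p)\<^sup>2 + (cmod (f b \<omega>) ^ p)\<^sup>2 + (cmod (g b \<omega>) ^ p)\<^sup>2" by simp
    then have "2 * (cmod (f b \<omega>) ^ p * cmod (g b \<omega>) ^ p) \<le> 2 * ((cmod (f b \<omega>) ^ p)\<^sup>2 + (cmod (g b \<omega>) ^ p)\<^sup>2)"
      by (simp add: power2_diff)
    then show ?thesis
      by (simp add: norm_mult power_mult_distrib power_even_eq mult.commute[of 2 p] power_mult)
  qed
  have I: "integrable M (\<lambda>\<omega>. cmod (f b \<omega>) ^ (2 * p) + cmod (g b \<omega>) ^ (2 * p))" for b
    using C(1) E(1) by (intro Bochner_Integration.integrable_add)
  have i: "integrable M (\<lambda>\<omega>. cmod (f b \<omega> * g b \<omega>) ^ p)" for b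
    by (rule Bochner_Integration.integrable_bound[OF I[of b]])
       (measurable, auto intro!: AE_I2 order_trans[OF le])
  moreover have "(\<integral>\<omega>. cmod (f b \<omega> * g b \<omega>) ^ p \<partial>M) \<le> C + E" for b
  proof -
    have "(\<integral>\<omega>. cmod (f b \<omega> * g b \<omega>) ^ p \<partial>M) \<le> (\<integral>\<omega>. cmod (f b \<omega>) ^ (2 * p) + cmod (g b \<omega>) ^ (2 * p) \<partial>M)"
      by (rule integral_mono[OF i I]) (rule le)
    also have "\<dots> \<le> C + E" using C E by (simp add: add_mono)
    finally show ?thesis .
  qed
  ultimately show "\<exists>C. \<forall>b. integrable M (\<lambda>\<omega>. cmod (f b \<omega> * g b \<omega>) ^ p) \<and> (\<integral>\<omega>. cmod (f b \<omega> * g b \<omega>) ^ p \<partial>M) \<le> C" by blast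
qed

lemma (in prob_space) bounded_moments_const: "bounded_moments M (\<lambda>b \<omega>. c)"
  unfolding bounded_moments_def by (auto simp: prob_space)

lemma (in prob_space) bounded_moments_sum:
  assumes "\<And>e. e \<in> A \<Longrightarrow> bounded_moments M (f e)"
  shows "bounded_moments M (\<lambda>b \<omega>. \<Sum>e\<in>A. f e b \<omega>)"
  using assms
  by (induction A rule: infinite_finite_induct) (auto intro: bounded_moments_add bounded_moments_const)

lemma (in prob_space) bounded_moments_minus:
  "bounded_moments M f \<Longrightarrow> bounded_moments M g \<Longrightarrow> bounded_moments M (\<lambda>b \<omega>. f b \<omega> - g b \<omega>)"
  using bounded_moments_add[of M f "\<lambda>b \<omega>. (- 1) * g b \<omega>"] bounded_moments_mult[OF bounded_moments_const[of "-1"], of g] by simp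

section \<open>Second and fourth moments of Gaussian forms with random coefficients\<close>

context gaussian_family
begin

lemma Z_power_integrable:
  assumes "i \<in> S" shows "integrable M (\<lambda>\<omega>. cmod (Z i \<omega>) ^ p)"
  using integrable_CN_power[OF var_pos[OF assms], of p] Z_measurable[OF assms]
  unfolding law_Z[OF assms, symmetric] by (simp add: integrable_distr_eq)

lemma bounded_moments_Z:
  assumes "\<And>b. i b \<in> S" "\<And>b. var (i b) = v"
  shows "bounded_moments M (\<lambda>b. Z (i b))"
  unfolding bounded_moments_def
proof (intro conjI allI)
  show "Z (i b) \<in> borel_measurable M" for b using assms Z_measurable by simp
  fix p
  have "(\<integral>\<omega>. cmod (Z (i b) \<omega>) ^ p \<partial>M) \<le> (\<integral>x. cmod x ^ p \<partial>CN v)" for b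
    using Z_measurable[OF assms(1)[of b]]
    unfolding assms(2)[of b, symmetric] law_Z[OF assms(1)[of b], symmetric] by (simp add: integral_distr)
  then show "\<exists>C. \<forall>b. integrable M (\<lambda>\<omega>. cmod (Z (i b) \<omega>) ^ p) \<and> (\<integral>\<omega>. cmod (Z (i b) \<omega>) ^ p \<partial>M) \<le> C"
    using Z_power_integrable assms(1) by blast
qed

lemma Z_moments:
  assumes "i \<in> S" "p \<le> 2" "q \<le> 2"
  shows "integrable M (\<lambda>\<omega>. Z i \<omega> ^ p * cnj (Z i \<omega>) ^ q)"
    and "expectation (\<lambda>\<omega>. Z i \<omega> ^ p * cnj (Z i \<omega>) ^ q) = (if p = q then of_real (fact p * var i ^ p) else 0)"
proof -
  note [measurable] = Z_measurable[OF assms(1)]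
  show "integrable M (\<lambda>\<omega>. Z i \<omega> ^ p * cnj (Z i \<omega>) ^ q)"
    by (rule Bochner_Integration.integrable_bound[OF Z_power_integrable[OF assms(1), of "p + q"]])
       (auto simp: norm_mult norm_power power_add)
  have "expectation (\<lambda>\<omega>. Z i \<omega> ^ p * cnj (Z i \<omega>) ^ q) = (\<integral>x. x ^ p * cnj x ^ q \<partial>CN (var i))"
    unfolding law_Z[OF assms(1), symmetric] by (subst integral_distr) auto
  then show "expectation (\<lambda>\<omega>. Z i \<omega> ^ p * cnj (Z i \<omega>) ^ q) = (if p = q then of_real (fact p * var i ^ p) else 0)"
    using CN_moments[OF var_pos[OF assms(1)] assms(2,3)] by simp
qed

lemma integrable_mult_L2:
  fixes f g :: "'w \<Rightarrow> complex"
  assumes [measurable]: "f \<in> borel_measurable M" "g \<in> borel_measurable M"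
    and "integrable M (\<lambda>\<omega>. (cmod (f \<omega>))\<^sup>2)" "integrable M (\<lambda>\<omega>. (cmod (g \<omega>))\<^sup>2)"
  shows "integrable M (\<lambda>\<omega>. f \<omega> * g \<omega>)"
proof (rule Bochner_Integration.integrable_bound)
  show "integrable M (\<lambda>\<omega>. (cmod (f \<omega>))\<^sup>2 + (cmod (g \<omega>))\<^sup>2)" using assms by simp
  show "AE \<omega> in M. norm (f \<omega> * g \<omega>) \<le> norm ((cmod (f \<omega>))\<^sup>2 + (cmod (g \<omega>))\<^sup>2)"
  proof (rule AE_I2)
    fix \<omega>
    have "0 \<le> (cmod (f \<omega>) - cmod (g \<omega>))\<^sup>2 + (cmod (f \<omega>))\<^sup>2 + (cmod (g \<omega>))\<^sup>2" by simp
    then show "norm (f \<omega> * g \<omega>) \<le> norm ((cmod (f \<omega>))\<^sup>2 + (cmod (g \<omega>))\<^sup>2)"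
      by (simp add: norm_mult power2_diff)
  qed
qed measurable

text \<open>The coefficients may be random as long as they depend on the labels in \<open>I\<close>.
  Terms are added one at a time: the new \<open>Z e\<close> is centered and independent of its
  coefficient and of all that has been accumulated, so the mixed expectation factors with a factor 0
  and the square term with a factor \<open>var e\<close>.\<close>

lemma pythagoras:
  assumes E: "finite E" "E \<subseteq> S" and I: "I \<subseteq> S" "I \<inter> E = {}"
    and \<phi>: "\<phi> \<in> borel_measurable (Sg I)" "integrable M (\<lambda>\<omega>. (cmod (\<phi> \<omega>))\<^sup>2)"
    and f: "\<And>e. e \<in> E \<Longrightarrow> f e \<in> borel_measurable (Sg I)" "\<And>e. e \<in> E \<Longrightarrow> integrable M (\<lambda>\<omega>. (cmod (f e \<omega>))\<^sup>2)"
  shows "integrable M (\<lambda>\<omega>. (cmod (\<phi> \<omega> + (\<Sum>e\<in>E. f e \<omega> * Z e \<omega>)))\<^sup>2) \<and>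
    expectation (\<lambda>\<omega>. (cmod (\<phi> \<omega> + (\<Sum>e\<in>E. f e \<omega> * Z e \<omega>)))\<^sup>2) =
      expectation (\<lambda>\<omega>. (cmod (\<phi> \<omega>))\<^sup>2) + (\<Sum>e\<in>E. var e * expectation (\<lambda>\<omega>. (cmod (f e \<omega>))\<^sup>2))"
  using E I(2) f
proof (induction E)
  case empty
  show ?case using \<phi> by simp
next
  case (insert e E)
  define \<psi> where "\<psi> \<omega> = \<phi> \<omega> + (\<Sum>e\<in>E. f e \<omega> * Z e \<omega>)" for \<omega>
  have IH: "integrable M (\<lambda>\<omega>. (cmod (\<psi> \<omega>))\<^sup>2)"
    "expectation (\<lambda>\<omega>. (cmod (\<psi> \<omega>))\<^sup>2) = expectation (\<lambda>\<omega>. (cmod (\<phi> \<omega>))\<^sup>2) + (\<Sum>e\<in>E. var e * expectation (\<lambda>\<omega>. (cmod (f e \<omega>))\<^sup>2))"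
    unfolding \<psi>_def using insert by auto
  define J where "J = I \<union> E"
  have J: "J \<subseteq> S" "{e} \<subseteq> S" "J \<inter> {e} = {}" using insert I by (auto simp: J_def)
  have mono: "h \<in> borel_measurable (Sg I) \<Longrightarrow> h \<in> borel_measurable (Sg J)" for h :: "'w \<Rightarrow> complex"
    by (rule measurable_Sg_mono[of I]) (auto simp: J_def)
  have \<psi>: "\<psi> \<in> borel_measurable (Sg J)"
    unfolding \<psi>_def
  proof (intro borel_measurable_add borel_measurable_sum borel_measurable_times mono[OF \<phi>(1)])
    fix i assume "i \<in> E"
    then show "f i \<in> borel_measurable (Sg J)" "Z i \<in> borel_measurable (Sg J)"
      by (auto intro!: mono insert.prems Z_Sg) (simp add: J_def)
  qed
  have fe: "f e \<in> borel_measurable (Sg J)" "integrable M (\<lambda>\<omega>. (cmod (f e \<omega>))\<^sup>2)"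
    using insert by (auto intro: mono)
  note [measurable] = measurable_Sg_M[OF J(1) \<psi>] measurable_Sg_M[OF J(1) fe(1)] Z_measurable[of e]
  have eS: "e \<in> S" using J by simp
  have m1: "integrable M (\<lambda>\<omega>. cnj (Z e \<omega>))" "expectation (\<lambda>\<omega>. cnj (Z e \<omega>)) = 0"
    using Z_moments[OF eS, of 0 1] by auto
  have m2: "integrable M (\<lambda>\<omega>. of_real ((cmod (Z e \<omega>))\<^sup>2) :: complex)" "expectation (\<lambda>\<omega>. of_real ((cmod (Z e \<omega>))\<^sup>2) :: complex) = of_real (var e)"
    unfolding complex_norm_square using Z_moments[OF eS, of 1 1] by simp_all
  have c1: "integrable M (\<lambda>\<omega>. \<psi> \<omega> * cnj (f e \<omega>))"
    by (rule integrable_mult_L2) (use IH fe eS in auto)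
  have cm: "(\<lambda>\<omega>. \<psi> \<omega> * cnj (f e \<omega>)) \<in> borel_measurable (Sg J)"
    by (intro borel_measurable_times borel_measurable_cnj \<psi> fe)
  have zm: "(\<lambda>\<omega>. cnj (Z e \<omega>)) \<in> borel_measurable (Sg {e})" by (intro borel_measurable_cnj Z_Sg) simp
  have zm2: "(\<lambda>\<omega>. complex_of_real ((cmod (Z e \<omega>))\<^sup>2)) \<in> borel_measurable (Sg {e})"
    using Z_Sg[of e "{e}"] by measurable
  have fm2: "(\<lambda>\<omega>. complex_of_real ((cmod (f e \<omega>))\<^sup>2)) \<in> borel_measurable (Sg J)"
    using fe(1) by measurable
  note x = Sg_expectation_mult[OF J cm zm c1 m1(1)]
  note y = Sg_expectation_mult[OF J fm2 zm2 _ m2(1)]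
  have fi: "integrable M (\<lambda>\<omega>. complex_of_real ((cmod (f e \<omega>))\<^sup>2))" using fe(2) by (simp only: integrable_of_real)
  have expand: "complex_of_real ((cmod (u + w * z))\<^sup>2) = complex_of_real ((cmod u)\<^sup>2) +
      (u * cnj w * cnj z + cnj (u * cnj w * cnj z)) + complex_of_real ((cmod w)\<^sup>2) * complex_of_real ((cmod z)\<^sup>2)" for u w z :: complex
    unfolding complex_norm_square by (simp add: algebra_simps)
  have pi: "integrable M (\<lambda>\<omega>. complex_of_real ((cmod (\<psi> \<omega>))\<^sup>2))" using IH(1) by (simp only: integrable_of_real)
  have "integrable M (\<lambda>\<omega>. complex_of_real ((cmod (\<psi> \<omega> + f e \<omega> * Z e \<omega>))\<^sup>2))"
    unfolding expand by (intro Bochner_Integration.integrable_add pi x(1) y(1)[OF fi] integrable_cnj)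
  then have i: "integrable M (\<lambda>\<omega>. (cmod (\<psi> \<omega> + f e \<omega> * Z e \<omega>))\<^sup>2)"
    by (simp only: complex_of_real_integrable_eq)
  have "complex_of_real (expectation (\<lambda>\<omega>. (cmod (\<psi> \<omega> + f e \<omega> * Z e \<omega>))\<^sup>2)) =
      expectation (\<lambda>\<omega>. complex_of_real ((cmod (\<psi> \<omega> + f e \<omega> * Z e \<omega>))\<^sup>2))"
    by (simp only: integral_complex_of_real)
  also have "\<dots> = expectation (\<lambda>\<omega>. complex_of_real ((cmod (\<psi> \<omega>))\<^sup>2)) +
      (expectation (\<lambda>\<omega>. \<psi> \<omega> * cnj (f e \<omega>) * cnj (Z e \<omega>)) + expectation (\<lambda>\<omega>. cnj (\<psi> \<omega> * cnj (f e \<omega>) * cnj (Z e \<omega>)))) +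
      expectation (\<lambda>\<omega>. complex_of_real ((cmod (f e \<omega>))\<^sup>2) * complex_of_real ((cmod (Z e \<omega>))\<^sup>2))"
    unfolding expand using x(1) y(1)[OF fi] pi integrable_cnj[OF x(1)]
    by (simp only: Bochner_Integration.integral_add Bochner_Integration.integrable_add)
  also have "\<dots> = complex_of_real (expectation (\<lambda>\<omega>. (cmod (\<psi> \<omega>))\<^sup>2) + var e * expectation (\<lambda>\<omega>. (cmod (f e \<omega>))\<^sup>2))"
  proof -
    have "expectation (\<lambda>\<omega>. cnj (\<psi> \<omega> * cnj (f e \<omega>) * cnj (Z e \<omega>))) = 0"
      using Bochner_Integration.integral_cnj[of M "\<lambda>\<omega>. \<psi> \<omega> * cnj (f e \<omega>) * cnj (Z e \<omega>)"] x(2) m1(2) by simp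
    then show ?thesis
      unfolding x(2) y(2)[OF fi] m1(2) m2(2)
      unfolding integral_complex_of_real by simp
  qed
  finally have ex: "expectation (\<lambda>\<omega>. (cmod (\<psi> \<omega> + f e \<omega> * Z e \<omega>))\<^sup>2) =
      expectation (\<lambda>\<omega>. (cmod (\<psi> \<omega>))\<^sup>2) + var e * expectation (\<lambda>\<omega>. (cmod (f e \<omega>))\<^sup>2)"
    by (simp only: of_real_eq_iff)
  have eq: "\<phi> \<omega> + (\<Sum>e\<in>insert e E. f e \<omega> * Z e \<omega>) = \<psi> \<omega> + f e \<omega> * Z e \<omega>" for \<omega>
    using insert by (simp add: \<psi>_def)
  show ?case unfolding eq using i ex IH(2) insert by simp
qed

lemma integral_sum2:
  fixes F :: "nat \<Rightarrow> nat \<Rightarrow> 'w \<Rightarrow> complex"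
  assumes "\<And>a b. a < N \<Longrightarrow> b < N' \<Longrightarrow> integrable M (F a b)"
  shows "expectation (\<lambda>\<omega>. \<Sum>a<N. \<Sum>b<N'. F a b \<omega>) = (\<Sum>a<N. \<Sum>b<N'. expectation (F a b))"
proof -
  have "expectation (\<lambda>\<omega>. \<Sum>a<N. \<Sum>b<N'. F a b \<omega>) = (\<Sum>a<N. expectation (\<lambda>\<omega>. \<Sum>b<N'. F a b \<omega>))"
    using assms by (intro Bochner_Integration.integral_sum Bochner_Integration.integrable_sum) auto
  also have "\<dots> = (\<Sum>a<N. \<Sum>b<N'. expectation (F a b))"
    using assms by (intro sum.cong refl Bochner_Integration.integral_sum) auto
  finally show ?thesis .
qed

text \<open>The Isserlis formula for circular variables: only pairings of a conjugated with a plain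
  factor count. Coinciding labels are merged into powers, with \<open>p\<close> and \<open>q\<close>
  counting plain and conjugated occurrences; independence leaves a product that vanishes unless both
  counts agree at each label. If all four labels coincide, both pairings contribute, in accordance
  with the fourth moment \<open>2 * v\<^sup>2\<close>.\<close>

lemma moment4:
  assumes S: "\<alpha> \<in> S" "\<beta> \<in> S" "\<gamma> \<in> S" "\<delta> \<in> S"
    and v: "var \<alpha> = v" "var \<beta> = v" "var \<gamma> = v" "var \<delta> = v"
  shows "integrable M (\<lambda>\<omega>. cnj (Z \<alpha> \<omega>) * Z \<beta> \<omega> * (Z \<gamma> \<omega> * cnj (Z \<delta> \<omega>)))"
    and "expectation (\<lambda>\<omega>. cnj (Z \<alpha> \<omega>) * Z \<beta> \<omega> * (Z \<gamma> \<omega> * cnj (Z \<delta> \<omega>))) =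
      (of_real v)\<^sup>2 * (of_bool (\<alpha> = \<beta> \<and> \<gamma> = \<delta>) + of_bool (\<alpha> = \<gamma> \<and> \<beta> = \<delta>))"
proof -
  define L where "L = {\<alpha>, \<beta>, \<gamma>, \<delta>}"
  define p :: "'i \<Rightarrow> nat" where "p e = of_bool (e = \<beta>) + of_bool (e = \<gamma>)" for e
  define q :: "'i \<Rightarrow> nat" where "q e = of_bool (e = \<alpha>) + of_bool (e = \<delta>)" for e
  have L: "finite L" "L \<subseteq> S" using S by (auto simp: L_def)
  have pq: "p e \<le> 2" "q e \<le> 2" for e by (auto simp: p_def q_def)
  have prodp: "(\<Prod>e\<in>L. G e ^ of_bool (e = \<kappa>)) = G \<kappa>" if "\<kappa> \<in> L" for G :: "'i \<Rightarrow> complex" and \<kappa>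
  proof -
    have "(\<Prod>e\<in>L. G e ^ of_bool (e = \<kappa>)) = (\<Prod>e\<in>L. if e = \<kappa> then G e else 1)" by (intro prod.cong) auto
    then show ?thesis using that L by simp
  qed
  define X where "X e \<omega> = Z e \<omega> ^ p e * cnj (Z e \<omega>) ^ q e" for e \<omega>
  have eq: "cnj (Z \<alpha> \<omega>) * Z \<beta> \<omega> * (Z \<gamma> \<omega> * cnj (Z \<delta> \<omega>)) = (\<Prod>e\<in>L. X e \<omega>)" for \<omega>
    unfolding X_def p_def q_def power_add prod.distrib
    using prodp[of _ "\<lambda>e. Z e \<omega>"] prodp[of _ "\<lambda>e. cnj (Z e \<omega>)"] by (simp add: L_def)
  have "indep_vars (\<lambda>_. borel) (\<lambda>e. (\<lambda>z. z ^ p e * cnj z ^ q e) \<circ> Z e) L"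
    by (rule indep_vars_compose[OF indep_vars_subset[OF indep_Z L(2)]]) measurable
  then have ind: "indep_vars (\<lambda>_. borel) X L" by (simp add: comp_def X_def[abs_def])
  have int: "integrable M (X e)" if "e \<in> L" for e
    using Z_moments(1)[of e "p e" "q e"] that L pq by (auto simp: X_def[abs_def])
  show "integrable M (\<lambda>\<omega>. cnj (Z \<alpha> \<omega>) * Z \<beta> \<omega> * (Z \<gamma> \<omega> * cnj (Z \<delta> \<omega>)))"
    unfolding eq by (rule indep_vars_integrable[OF L(1) ind int])
  have var: "var e = v" if "e \<in> L" for e using that v by (auto simp: L_def)
  have EX: "expectation (X e) = (if p e = q e then of_real (fact (p e) * v ^ p e) else 0)" if "e \<in> L" for e
    using Z_moments(2)[of e "p e" "q e"] that L pq var by (auto simp: X_def[abs_def])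
  have E: "expectation (\<lambda>\<omega>. cnj (Z \<alpha> \<omega>) * Z \<beta> \<omega> * (Z \<gamma> \<omega> * cnj (Z \<delta> \<omega>))) = (\<Prod>e\<in>L. expectation (X e))"
    unfolding eq by (rule indep_vars_lebesgue_integral[OF L(1) ind int])
  consider "\<beta> = \<gamma>" "\<alpha> = \<beta>" "\<delta> = \<beta>" | "\<beta> \<noteq> \<gamma>" "\<alpha> = \<beta>" "\<delta> = \<gamma>" | "\<beta> \<noteq> \<gamma>" "\<alpha> = \<gamma>" "\<delta> = \<beta>"
    | "p \<beta> \<noteq> q \<beta> \<or> p \<gamma> \<noteq> q \<gamma>" "\<not> (\<alpha> = \<beta> \<and> \<gamma> = \<delta>)" "\<not> (\<alpha> = \<gamma> \<and> \<beta> = \<delta>)"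
    by (cases "\<beta> = \<gamma>"; cases "\<alpha> = \<beta>"; cases "\<delta> = \<beta>"; cases "\<alpha> = \<gamma>"; cases "\<delta> = \<gamma>") (auto simp: p_def q_def)
  then show "expectation (\<lambda>\<omega>. cnj (Z \<alpha> \<omega>) * Z \<beta> \<omega> * (Z \<gamma> \<omega> * cnj (Z \<delta> \<omega>))) =
      (of_real v)\<^sup>2 * (of_bool (\<alpha> = \<beta> \<and> \<gamma> = \<delta>) + of_bool (\<alpha> = \<gamma> \<and> \<beta> = \<delta>))"
  proof cases
    case 1
    then show ?thesis unfolding E using EX by (simp add: L_def p_def q_def power2_eq_square)
  next
    case 2
    then show ?thesis unfolding E using EX by (simp add: L_def p_def q_def power2_eq_square)
  next
    case 3
    then show ?thesis unfolding E using EX by (simp add: L_def p_def q_def power2_eq_square insert_commute)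
  next
    case 4
    then obtain e where "e \<in> L" "p e \<noteq> q e" by (auto simp: L_def)
    then have "(\<Prod>e\<in>L. expectation (X e)) = 0"
      using EX[of e] L by (auto intro!: prod_zero)
    then show ?thesis unfolding E by (simp only: 4(2,3) of_bool_def if_False) simp
  qed
qed

text \<open>Of the two pairings in \<open>moment4\<close>, one produces the squared trace and the
  other the squared Frobenius norm of \<open>P\<close>, which by the row condition is again the
  trace. The matrix is random but independent of the vector, so it enters through expectations of
  products of its entries, and the trace is almost surely the constant \<open>n\<close>.\<close>

lemma quadratic_form_moment2:
  fixes P :: "nat \<Rightarrow> nat \<Rightarrow> 'w \<Rightarrow> complex"
  assumes x: "inj_on x {..<N}" "\<And>a. a < N \<Longrightarrow> x a \<in> S" "\<And>a. a < N \<Longrightarrow> var (x a) = v"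
    and I: "I \<subseteq> S" "I \<inter> x ` {..<N} = {}"
    and P: "\<And>a b. a < N \<Longrightarrow> b < N \<Longrightarrow> P a b \<in> borel_measurable (Sg I)"
      "\<And>a b \<omega>. a < N \<Longrightarrow> b < N \<Longrightarrow> \<omega> \<in> space M \<Longrightarrow> cmod (P a b \<omega>) \<le> 1"
      "\<And>a \<omega>. a < N \<Longrightarrow> \<omega> \<in> space M \<Longrightarrow> complex_of_real (\<Sum>c<N. (cmod (P a c \<omega>))\<^sup>2) = P a a \<omega>"
      "AE \<omega> in M. (\<Sum>a<N. P a a \<omega>) = of_nat n"
  shows "expectation (\<lambda>\<omega>. (cmod (\<Sum>a<N. \<Sum>b<N. cnj (Z (x a) \<omega>) * P a b \<omega> * Z (x b) \<omega>))\<^sup>2) = v\<^sup>2 * ((real n)\<^sup>2 + real n)"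
    and "integrable M (\<lambda>\<omega>. \<Sum>a<N. \<Sum>b<N. cnj (Z (x a) \<omega>) * P a b \<omega> * Z (x b) \<omega>)"
    and "expectation (\<lambda>\<omega>. \<Sum>a<N. \<Sum>b<N. cnj (Z (x a) \<omega>) * P a b \<omega> * Z (x b) \<omega>) = of_real (v * real n)"
proof -
  define X where "X = x ` {..<N}"
  have J: "I \<subseteq> S" "X \<subseteq> S" "I \<inter> X = {}" using I x by (auto simp: X_def)
  have Pm: "P a b \<in> borel_measurable M" if "a < N" "b < N" for a b
    by (rule measurable_Sg_M[OF I(1) P(1)[OF that]])
  have xm: "Z (x a) \<in> borel_measurable (Sg X)" if "a < N" for a
    using that by (intro Z_Sg) (auto simp: X_def)
  have xeq: "x a = x b \<longleftrightarrow> a = b" if "a < N" "b < N" for a b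
    using that x(1) by (auto simp: inj_on_def)
  have bint: "integrable M f" if "f \<in> borel_measurable M" "\<And>\<omega>. \<omega> \<in> space M \<Longrightarrow> cmod (f \<omega>) \<le> 1" for f :: "'w \<Rightarrow> complex"
    using that by (intro integrable_const_bound[where B=1]) auto
  have two: "integrable M (\<lambda>\<omega>. P a b \<omega> * (cnj (Z (x a) \<omega>) * Z (x b) \<omega>))"
    "expectation (\<lambda>\<omega>. P a b \<omega> * (cnj (Z (x a) \<omega>) * Z (x b) \<omega>)) = expectation (P a b) * (of_real v * of_bool (a = b))"
    if ab: "a < N" "b < N" for a b
  proof -
    have pi: "integrable M (P a b)" by (rule bint[OF Pm[OF ab] P(2)[OF ab]])
    have m: "(\<lambda>\<omega>. cnj (Z (x a) \<omega>) * Z (x b) \<omega>) \<in> borel_measurable (Sg X)"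
      by (intro borel_measurable_times borel_measurable_cnj xm ab)
    have zi: "integrable M (\<lambda>\<omega>. cnj (Z (x a) \<omega>) * Z (x b) \<omega>)"
      by (rule integrable_mult_L2) (use Z_measurable x(2) ab Z_power_integrable in auto)
    have "expectation (\<lambda>\<omega>. cnj (Z (x a) \<omega>) * Z (x b) \<omega>) = of_real v * of_bool (a = b)"
    proof (cases "a = b")
      case True
      then show ?thesis using Z_moments(2)[of "x a" 1 1] x ab by (simp add: mult.commute)
    next
      case False
      have "{x a} \<subseteq> S" "{x b} \<subseteq> S" "{x a} \<inter> {x b} = {}" using x ab False xeq by auto
      from Sg_expectation_mult(2)[OF this, of "\<lambda>\<omega>. cnj (Z (x a) \<omega>)" "Z (x b)"]
        Z_moments[of "x a" 0 1] Z_moments[of "x b" 1 0] x ab False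
      show ?thesis by (simp add: Z_Sg borel_measurable_cnj)
    qed
    with Sg_expectation_mult[OF J P(1)[OF ab] m pi zi]
    show "integrable M (\<lambda>\<omega>. P a b \<omega> * (cnj (Z (x a) \<omega>) * Z (x b) \<omega>))"
      "expectation (\<lambda>\<omega>. P a b \<omega> * (cnj (Z (x a) \<omega>) * Z (x b) \<omega>)) = expectation (P a b) * (of_real v * of_bool (a = b))"
      by auto
  qed
  have q_eq: "(\<Sum>a<N. \<Sum>b<N. cnj (Z (x a) \<omega>) * P a b \<omega> * Z (x b) \<omega>) =
      (\<Sum>a<N. \<Sum>b<N. P a b \<omega> * (cnj (Z (x a) \<omega>) * Z (x b) \<omega>))" for \<omega>
    by (intro sum.cong) (auto simp: mult_ac)
  show "integrable M (\<lambda>\<omega>. \<Sum>a<N. \<Sum>b<N. cnj (Z (x a) \<omega>) * P a b \<omega> * Z (x b) \<omega>)"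
    unfolding q_eq by (intro Bochner_Integration.integrable_sum two) auto
  have trace: "(\<Sum>a<N. expectation (P a a)) = of_nat n"
  proof -
    have "(\<Sum>a<N. expectation (P a a)) = expectation (\<lambda>\<omega>. \<Sum>a<N. P a a \<omega>)"
      using bint[OF Pm P(2)] by (subst Bochner_Integration.integral_sum) auto
    also have "\<dots> = expectation (\<lambda>_. of_nat n)"
      using P(4) Pm by (intro integral_cong_AE) auto
    finally show ?thesis by (simp add: prob_space)
  qed
  have "expectation (\<lambda>\<omega>. \<Sum>a<N. \<Sum>b<N. P a b \<omega> * (cnj (Z (x a) \<omega>) * Z (x b) \<omega>)) =
      (\<Sum>a<N. \<Sum>b<N. expectation (P a b) * (of_real v * of_bool (a = b)))"
    by (subst integral_sum2) (auto intro!: sum.cong simp: two)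
  also have "\<dots> = (\<Sum>a<N. \<Sum>b<N. if a = b then of_real v * expectation (P a a) else 0)"
    by (intro sum.cong) auto
  also have "\<dots> = (\<Sum>a<N. of_real v * expectation (P a a))" by simp
  also have "\<dots> = of_real (v * real n)" by (simp add: sum_distrib_left[symmetric] trace)
  finally show "expectation (\<lambda>\<omega>. \<Sum>a<N. \<Sum>b<N. cnj (Z (x a) \<omega>) * P a b \<omega> * Z (x b) \<omega>) = of_real (v * real n)"
    unfolding q_eq .
  define R where "R a b c d \<omega> = P a b \<omega> * cnj (P c d \<omega>)" for a b c d \<omega>
  define Y where "Y a b c d \<omega> = cnj (Z (x a) \<omega>) * Z (x b) \<omega> * (Z (x c) \<omega> * cnj (Z (x d) \<omega>))" for a b c d \<omega>
  have R: "R a b c d \<in> borel_measurable (Sg I)" "integrable M (R a b c d)" if "a < N" "b < N" "c < N" "d < N" for a b c d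
  proof -
    show m: "R a b c d \<in> borel_measurable (Sg I)"
      unfolding R_def by (intro borel_measurable_times borel_measurable_cnj P(1) that)
    show "integrable M (R a b c d)"
      using P(2) that by (intro bint[OF measurable_Sg_M[OF I(1) m]]) (auto simp: R_def norm_mult intro: mult_le_one)
  qed
  have Y: "Y a b c d \<in> borel_measurable (Sg X)" "integrable M (Y a b c d)"
    "expectation (Y a b c d) = (of_real v)\<^sup>2 * (of_bool (a = b \<and> c = d) + of_bool (a = c \<and> b = d))"
    if "a < N" "b < N" "c < N" "d < N" for a b c d
  proof -
    show "Y a b c d \<in> borel_measurable (Sg X)"
      unfolding Y_def by (intro borel_measurable_times borel_measurable_cnj xm that)
    show "integrable M (Y a b c d)"
      unfolding Y_def by (rule moment4) (use that x in auto)
    show "expectation (Y a b c d) = (of_real v)\<^sup>2 * (of_bool (a = b \<and> c = d) + of_bool (a = c \<and> b = d))"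
      unfolding Y_def using moment4(2)[of "x a" "x b" "x c" "x d" v] that x xeq by simp
  qed
  have RY: "integrable M (\<lambda>\<omega>. R a b c d \<omega> * Y a b c d \<omega>)"
    "expectation (\<lambda>\<omega>. R a b c d \<omega> * Y a b c d \<omega>) = expectation (R a b c d) * ((of_real v)\<^sup>2 * (of_bool (a = b \<and> c = d) + of_bool (a = c \<and> b = d)))"
    if "a < N" "b < N" "c < N" "d < N" for a b c d
    using Sg_expectation_mult[OF J R(1)[OF that] Y(1)[OF that] R(2)[OF that] Y(2)[OF that]] Y(3)[OF that] by auto
  have sq: "complex_of_real ((cmod (\<Sum>a<N. \<Sum>b<N. cnj (Z (x a) \<omega>) * P a b \<omega> * Z (x b) \<omega>))\<^sup>2) =
      (\<Sum>a<N. \<Sum>b<N. \<Sum>c<N. \<Sum>d<N. R a b c d \<omega> * Y a b c d \<omega>)" for \<omega>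
  proof -
    define u where "u a b = cnj (Z (x a) \<omega>) * P a b \<omega> * Z (x b) \<omega>" for a b
    have "complex_of_real ((cmod (\<Sum>a<N. \<Sum>b<N. u a b))\<^sup>2) = (\<Sum>a<N. \<Sum>b<N. u a b) * (\<Sum>c<N. \<Sum>d<N. cnj (u c d))"
      unfolding complex_norm_square by simp
    also have "\<dots> = (\<Sum>a<N. \<Sum>b<N. \<Sum>c<N. \<Sum>d<N. u a b * cnj (u c d))"
    proof -
      have "(\<Sum>a<N. \<Sum>b<N. u a b) * W = (\<Sum>a<N. \<Sum>b<N. u a b * W)" for W
        by (simp only: sum_distrib_right)
      note this[of "\<Sum>c<N. \<Sum>d<N. cnj (u c d)"]
      then show ?thesis by (simp only: sum_distrib_left[of "u _ _"])
    qed
    also have "\<dots> = (\<Sum>a<N. \<Sum>b<N. \<Sum>c<N. \<Sum>d<N. R a b c d \<omega> * Y a b c d \<omega>)"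
      by (intro sum.cong refl) (simp add: u_def R_def Y_def mult_ac)
    finally show ?thesis by (simp only: u_def)
  qed
  have Eswap: "expectation (\<lambda>\<omega>. \<Sum>a<N. \<Sum>b<N. \<Sum>c<N. \<Sum>d<N. R a b c d \<omega> * Y a b c d \<omega>) =
     (\<Sum>a<N. \<Sum>b<N. \<Sum>c<N. \<Sum>d<N. expectation (\<lambda>\<omega>. R a b c d \<omega> * Y a b c d \<omega>))"
  proof -
    have "integrable M (\<lambda>\<omega>. \<Sum>c<N. \<Sum>d<N. R a b c d \<omega> * Y a b c d \<omega>)"
      "expectation (\<lambda>\<omega>. \<Sum>c<N. \<Sum>d<N. R a b c d \<omega> * Y a b c d \<omega>) =
        (\<Sum>c<N. \<Sum>d<N. expectation (\<lambda>\<omega>. R a b c d \<omega> * Y a b c d \<omega>))" if "a < N" "b < N" for a b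
      using RY(1) that by (auto intro!: Bochner_Integration.integrable_sum integral_sum2)
    then show ?thesis by (subst integral_sum2) auto
  qed
  have "complex_of_real (expectation (\<lambda>\<omega>. (cmod (\<Sum>a<N. \<Sum>b<N. cnj (Z (x a) \<omega>) * P a b \<omega> * Z (x b) \<omega>))\<^sup>2)) =
     (\<Sum>a<N. \<Sum>b<N. \<Sum>c<N. \<Sum>d<N. expectation (\<lambda>\<omega>. R a b c d \<omega> * Y a b c d \<omega>))"
    unfolding integral_complex_of_real[symmetric] sq by (rule Eswap)
  also have "\<dots> = (\<Sum>a<N. \<Sum>b<N. \<Sum>c<N. \<Sum>d<N. (of_real v)\<^sup>2 * ((if a = b then if c = d then expectation (R a a c c) else 0 else 0)
       + (if c = a then if d = b then expectation (R a b a b) else 0 else 0)))"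
    using RY by (intro sum.cong refl) auto
  also have "\<dots> = (of_real v)\<^sup>2 * ((\<Sum>a<N. \<Sum>c<N. expectation (R a a c c)) + (\<Sum>a<N. \<Sum>b<N. expectation (R a b a b)))"
  proof -
    have k1: "(\<Sum>a<N. \<Sum>b<N. \<Sum>c<N. \<Sum>d<N. if a = b then if c = d then F a c else 0 else 0) = (\<Sum>a<N. \<Sum>c<N. F a c)" for F :: "nat \<Rightarrow> nat \<Rightarrow> complex"
    proof (rule sum.cong[OF refl])
      fix a assume "a \<in> {..<N}"
      have "(\<Sum>b<N. \<Sum>c<N. \<Sum>d<N. if a = b then if c = d then F a c else 0 else 0) = (\<Sum>b<N. if a = b then \<Sum>c<N. F a c else 0)"
        by (intro sum.cong refl) auto
      then show "(\<Sum>b<N. \<Sum>c<N. \<Sum>d<N. if a = b then if c = d then F a c else 0 else 0) = (\<Sum>c<N. F a c)"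
        using \<open>a \<in> {..<N}\<close> by simp
    qed
    have k2: "(\<Sum>a<N. \<Sum>b<N. \<Sum>c<N. \<Sum>d<N. if c = a then if d = b then F a b else 0 else 0) = (\<Sum>a<N. \<Sum>b<N. F a b)" for F :: "nat \<Rightarrow> nat \<Rightarrow> complex"
    proof (rule sum.cong[OF refl], rule sum.cong[OF refl])
      fix a b assume ab: "a \<in> {..<N}" "b \<in> {..<N}"
      have "(\<Sum>c<N. \<Sum>d<N. if c = a then if d = b then F a b else 0 else 0) = (\<Sum>c<N. if c = a then F a b else 0)"
        using ab by (intro sum.cong refl) auto
      then show "(\<Sum>c<N. \<Sum>d<N. if c = a then if d = b then F a b else 0 else 0) = F a b"
        using ab by simp
    qed
    show ?thesis
      by (simp only: sum_distrib_left[symmetric] sum.distrib k1 k2)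
  qed
  also have "(\<Sum>a<N. \<Sum>c<N. expectation (R a a c c)) = of_nat n * of_nat n"
  proof -
    have "(\<Sum>a<N. \<Sum>c<N. expectation (R a a c c)) = expectation (\<lambda>\<omega>. \<Sum>a<N. \<Sum>c<N. R a a c c \<omega>)"
      using R by (intro integral_sum2[symmetric]) auto
    also have "\<dots> = expectation (\<lambda>_. of_nat n * of_nat n)"
    proof (rule integral_cong_AE)
      show "AE \<omega> in M. (\<Sum>a<N. \<Sum>c<N. R a a c c \<omega>) = of_nat n * of_nat n"
        using P(4)
      proof eventually_elim
        case (elim \<omega>)
        have "(\<Sum>a<N. \<Sum>c<N. R a a c c \<omega>) = (\<Sum>a<N. P a a \<omega>) * cnj (\<Sum>c<N. P c c \<omega>)"
          by (simp add: R_def sum_product)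
        then show ?case by (simp only: elim) simp
      qed
      show "(\<lambda>\<omega>. \<Sum>a<N. \<Sum>c<N. R a a c c \<omega>) \<in> borel_measurable M"
        using R by (intro borel_measurable_sum borel_measurable_integrable) auto
    qed simp
    finally show ?thesis by (simp add: prob_space)
  qed
  also have "(\<Sum>a<N. \<Sum>b<N. expectation (R a b a b)) = of_nat n"
  proof -
    have "(\<Sum>a<N. \<Sum>b<N. expectation (R a b a b)) = (\<Sum>a<N. expectation (\<lambda>\<omega>. \<Sum>b<N. R a b a b \<omega>))"
      using R by (intro sum.cong refl Bochner_Integration.integral_sum[symmetric]) auto
    also have "\<dots> = (\<Sum>a<N. expectation (P a a))"
    proof (intro sum.cong refl Bochner_Integration.integral_cong)
      fix a \<omega> assume "a \<in> {..<N}" "\<omega> \<in> space M"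
      then have "P a a \<omega> = complex_of_real (\<Sum>c<N. (cmod (P a c \<omega>))\<^sup>2)" using P(3) by simp
      then show "(\<Sum>b<N. R a b a b \<omega>) = P a a \<omega>"
        by (simp only: R_def of_real_sum complex_norm_square)
    qed
    finally show ?thesis by (simp only: trace)
  qed
  also have "(of_real v)\<^sup>2 * (of_nat n * of_nat n + of_nat n) = complex_of_real (v\<^sup>2 * ((real n)\<^sup>2 + real n))"
    by (simp add: power2_eq_square)
  finally show "expectation (\<lambda>\<omega>. (cmod (\<Sum>a<N. \<Sum>b<N. cnj (Z (x a) \<omega>) * P a b \<omega> * Z (x b) \<omega>))\<^sup>2) = v\<^sup>2 * ((real n)\<^sup>2 + real n)"
    by (simp only: of_real_eq_iff)
qed

end

section \<open>The multicast system\<close>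

text \<open>Labels with the same key form a group; different groups are independent, and each
  \<open>Z x\<close> depends on its own group. A group has at most the two members
  \<open>key x\<close> and \<open>partner (key x)\<close>, so independence inside it is independence
  of one pair. The purpose is to exchange channel entry and pilot noise for error and estimate
  without losing joint independence.\<close>

lemma (in prob_space) indep_vars_ungroup:
  fixes X :: "'i \<Rightarrow> 'a \<Rightarrow> 'b" and Z :: "'i \<Rightarrow> 'a \<Rightarrow> 'c"
  assumes X: "indep_vars (\<lambda>_. N) X S"
    and f: "\<And>x. x \<in> S \<Longrightarrow> f x \<in> PiM {y\<in>S. key y = key x} (\<lambda>_. N) \<rightarrow>\<^sub>M N'"
    and Z: "\<And>x \<omega>. x \<in> S \<Longrightarrow> \<omega> \<in> space M \<Longrightarrow> Z x \<omega> = f x (\<lambda>y\<in>{y\<in>S. key y = key x}. X y \<omega>)"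
    and Zm: "\<And>x. x \<in> S \<Longrightarrow> Z x \<in> M \<rightarrow>\<^sub>M N'"
    and group: "\<And>x. x \<in> S \<Longrightarrow> x = key x \<or> x = partner (key x)"
    and pair: "\<And>\<kappa>. \<kappa> \<in> S \<Longrightarrow> partner \<kappa> \<in> S \<Longrightarrow> \<kappa> \<noteq> partner \<kappa> \<Longrightarrow> indep_var N' (Z \<kappa>) N' (Z (partner \<kappa>))"
  shows "indep_vars (\<lambda>_. N') Z S"
  unfolding indep_vars_def2
proof (intro conjI ballI)
  show "Z x \<in> M \<rightarrow>\<^sub>M N'" if "x \<in> S" for x using Zm that .
  define grp where "grp \<kappa> = {y\<in>S. key y = \<kappa>}" for \<kappa>
  define Y where "Y \<kappa> \<omega> = (\<lambda>y\<in>grp \<kappa>. X y \<omega>)" for \<kappa> \<omega>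
  have indY: "indep_vars (\<lambda>\<kappa>. PiM (grp \<kappa>) (\<lambda>_. N)) Y (key ` S)"
    unfolding Y_def by (rule indep_vars_restrict[OF X]) (auto simp: grp_def disjoint_family_on_def)
  show "indep_sets (\<lambda>x. {Z x -` A \<inter> space M | A. A \<in> sets N'}) S"
  proof (rule indep_setsI)
    show "{Z x -` A \<inter> space M | A. A \<in> sets N'} \<subseteq> events" if "x \<in> S" for x
      using measurable_sets[OF Zm[OF that]] by auto
    fix A J assume J: "J \<noteq> {}" "J \<subseteq> S" "finite J" and "\<forall>j\<in>J. A j \<in> {Z j -` A \<inter> space M | A. A \<in> sets N'}"
    then have "\<forall>j\<in>J. \<exists>B. B \<in> sets N' \<and> A j = Z j -` B \<inter> space M" by auto
    then obtain B where B: "\<And>j. j \<in> J \<Longrightarrow> B j \<in> sets N'" "\<And>j. j \<in> J \<Longrightarrow> A j = Z j -` B j \<inter> space M"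
      by metis
    define J' where "J' \<kappa> = {j\<in>J. key j = \<kappa>}" for \<kappa>
    have J'fin: "finite (J' \<kappa>)" for \<kappa> using J by (simp add: J'_def)
    \<comment> \<open>The conditions on all selected members of a group, written as one event for
      the vector of original variables of that group; to such events the independence of the groups
      applies.\<close>
    define C where "C \<kappa> = {y\<in>space (PiM (grp \<kappa>) (\<lambda>_. N)). \<forall>j\<in>J' \<kappa>. f j y \<in> B j}" for \<kappa>
    have Cm: "C \<kappa> \<in> sets (PiM (grp \<kappa>) (\<lambda>_. N))" for \<kappa>
    proof -
      have "f j \<in> PiM (grp \<kappa>) (\<lambda>_. N) \<rightarrow>\<^sub>M N'" if "j \<in> J' \<kappa>" for j
        using f[of j] that J by (auto simp: J'_def grp_def)
      moreover have "B j \<in> sets N'" if "j \<in> J' \<kappa>" for j using B that by (auto simp: J'_def)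
      ultimately have "{y\<in>space (PiM (grp \<kappa>) (\<lambda>_. N)). f j y \<in> B j} \<in> sets (PiM (grp \<kappa>) (\<lambda>_. N))" if "j \<in> J' \<kappa>" for j
        using that by (auto intro!: measurable_sets_Collect)
      then show ?thesis
        unfolding C_def using J'fin[of \<kappa>] by (intro sets.sets_Collect_finite_All) auto
    qed
    have YC: "Y \<kappa> -` C \<kappa> \<inter> space M = (if J' \<kappa> = {} then space M else (\<Inter>j\<in>J' \<kappa>. A j))" if "\<kappa> \<in> key ` J" for \<kappa>
    proof -
      have "Y \<kappa> \<omega> \<in> space (PiM (grp \<kappa>) (\<lambda>_. N))" if "\<omega> \<in> space M" for \<omega>
        using that measurable_space[of "X _" M N] X unfolding Y_def indep_vars_def
        by (auto simp: space_PiM grp_def)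
      moreover have "f j (Y \<kappa> \<omega>) = Z j \<omega>" if "j \<in> J' \<kappa>" "\<omega> \<in> space M" for j \<omega>
        using Z[of j \<omega>] that J by (auto simp: J'_def Y_def grp_def)
      ultimately show ?thesis
        using B(2) by (auto simp: C_def J'_def)
    qed
    have ne: "J' \<kappa> \<noteq> {}" if "\<kappa> \<in> key ` J" for \<kappa> using that by (auto simp: J'_def)
    have within: "prob (\<Inter>j\<in>J' \<kappa>. A j) = (\<Prod>j\<in>J' \<kappa>. prob (A j))" if "\<kappa> \<in> key ` J" for \<kappa>
    proof -
      have sub: "J' \<kappa> \<subseteq> {\<kappa>, partner \<kappa>}" using group J by (auto simp: J'_def)
      show ?thesis
      proof (cases "\<kappa> \<in> J' \<kappa> \<and> partner \<kappa> \<in> J' \<kappa> \<and> \<kappa> \<noteq> partner \<kappa>")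
        case True
        then have eq: "J' \<kappa> = {\<kappa>, partner \<kappa>}" using sub by auto
        have inJ: "\<kappa> \<in> J" "partner \<kappa> \<in> J" using True by (auto simp: J'_def)
        have "indep_var N' (Z \<kappa>) N' (Z (partner \<kappa>))" using pair True inJ J by auto
        from indep_varD[OF this B(1)[OF inJ(1)] B(1)[OF inJ(2)]]
        have "prob (A \<kappa> \<inter> A (partner \<kappa>)) = prob (A \<kappa>) * prob (A (partner \<kappa>))"
          unfolding B(2)[OF inJ(1)] B(2)[OF inJ(2)] by (simp add: Int_def vimage_def conj_ac)
        then show ?thesis using True by (simp add: eq)
      next
        case False
        with sub ne[OF that] obtain j where "J' \<kappa> = {j}" by blast
        then show ?thesis by simp
      qed
    qed
    have "(\<Inter>j\<in>J. A j) = (\<Inter>\<kappa>\<in>key ` J. Y \<kappa> -` C \<kappa> \<inter> space M)"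
    proof -
      have "(\<Inter>\<kappa>\<in>key ` J. Y \<kappa> -` C \<kappa> \<inter> space M) = (\<Inter>\<kappa>\<in>key ` J. \<Inter>j\<in>J' \<kappa>. A j)"
        using YC ne by (intro INF_cong refl) auto
      then show ?thesis by (auto simp: J'_def)
    qed
    also have "prob \<dots> = (\<Prod>\<kappa>\<in>key ` J. prob (Y \<kappa> -` C \<kappa> \<inter> space M))"
      using J Cm by (intro indep_varsD[OF indY]) auto
    also have "\<dots> = (\<Prod>\<kappa>\<in>key ` J. \<Prod>j\<in>J' \<kappa>. prob (A j))"
      using YC ne within by (intro prod.cong) auto
    also have "\<dots> = (\<Prod>j\<in>J. prob (A j))"
      unfolding J'_def using J by (intro prod.group) auto
    finally show "prob (\<Inter>j\<in>J. A j) = (\<Prod>j\<in>J. prob (A j))" .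
  qed
qed

section \<open>Estimates and estimation errors as one independent Gaussian family\<close>

locale multicast_user = multicast_system M N G T \<tau> K \<beta> p_ul g n s z
  for M :: "'w measure" and N G T \<tau> K \<beta> p_ul g n s z +
  fixes p_dl \<mu> :: "nat \<Rightarrow> nat \<Rightarrow> real" and i k :: nat
  assumes antennas: "\<And>j. j \<in> {1..G} \<Longrightarrow> nu G K j < N"
    and powers: "\<And>j m. j \<in> {1..G} \<Longrightarrow> m \<in> {1..K j} \<Longrightarrow> 0 \<le> p_dl j m"
    and mu: "\<And>j m. j \<in> {1..G} \<Longrightarrow> m \<in> {1..K j} \<Longrightarrow>
      \<mu> j m = p_dl j m / (real (N - nu G K j) * estimate_var \<tau> (p_ul j m) (\<beta> j m))"
    and user: "i \<in> {1..G}" "k \<in> {1..K i}"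
begin

abbreviation "D \<equiv> {\<tau><..T}"
abbreviation "S \<equiv> sources N G K D"
definition X :: "source \<Rightarrow> 'w \<Rightarrow> complex" where "X = source_rv g n s (z i k)"
abbreviation "gam j m \<equiv> estimate_var \<tau> (p_ul j m) (\<beta> j m)"

definition est :: "nat \<Rightarrow> nat \<Rightarrow> nat \<Rightarrow> nat \<Rightarrow> 'w \<Rightarrow> complex" where
  "est b j m a \<omega> = complex_of_real (sqrt (real \<tau> * p_ul j m) * \<beta> j m / (1 + real \<tau> * p_ul j m * \<beta> j m)) *
     (complex_of_real (sqrt (real \<tau> * p_ul j m)) * X (Channel b j m a) \<omega> + X (Pilot_Noise b j m a) \<omega>)"

text \<open>The channel labels are reused for the estimation errors and the pilot noise labels for the estimates.\<close>

definition Z :: "source \<Rightarrow> 'w \<Rightarrow> complex" where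
  "Z x = (case x of Channel b j m a \<Rightarrow> (\<lambda>\<omega>. est b j m a \<omega> - X x \<omega>)
     | Pilot_Noise b j m a \<Rightarrow> est b j m a | _ \<Rightarrow> X x)"

definition vr :: "source \<Rightarrow> real" where
  "vr x = (case x of Channel b j m a \<Rightarrow> \<beta> j m - gam j m | Pilot_Noise b j m a \<Rightarrow> gam j m | _ \<Rightarrow> 1)"

lemma tau_pos: "0 < \<tau>"
proof -
  have "0 < K i" using user by simp
  also have "K i \<le> (\<Sum>j=1..G. K j)" using user by (intro member_le_sum) auto
  finally show ?thesis using pilots by simp
qed

lemma r_pos: "j \<in> {1..G} \<Longrightarrow> m \<in> {1..K j} \<Longrightarrow> 0 < sqrt (real \<tau> * p_ul j m)"
  using tau_pos p_ul_pos by simp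

lemma r_sq: "j \<in> {1..G} \<Longrightarrow> m \<in> {1..K j} \<Longrightarrow> (sqrt (real \<tau> * p_ul j m))\<^sup>2 = real \<tau> * p_ul j m"
  using tau_pos p_ul_pos[of j m] by simp

lemma in_sources[simp]:
  "Channel b j m a \<in> S \<longleftrightarrow> j \<in> {1..G} \<and> m \<in> {1..K j} \<and> a < N"
  "Pilot_Noise b j m a \<in> S \<longleftrightarrow> j \<in> {1..G} \<and> m \<in> {1..K j} \<and> a < N"
  "Data b t j \<in> S \<longleftrightarrow> t \<in> D \<and> j \<in> {1..G}"
  "Receiver_Noise b t \<in> S \<longleftrightarrow> t \<in> D"
  by (auto simp: sources_def)

lemma X_indep: "indep_vars (\<lambda>_. borel) X S"
  unfolding X_def by (rule indep[OF user])

lemma X_measurable: "x \<in> S \<Longrightarrow> X x \<in> borel_measurable M"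
  using X_indep by (auto simp: indep_vars_def)

lemma X_law: "x \<in> S \<Longrightarrow> distr M borel (X x) = CN (source_var \<beta> x)"
  using laws[OF user, of x] distributed_distr_eq_density[of M lborel "X x"]
  by (simp add: X_def CN_def cong: distr_cong)

lemma beta_minus_gam:
  assumes "j \<in> {1..G}" "m \<in> {1..K j}"
  shows "\<beta> j m - gam j m = \<beta> j m / (1 + real \<tau> * p_ul j m * \<beta> j m)"
    and "0 < gam j m" "0 < \<beta> j m - gam j m"
proof -
  have pos: "0 < real \<tau> * p_ul j m" "0 < \<beta> j m" using tau_pos p_ul_pos beta_pos assms by auto
  then have k: "0 < 1 + real \<tau> * p_ul j m * \<beta> j m" by (simp add: add_pos_pos)
  then show eq: "\<beta> j m - gam j m = \<beta> j m / (1 + real \<tau> * p_ul j m * \<beta> j m)"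
    by (simp add: estimate_var_def field_simps power2_eq_square)
  show "0 < \<beta> j m - gam j m" unfolding eq using pos k by simp
  show "0 < gam j m" unfolding estimate_var_def using pos k tau_pos p_ul_pos[OF assms] by simp
qed

lemma estimate_decomposition:
  assumes jm: "j \<in> {1..G}" "m \<in> {1..K j}" "a < N"
  shows "indep_var borel (Z (Channel b j m a)) borel (Z (Pilot_Noise b j m a))"
    "distr M borel (Z (Channel b j m a)) = CN (\<beta> j m - gam j m)"
    "distr M borel (Z (Pilot_Noise b j m a)) = CN (gam j m)"
proof -
  let ?r = "sqrt (real \<tau> * p_ul j m)"
  have S: "Channel b j m a \<in> S" "Pilot_Noise b j m a \<in> S" using jm by auto
  have "indep_var (PiM {Channel b j m a} (\<lambda>_. borel)) (\<lambda>\<omega>. \<lambda>x\<in>{Channel b j m a}. X x \<omega>)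
      (PiM {Pilot_Noise b j m a} (\<lambda>_. borel)) (\<lambda>\<omega>. \<lambda>x\<in>{Pilot_Noise b j m a}. X x \<omega>)"
    by (rule indep_var_restrict[OF X_indep]) (use S in auto)
  from indep_var_compose[OF this, of "\<lambda>x. x (Channel b j m a)" borel "\<lambda>x. x (Pilot_Noise b j m a)" borel]
  have ind: "indep_var borel (X (Channel b j m a)) borel (X (Pilot_Noise b j m a))"
    by (simp add: comp_def)
  note d = mmse_decomposition[OF r_pos[OF jm(1,2)] beta_pos[OF jm(1,2)] X_law[OF S(1), unfolded source_var.simps] X_law[OF S(2), unfolded source_var.simps] ind]
  have H: "Z (Pilot_Noise b j m a) = (\<lambda>\<omega>. complex_of_real (?r * \<beta> j m / (1 + ?r\<^sup>2 * \<beta> j m)) *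
     (complex_of_real ?r * X (Channel b j m a) \<omega> + X (Pilot_Noise b j m a) \<omega>))"
    unfolding Z_def est_def r_sq[OF jm(1,2)] by simp
  have C: "Z (Channel b j m a) = (\<lambda>\<omega>. Z (Pilot_Noise b j m a) \<omega> - X (Channel b j m a) \<omega>)"
    unfolding Z_def by simp
  have "indep_var borel (Z (Pilot_Noise b j m a)) borel (Z (Channel b j m a))"
    unfolding C unfolding H by (rule d(1))
  then have "indep_set (sigma_sets (space M) {Z (Pilot_Noise b j m a) -` A \<inter> space M | A. A \<in> sets borel})
      (sigma_sets (space M) {Z (Channel b j m a) -` A \<inter> space M | A. A \<in> sets borel})"
    and rv: "Z (Pilot_Noise b j m a) \<in> borel_measurable M" "Z (Channel b j m a) \<in> borel_measurable M"
    unfolding indep_var_eq by auto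
  then show "indep_var borel (Z (Channel b j m a)) borel (Z (Pilot_Noise b j m a))"
    unfolding indep_var_eq indep_sets2_eq by (metis (no_types, lifting) Int_commute mult.commute)
  have e: "(sqrt (real \<tau> * p_ul j m))\<^sup>2 * (\<beta> j m)\<^sup>2 / (1 + (sqrt (real \<tau> * p_ul j m))\<^sup>2 * \<beta> j m) = gam j m"
    "\<beta> j m / (1 + (sqrt (real \<tau> * p_ul j m))\<^sup>2 * \<beta> j m) = \<beta> j m - gam j m"
    unfolding r_sq[OF jm(1,2)] beta_minus_gam(1)[OF jm(1,2)] by (auto simp: estimate_var_def)
  show "distr M borel (Z (Pilot_Noise b j m a)) = CN (gam j m)"
    using d(2) unfolding H e .
  show "distr M borel (Z (Channel b j m a)) = CN (\<beta> j m - gam j m)"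
    using d(3) unfolding C H e .
qed

text \<open>The grouping for \<open>indep_vars_ungroup\<close>: a channel entry and its pilot noise
  share the channel label as representative, every other label stays alone.\<close>

definition key :: "source \<Rightarrow> source" where
  "key x = (case x of Pilot_Noise b j m a \<Rightarrow> Channel b j m a | _ \<Rightarrow> x)"

definition partner :: "source \<Rightarrow> source" where
  "partner x = (case x of Channel b j m a \<Rightarrow> Pilot_Noise b j m a | _ \<Rightarrow> x)"

lemma error_estimate_measurable: "x \<in> S \<Longrightarrow> Z x \<in> borel_measurable M"
proof (cases x)
  case (Channel b j m a)
  moreover assume "x \<in> S"
  ultimately show ?thesis using estimate_decomposition(1)[of j m a b] by (auto dest: indep_var_rv1)
next
  case (Pilot_Noise b j m a)
  moreover assume "x \<in> S"
  ultimately show ?thesis using estimate_decomposition(1)[of j m a b] by (auto dest: indep_var_rv2)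
qed (use X_measurable in \<open>auto simp: Z_def\<close>)

lemma indep_Z: "indep_vars (\<lambda>_. borel) Z S"
proof -
  define q where "q b j m a y = complex_of_real (sqrt (real \<tau> * p_ul j m) * \<beta> j m / (1 + real \<tau> * p_ul j m * \<beta> j m)) *
     (complex_of_real (sqrt (real \<tau> * p_ul j m)) * y (Channel b j m a) + y (Pilot_Noise b j m a))"
    for b j m a :: nat and y :: "source \<Rightarrow> complex"
  define f where "f x y = (case x of Channel b j m a \<Rightarrow> q b j m a y - y (Channel b j m a)
     | Pilot_Noise b j m a \<Rightarrow> q b j m a y | _ \<Rightarrow> y x)" for x and y :: "source \<Rightarrow> complex"
  show ?thesis
  proof (rule indep_vars_ungroup[OF X_indep, where key=key and partner=partner and f=f])
    fix x assume x: "x \<in> S"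
    let ?P = "PiM {y\<in>S. key y = key x} (\<lambda>_. borel :: complex measure)"
    have comp: "(\<lambda>y. y u) \<in> borel_measurable ?P" if "u \<in> S" "key u = key x" for u
      using that by (intro measurable_component_singleton) auto
    show "f x \<in> borel_measurable ?P"
    proof (cases x)
      case (Channel b j m a)
      with x have "(\<lambda>y. y (Channel b j m a)) \<in> borel_measurable ?P" "(\<lambda>y. y (Pilot_Noise b j m a)) \<in> borel_measurable ?P"
        by (auto intro!: comp simp: key_def)
      note m = this
      have fx: "f x = (\<lambda>y. q b j m a y - y (Channel b j m a))" unfolding Channel f_def by auto
      show ?thesis unfolding fx q_def
        by (intro borel_measurable_diff borel_measurable_times borel_measurable_add borel_measurable_const m)
    next
      case (Pilot_Noise b j m a)
      with x have "(\<lambda>y. y (Channel b j m a)) \<in> borel_measurable ?P" "(\<lambda>y. y (Pilot_Noise b j m a)) \<in> borel_measurable ?P"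
        by (auto intro!: comp simp: key_def)
      note m = this
      have fx: "f x = q b j m a" unfolding Pilot_Noise f_def by auto
      show ?thesis unfolding fx q_def
        by (intro borel_measurable_times borel_measurable_add borel_measurable_const m)
    qed (use comp[of x] x in \<open>auto simp: f_def[abs_def]\<close>)
    show "x = key x \<or> x = partner (key x)" by (cases x) (auto simp: key_def partner_def)
    show "Z x \<in> borel_measurable M" using error_estimate_measurable x .
    fix \<omega> assume "\<omega> \<in> space M"
    show "Z x \<omega> = f x (\<lambda>y\<in>{y\<in>S. key y = key x}. X y \<omega>)"
      using x by (cases x) (auto simp: Z_def f_def q_def est_def key_def)
  next
    fix \<kappa> assume "\<kappa> \<in> S" "partner \<kappa> \<in> S" "\<kappa> \<noteq> partner \<kappa>"
    then show "indep_var borel (Z \<kappa>) borel (Z (partner \<kappa>))"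
      using estimate_decomposition(1) by (cases \<kappa>) (auto simp: partner_def)
  qed
qed

sublocale GF: gaussian_family M Z S vr
proof
  show "indep_vars (\<lambda>_. borel) Z S" by (rule indep_Z)
  fix x assume x: "x \<in> S"
  show "distr M borel (Z x) = CN (vr x)"
    using x estimate_decomposition X_law[OF x] by (cases x) (auto simp: vr_def Z_def)
  show "0 < vr x"
    using x beta_minus_gam by (cases x) (auto simp: vr_def)
qed

end

section \<open>Indexing the columns of the matrix of the other groups' estimates\<close>

definition other_index :: "nat \<Rightarrow> (nat \<Rightarrow> nat) \<Rightarrow> nat \<Rightarrow> (nat \<times> nat) list" where
  "other_index G K j = concat (map (\<lambda>l. map (Pair l) [1..<Suc (K l)]) (filter (\<lambda>l. l \<noteq> j) [1..<Suc G]))"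

lemma other_estimates_index:
  "other_estimates N G K h j = mat_of_cols N (map (\<lambda>(l, m). h l m) (other_index G K j))"
  unfolding other_estimates_def other_index_def by (simp add: map_concat comp_def)

lemma set_other_index: "set (other_index G K j) = {(l, m). l \<in> {1..G} - {j} \<and> m \<in> {1..K l}}"
  unfolding other_index_def by (auto simp del: upt_Suc)

lemma distinct_concat_Pair: "distinct ls \<Longrightarrow> distinct (concat (map (\<lambda>l. map (Pair l) [1..<Suc (K l)]) ls))"
  by (induction ls) (auto simp: distinct_map inj_on_def)

lemma distinct_other_index: "distinct (other_index G K j)"
  unfolding other_index_def by (intro distinct_concat_Pair) simp

lemma length_other_index:
  assumes "j \<in> {1..G}" shows "length (other_index G K j) = nu G K j"
proof -
  have "length (other_index G K j) = (\<Sum>l\<leftarrow>filter (\<lambda>l. l \<noteq> j) [1..<Suc G]. K l)"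
    unfolding other_index_def by (simp add: length_concat comp_def del: upt_Suc)
  also have "\<dots> = (\<Sum>l\<in>{1..G} - {j}. K l)"
    by (subst sum_list_distinct_conv_sum_set) (auto intro!: sum.cong simp del: upt_Suc)
  also have "\<dots> = nu G K j"
    unfolding nu_def using assms by (simp add: sum_diff1_nat)
  finally show ?thesis .
qed

section \<open>Precoders and received signal in terms of the Gaussian family\<close>

context multicast_user
begin

abbreviation H :: "nat \<Rightarrow> 'w \<Rightarrow> nat \<Rightarrow> nat \<Rightarrow> complex vec" where
  "H b \<omega> j m \<equiv> mmse_estimate \<tau> (p_ul j m) (\<beta> j m) (g b j m \<omega>) (n b j m \<omega>)"

lemma H_entry:
  assumes "j \<in> {1..G}" "m \<in> {1..K j}" "a < N" "\<omega> \<in> space M"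
  shows "vec_index (H b \<omega> j m) a = Z (Pilot_Noise b j m a) \<omega>"
proof -
  have "dim_vec (g b j m \<omega>) = N" "dim_vec (n b j m \<omega>) = N"
    using dims[OF assms(1,2,4), of b] by auto
  then show ?thesis using assms(3) by (simp add: mmse_estimate_def Z_def est_def X_def)
qed

text \<open>Under a \<open>Channel\<close> label, \<open>Z\<close> stores estimate minus channel;
  this fixes the sign with which the error enters everywhere below.\<close>

lemma g_entry:
  assumes "j \<in> {1..G}" "m \<in> {1..K j}" "a < N" "\<omega> \<in> space M"
  shows "vec_index (g b j m \<omega>) a = Z (Pilot_Noise b j m a) \<omega> - Z (Channel b j m a) \<omega>"
  by (simp add: Z_def X_def)

definition A :: "nat \<Rightarrow> nat \<Rightarrow> 'w \<Rightarrow> complex mat" where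
  "A b j \<omega> = other_estimates N G K (H b \<omega>) j"

abbreviation lab :: "nat \<Rightarrow> nat \<Rightarrow> nat \<Rightarrow> nat \<Rightarrow> source" where
  "lab b j r c \<equiv> Pilot_Noise b (fst (other_index G K j ! c)) (snd (other_index G K j ! c)) r"

definition Gm :: "nat \<Rightarrow> nat \<Rightarrow> 'w \<Rightarrow> complex mat" where
  "Gm b j \<omega> = mat_adjoint (A b j \<omega>) * A b j \<omega>"

definition P :: "nat \<Rightarrow> nat \<Rightarrow> nat \<Rightarrow> nat \<Rightarrow> 'w \<Rightarrow> complex" where
  "P b j a c \<omega> = nulling_projector N G K (H b \<omega>) j $$ (a, c)"

text \<open>The labels that determine the projector of group \<open>j\<close>. They avoid the
  estimates of group \<open>j\<close> itself, and this independence is what makes the second moments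
  computable.\<close>

definition IP :: "nat \<Rightarrow> nat \<Rightarrow> source set" where
  "IP b j = {Pilot_Noise b l m a | l m a. l \<in> {1..G} - {j} \<and> m \<in> {1..K l} \<and> a < N}"

lemma IP_S: "IP b j \<subseteq> S"
  by (auto simp: IP_def)

lemma P_eq: "P b j a c \<omega> = (1\<^sub>m N - A b j \<omega> * inv_mat (mat_adjoint (A b j \<omega>) * A b j \<omega>) * mat_adjoint (A b j \<omega>)) $$ (a, c)"
  unfolding P_def nulling_projector_def A_def Let_def ..

context
  fixes j :: nat
  assumes j: "j \<in> {1..G}"
begin

lemma other_index_nth:
  assumes "c < nu G K j"
  shows "fst (other_index G K j ! c) \<in> {1..G} - {j}" "snd (other_index G K j ! c) \<in> {1..K (fst (other_index G K j ! c))}"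
  using nth_mem[of c "other_index G K j"] assms length_other_index[OF j, of K] set_other_index[of G K j]
  by (auto simp: split_beta)

lemma A_carrier: "A b j \<omega> \<in> carrier_mat N (nu G K j)"
  unfolding A_def other_estimates_index using length_other_index[OF j, of K] by (intro carrier_matI) simp_all

lemma A_entry:
  assumes "a < N" "c < nu G K j" "\<omega> \<in> space M"
  shows "A b j \<omega> $$ (a, c) = Z (lab b j a c) \<omega>"
proof -
  have "A b j \<omega> $$ (a, c) = vec_index (H b \<omega> (fst (other_index G K j ! c)) (snd (other_index G K j ! c))) a"
    unfolding A_def other_estimates_index using assms length_other_index[OF j, of K]
    by (simp add: mat_of_cols_index split_beta)
  also have "\<dots> = Z (lab b j a c) \<omega>"
    using other_index_nth[OF assms(2)] assms by (intro H_entry) auto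
  finally show ?thesis .
qed

lemma lab_IP: "a < N \<Longrightarrow> c < nu G K j \<Longrightarrow> lab b j a c \<in> IP b j"
  using other_index_nth[of c] by (auto simp: IP_def)

lemma A_meas: "a < N \<Longrightarrow> c < nu G K j \<Longrightarrow> (\<lambda>\<omega>. A b j \<omega> $$ (a, c)) \<in> borel_measurable (GF.Sg (IP b j))"
  using GF.Z_Sg[OF lab_IP] A_entry by (subst measurable_cong) auto

lemma Gm_carrier: "Gm b j \<omega> \<in> carrier_mat (nu G K j) (nu G K j)"
  unfolding Gm_def by (rule gram_carrier[OF A_carrier])

lemma Gm_meas:
  assumes "c < nu G K j" "d < nu G K j"
  shows "(\<lambda>\<omega>. Gm b j \<omega> $$ (c, d)) \<in> borel_measurable (GF.Sg (IP b j))"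
proof -
  have "Gm b j \<omega> $$ (c, d) = (\<Sum>a<N. cnj (A b j \<omega> $$ (a, c)) * A b j \<omega> $$ (a, d))" for \<omega>
    unfolding Gm_def using A_carrier[of b \<omega>] assms
    by (subst index_mult_mat_sum[of _ "nu G K j" N _ "nu G K j"]) auto
  then show ?thesis
    using assms by (simp only:) (intro borel_measurable_sum borel_measurable_times borel_measurable_cnj A_meas; simp)
qed

lemma inv_Gm_meas:
  assumes "c < nu G K j" "d < nu G K j"
  shows "(\<lambda>\<omega>. inv_mat (Gm b j \<omega>) $$ (c, d)) \<in> borel_measurable (GF.Sg (IP b j))"
proof -
  have [measurable]: "(\<lambda>\<omega>. det (Gm b j \<omega>)) \<in> borel_measurable (GF.Sg (IP b j))"
    by (rule det_measurable[OF Gm_carrier Gm_meas])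
  have [measurable]: "(\<lambda>\<omega>. cofactor (Gm b j \<omega>) d c) \<in> borel_measurable (GF.Sg (IP b j))"
    by (rule cofactor_measurable[OF Gm_carrier Gm_meas]) (use assms in auto)
  show ?thesis
    unfolding inv_mat_index[OF Gm_carrier assms] by measurable
qed

lemma P_meas:
  assumes "a < N" "c < N"
  shows "P b j a c \<in> borel_measurable (GF.Sg (IP b j))"
proof -
  have "P b j a c \<omega> = (if a = c then 1 else 0) - (\<Sum>e<nu G K j. \<Sum>d<nu G K j.
      A b j \<omega> $$ (a, d) * inv_mat (Gm b j \<omega>) $$ (d, e) * cnj (A b j \<omega> $$ (c, e)))" for \<omega>
  proof -
    define E where "E = A b j \<omega> * inv_mat (Gm b j \<omega>) * mat_adjoint (A b j \<omega>)"
    have "E \<in> carrier_mat N N"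
      unfolding E_def Gm_def by (rule projector_range_carrier[OF A_carrier])
    then have "P b j a c \<omega> = (if a = c then 1 else 0) - E $$ (a, c)"
      using assms unfolding P_eq E_def[symmetric] Gm_def[symmetric] by simp
    then show ?thesis
      unfolding E_def Gm_def projector_range_index[OF A_carrier[of b \<omega>] assms] .
  qed
  then have "P b j a c = (\<lambda>\<omega>. (if a = c then 1 else 0) - (\<Sum>e<nu G K j. \<Sum>d<nu G K j.
      A b j \<omega> $$ (a, d) * inv_mat (Gm b j \<omega>) $$ (d, e) * cnj (A b j \<omega> $$ (c, e))))" by auto
  then show ?thesis
    using assms
    by (simp only:) (intro borel_measurable_diff borel_measurable_const borel_measurable_sum borel_measurable_times
        borel_measurable_cnj A_meas inv_Gm_meas; simp)
qed

lemma P_herm: "a < N \<Longrightarrow> c < N \<Longrightarrow> P b j a c \<omega> = cnj (P b j c a \<omega>)"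
  unfolding P_eq by (rule projector_hermitian[OF A_carrier])

lemma P_idem: "a < N \<Longrightarrow> c < N \<Longrightarrow> (\<Sum>d<N. P b j a d \<omega> * P b j d c \<omega>) = P b j a c \<omega>"
  unfolding P_eq by (rule projector_idem[OF A_carrier])

lemma P_row: "a < N \<Longrightarrow> complex_of_real (\<Sum>c<N. (cmod (P b j a c \<omega>))\<^sup>2) = P b j a a \<omega>"
  by (rule hermitian_projector_bounds(1)[where P="\<lambda>a c. P b j a c \<omega>", OF P_herm P_idem])

lemma P_bound: "a < N \<Longrightarrow> c < N \<Longrightarrow> cmod (P b j a c \<omega>) \<le> 1"
  by (rule hermitian_projector_bounds(2)[where P="\<lambda>a c. P b j a c \<omega>", OF P_herm P_idem])

text \<open>Since \<open>nu G K j < N\<close>, the first \<open>nu G K j\<close> rows form a square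
  block. Distinct positions carry distinct labels, so its entries are independent Gaussian
  variables.\<close>

lemma AE_Gm: "AE \<omega> in M. det (Gm b j \<omega>) \<noteq> 0"
proof -
  have nuN: "nu G K j < N" using antennas j by simp
  have "AE \<omega> in M. det (mat (nu G K j) (nu G K j) (\<lambda>(r, c). Z (lab b j r c) \<omega>)) \<noteq> 0"
  proof (rule GF.AE_det_neq_0)
    show "inj_on (\<lambda>(r, c). lab b j r c) ({..<nu G K j} \<times> {..<nu G K j})"
      using distinct_other_index[of G K j] length_other_index[OF j, of K]
      by (auto simp: inj_on_def intro: nth_eq_iff_index_eq[THEN iffD1] prod_eqI)
    show "lab b j r c \<in> S" if "r < nu G K j" "c < nu G K j" for r c
      using that nuN by (intro subsetD[OF IP_S lab_IP]) auto
  qed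
  then show ?thesis
  proof (rule AE_mp, intro AE_I2 impI)
    fix \<omega> assume \<omega>: "\<omega> \<in> space M" and d: "det (mat (nu G K j) (nu G K j) (\<lambda>(r, c). Z (lab b j r c) \<omega>)) \<noteq> 0"
    have "mat (nu G K j) (nu G K j) (\<lambda>(r, c). Z (lab b j r c) \<omega>) = mat (nu G K j) (nu G K j) (\<lambda>rc. A b j \<omega> $$ rc)"
      using nuN \<omega> by (intro eq_matI) (auto simp: A_entry)
    with d show "det (Gm b j \<omega>) \<noteq> 0"
      unfolding Gm_def using nuN by (intro gram_nonsingular[OF A_carrier]) auto
  qed
qed

lemma AE_P_trace: "AE \<omega> in M. (\<Sum>a<N. P b j a a \<omega>) = of_nat (N - nu G K j)"
  using AE_Gm[of b]
proof eventually_elim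
  case (elim \<omega>)
  then show ?case
    using projector_trace[OF A_carrier[of b \<omega>]] antennas[OF j]
    unfolding P_eq Gm_def by (simp add: of_nat_diff)
qed

text \<open>The estimate of a user of another group is one of the columns of
  \<open>A b j\<close>.\<close>

lemma AE_P_null:
  assumes lm: "l \<in> {1..G}" "l \<noteq> j" "m \<in> {1..K l}"
  shows "AE \<omega> in M. \<forall>a<N. (\<Sum>c<N. P b j a c \<omega> * Z (Pilot_Noise b l m c) \<omega>) = 0"
proof -
  have "(l, m) \<in> set (other_index G K j)" using lm by (simp add: set_other_index)
  then obtain d where d: "d < nu G K j" "other_index G K j ! d = (l, m)"
    using length_other_index[OF j, of K] by (auto simp: in_set_conv_nth)
  show ?thesis
    using AE_Gm[of b]
  proof (rule AE_mp, intro AE_I2 impI allI)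
    fix \<omega> a assume h: "\<omega> \<in> space M" "det (Gm b j \<omega>) \<noteq> 0" "a < N"
    have "(\<Sum>c<N. P b j a c \<omega> * Z (Pilot_Noise b l m c) \<omega>) = (\<Sum>c<N. P b j a c \<omega> * A b j \<omega> $$ (c, d))"
      using d h by (intro sum.cong) (auto simp: A_entry)
    also have "\<dots> = 0"
      unfolding P_eq using h d by (intro projector_nulls[OF A_carrier]) (auto simp: Gm_def)
    finally show "(\<Sum>c<N. P b j a c \<omega> * Z (Pilot_Noise b l m c) \<omega>) = 0" .
  qed
qed

end

text \<open>The precoder entry as a linear form in the estimates of group \<open>j\<close>, with
  coefficients depending on \<open>IP b j\<close> alone. The sum runs over pairs of user and antenna
  to match the shape of the Pythagorean lemmas.\<close>

definition w :: "nat \<Rightarrow> nat \<Rightarrow> nat \<Rightarrow> 'w \<Rightarrow> complex" where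
  "w b j a \<omega> = (\<Sum>e\<in>{1..K j} \<times> {..<N}. complex_of_real (sqrt (\<mu> j (fst e))) * P b j a (snd e) \<omega> * Z (Pilot_Noise b j (fst e) (snd e)) \<omega>)"

lemma precoder_entry:
  assumes "j \<in> {1..G}" "a < N" "\<omega> \<in> space M"
  shows "vec_index (precoder N G K \<mu> (H b \<omega>) j) a = w b j a \<omega>"
proof -
  have c: "nulling_projector N G K (H b \<omega>) j \<in> carrier_mat N N"
    using projector_range_carrier[OF A_carrier[OF assms(1), of b \<omega>]]
    unfolding nulling_projector_def Let_def A_def[symmetric] by (rule minus_carrier_mat)
  have "vec_index (precoder N G K \<mu> (H b \<omega>) j) a =
      (\<Sum>c<N. P b j a c \<omega> * (\<Sum>m=1..K j. complex_of_real (sqrt (\<mu> j m)) * vec_index (H b \<omega> j m) c))"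
    unfolding precoder_def P_def using assms by (subst index_mult_mat_vec_sum[OF c]) auto
  also have "\<dots> = (\<Sum>c<N. P b j a c \<omega> * (\<Sum>m=1..K j. complex_of_real (sqrt (\<mu> j m)) * Z (Pilot_Noise b j m c) \<omega>))"
    using H_entry[OF assms(1) _ _ assms(3)] by (intro sum.cong refl arg_cong2[where f="(*)"]) auto
  also have "\<dots> = (\<Sum>c<N. \<Sum>m=1..K j. complex_of_real (sqrt (\<mu> j m)) * P b j a c \<omega> * Z (Pilot_Noise b j m c) \<omega>)"
    by (simp add: sum_distrib_left mult_ac)
  also have "\<dots> = w b j a \<omega>"
    unfolding w_def by (subst sum.swap) (simp add: sum.cartesian_product split_beta)
  finally show ?thesis .
qed

text \<open>The effective scalar channel from the symbol of group \<open>j\<close> to the user; the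
  difference inside \<open>cnj\<close> is the true channel entry.\<close>

definition gain :: "nat \<Rightarrow> nat \<Rightarrow> 'w \<Rightarrow> complex" where
  "gain b j \<omega> = (\<Sum>a<N. w b j a \<omega> * cnj (Z (Pilot_Noise b i k a) \<omega> - Z (Channel b i k a) \<omega>))"

definition interf :: "nat \<Rightarrow> nat \<Rightarrow> 'w \<Rightarrow> complex" where
  "interf b t \<omega> = (\<Sum>j\<in>{1..G} - {i}. gain b j \<omega> * Z (Data b t j) \<omega>) + Z (Receiver_Noise b t) \<omega>"

lemma channel_eq:
  assumes "t \<in> D" "\<omega> \<in> space M"
  shows "multicast_channel N G \<tau> K \<beta> p_ul \<mu> g n s z i k x b t \<omega> = gain b i \<omega> * x b t + interf b t \<omega>"
proof -
  have gc: "g b i k \<omega> \<in> carrier_vec N" using dims[OF user assms(2)] by simp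
  define sy where "sy = (\<lambda>j. s b t j \<omega>)(i := x b t)"
  have "multicast_channel N G \<tau> K \<beta> p_ul \<mu> g n s z i k x b t \<omega> =
     (\<Sum>a<N. (\<Sum>j=1..G. vec_index (precoder N G K \<mu> (H b \<omega>) j) a * sy j) * cnj (vec_index (g b i k \<omega>) a)) + z i k b t \<omega>"
    unfolding multicast_channel_def received_def sy_def using gc
    by (simp add: scalar_prod_def atLeast0LessThan)
  also have "(\<Sum>a<N. (\<Sum>j=1..G. vec_index (precoder N G K \<mu> (H b \<omega>) j) a * sy j) * cnj (vec_index (g b i k \<omega>) a)) =
     (\<Sum>a<N. \<Sum>j=1..G. w b j a \<omega> * cnj (Z (Pilot_Noise b i k a) \<omega> - Z (Channel b i k a) \<omega>) * sy j)"
  proof (rule sum.cong[OF refl])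
    fix a assume a: "a \<in> {..<N}"
    have "(\<Sum>j=1..G. vec_index (precoder N G K \<mu> (H b \<omega>) j) a * sy j) = (\<Sum>j=1..G. w b j a \<omega> * sy j)"
      using a assms by (intro sum.cong) (auto simp: precoder_entry)
    then show "(\<Sum>j=1..G. vec_index (precoder N G K \<mu> (H b \<omega>) j) a * sy j) * cnj (vec_index (g b i k \<omega>) a) =
       (\<Sum>j=1..G. w b j a \<omega> * cnj (Z (Pilot_Noise b i k a) \<omega> - Z (Channel b i k a) \<omega>) * sy j)"
      using a assms g_entry[OF user, of a \<omega> b] by (simp only: sum_distrib_right lessThan_iff) (simp only: mult_ac)
  qed
  also have "\<dots> = (\<Sum>j=1..G. gain b j \<omega> * sy j)"
    unfolding gain_def sum_distrib_right by (rule sum.swap)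
  also have "\<dots> = gain b i \<omega> * x b t + (\<Sum>j\<in>{1..G} - {i}. gain b j \<omega> * s b t j \<omega>)"
    using user by (subst sum.remove[of _ i]) (auto simp: sy_def)
  finally show ?thesis
    by (simp add: interf_def Z_def X_def)
qed

end

context gaussian_family
begin

lemma pythagoras_inj:
  assumes E: "finite E" "inj_on l E" "l ` E \<subseteq> S" and I: "I \<subseteq> S" "I \<inter> l ` E = {}"
    and \<phi>: "\<phi> \<in> borel_measurable (Sg I)" "integrable M (\<lambda>\<omega>. (cmod (\<phi> \<omega>))\<^sup>2)"
    and f: "\<And>e. e \<in> E \<Longrightarrow> f e \<in> borel_measurable (Sg I)" "\<And>e. e \<in> E \<Longrightarrow> integrable M (\<lambda>\<omega>. (cmod (f e \<omega>))\<^sup>2)"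
  shows "expectation (\<lambda>\<omega>. (cmod (\<phi> \<omega> + (\<Sum>e\<in>E. f e \<omega> * Z (l e) \<omega>)))\<^sup>2) =
      expectation (\<lambda>\<omega>. (cmod (\<phi> \<omega>))\<^sup>2) + (\<Sum>e\<in>E. var (l e) * expectation (\<lambda>\<omega>. (cmod (f e \<omega>))\<^sup>2))"
proof -
  define f' where "f' x = f (the_inv_into E l x)" for x
  have f'[simp]: "f' (l e) = f e" if "e \<in> E" for e
    using the_inv_into_f_f[OF E(2) that] by (simp add: f'_def)
  have "expectation (\<lambda>\<omega>. (cmod (\<phi> \<omega> + (\<Sum>x\<in>l ` E. f' x \<omega> * Z x \<omega>)))\<^sup>2) =
      expectation (\<lambda>\<omega>. (cmod (\<phi> \<omega>))\<^sup>2) + (\<Sum>x\<in>l ` E. var x * expectation (\<lambda>\<omega>. (cmod (f' x \<omega>))\<^sup>2))"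
    using E I \<phi> f by (intro conjunct2[OF pythagoras]) auto
  then show ?thesis
    using E by (simp add: sum.reindex)
qed

end

section \<open>Second moments of the effective gains\<close>

context multicast_user
begin

text \<open>All estimates of interval \<open>b\<close>, hence all that the precoders depend on.
  \<open>IC\<close> adds the errors of the considered user, after which it determines the gains
  while staying disjoint from the labels of data and receiver noise.\<close>

definition IB :: "nat \<Rightarrow> source set" where
  "IB b = {Pilot_Noise b l m a | l m a. l \<in> {1..G} \<and> m \<in> {1..K l} \<and> a < N}"

definition IC :: "nat \<Rightarrow> source set" where
  "IC b = IB b \<union> (\<lambda>a. Channel b i k a) ` {..<N}"

lemma IB_S: "IB b \<subseteq> S" and IC_S: "IC b \<subseteq> S"
  using user by (auto simp: IB_def IC_def)

lemma est_IB: "l \<in> {1..G} \<Longrightarrow> m \<in> {1..K l} \<Longrightarrow> a < N \<Longrightarrow> Z (Pilot_Noise b l m a) \<in> borel_measurable (GF.Sg (IB b))"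
  by (intro GF.Z_Sg) (auto simp: IB_def)

lemma P_IB: "j \<in> {1..G} \<Longrightarrow> a < N \<Longrightarrow> c < N \<Longrightarrow> P b j a c \<in> borel_measurable (GF.Sg (IB b))"
  by (rule GF.measurable_Sg_mono[OF _ P_meas]) (auto simp: IP_def IB_def)

lemma w_IB: "j \<in> {1..G} \<Longrightarrow> a < N \<Longrightarrow> w b j a \<in> borel_measurable (GF.Sg (IB b))"
  unfolding w_def
  by (intro borel_measurable_sum borel_measurable_times borel_measurable_const est_IB P_IB) auto

lemma gain_IC: assumes j: "j \<in> {1..G}" shows "gain b j \<in> borel_measurable (GF.Sg (IC b))"
proof -
  have mono: "f \<in> borel_measurable (GF.Sg (IB b)) \<Longrightarrow> f \<in> borel_measurable (GF.Sg (IC b))" for f :: "'w \<Rightarrow> complex"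
    by (rule GF.measurable_Sg_mono) (auto simp: IC_def)
  show ?thesis
    unfolding gain_def
    by (intro borel_measurable_sum borel_measurable_times borel_measurable_cnj borel_measurable_diff
        mono[OF w_IB] mono[OF est_IB] GF.Z_Sg) (use user j in \<open>auto simp: IC_def\<close>)
qed

lemma bounded_moments_est: "l \<in> {1..G} \<Longrightarrow> m \<in> {1..K l} \<Longrightarrow> a < N \<Longrightarrow> bounded_moments M (\<lambda>b. Z (Pilot_Noise b l m a))"
  by (rule GF.bounded_moments_Z[where v="gam l m"]) (auto simp: vr_def)

lemma bounded_moments_err: "a < N \<Longrightarrow> bounded_moments M (\<lambda>b. Z (Channel b i k a))"
  using user by (intro GF.bounded_moments_Z[where v="\<beta> i k - gam i k"]) (auto simp: vr_def)

lemma bounded_moments_data: "t \<in> D \<Longrightarrow> j \<in> {1..G} \<Longrightarrow> bounded_moments M (\<lambda>b. Z (Data b t j))"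
  by (rule GF.bounded_moments_Z[where v=1]) (auto simp: vr_def)

lemma bounded_moments_noise: "t \<in> D \<Longrightarrow> bounded_moments M (\<lambda>b. Z (Receiver_Noise b t))"
  by (rule GF.bounded_moments_Z[where v=1]) (auto simp: vr_def)

lemma bounded_moments_P: "j \<in> {1..G} \<Longrightarrow> a < N \<Longrightarrow> c < N \<Longrightarrow> bounded_moments M (\<lambda>b. P b j a c)"
  by (rule bounded_moments_dominated[OF bounded_moments_const[of 1]]) (auto intro: GF.measurable_Sg_M[OF IP_S P_meas] P_bound)

lemma bounded_moments_w: "j \<in> {1..G} \<Longrightarrow> a < N \<Longrightarrow> bounded_moments M (\<lambda>b. w b j a)"
  unfolding w_def[abs_def] by (intro bounded_moments_sum bounded_moments_mult bounded_moments_const bounded_moments_P bounded_moments_est) auto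

lemma bounded_moments_gain: "j \<in> {1..G} \<Longrightarrow> bounded_moments M (\<lambda>b. gain b j)"
  unfolding gain_def[abs_def] using user
  by (intro bounded_moments_sum bounded_moments_mult bounded_moments_cnj bounded_moments_minus bounded_moments_w bounded_moments_est bounded_moments_err) auto

lemma bounded_moments_interf: "t \<in> D \<Longrightarrow> bounded_moments M (\<lambda>b. interf b t)"
  unfolding interf_def[abs_def]
  by (intro bounded_moments_add bounded_moments_sum bounded_moments_mult bounded_moments_gain bounded_moments_data bounded_moments_noise) auto

lemmas bounded_moments_sq = bounded_moments_integrable_power[where p=2]

lemma mu_nonneg: "j \<in> {1..G} \<Longrightarrow> m \<in> {1..K j} \<Longrightarrow> 0 \<le> \<mu> j m"
  using mu[of j m] powers[of j m] beta_minus_gam(2)[of j m] by simp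

lemma mu_gam: "j \<in> {1..G} \<Longrightarrow> m \<in> {1..K j} \<Longrightarrow> \<mu> j m * gam j m * real (N - nu G K j) = p_dl j m"
  using mu[of j m] antennas[of j] beta_minus_gam(2)[of j m] by simp

lemma norm_sqrt_mu: "j \<in> {1..G} \<Longrightarrow> m \<in> {1..K j} \<Longrightarrow> (cmod (complex_of_real (sqrt (\<mu> j m)) * u))\<^sup>2 = \<mu> j m * (cmod u)\<^sup>2"
  using mu_nonneg[of j m] by (simp add: norm_mult power_mult_distrib)

text \<open>Each row has squared norm equal to its diagonal entry, so the squared Frobenius norm is
  the trace, which is almost surely constant.\<close>

lemma P_frobenius:
  assumes j: "j \<in> {1..G}"
  shows "(\<Sum>a<N. \<Sum>c<N. expectation (\<lambda>\<omega>. (cmod (P b j a c \<omega>))\<^sup>2)) = real (N - nu G K j)"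
proof -
  have i: "integrable M (\<lambda>\<omega>. (cmod (P b j a c \<omega>))\<^sup>2)" if "a < N" "c < N" for a c
    by (rule bounded_moments_sq[OF bounded_moments_P[OF j that]])
  have "(\<Sum>a<N. \<Sum>c<N. expectation (\<lambda>\<omega>. (cmod (P b j a c \<omega>))\<^sup>2)) =
      (\<Sum>a<N. expectation (\<lambda>\<omega>. \<Sum>c<N. (cmod (P b j a c \<omega>))\<^sup>2))"
    using i by (intro sum.cong refl Bochner_Integration.integral_sum[symmetric]) auto
  also have "\<dots> = expectation (\<lambda>\<omega>. \<Sum>a<N. \<Sum>c<N. (cmod (P b j a c \<omega>))\<^sup>2)"
    using i by (intro Bochner_Integration.integral_sum[symmetric] Bochner_Integration.integrable_sum) auto
  also have "\<dots> = expectation (\<lambda>\<omega>. real (N - nu G K j))"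
  proof (rule integral_cong_AE)
    show "(\<lambda>\<omega>. \<Sum>a<N. \<Sum>c<N. (cmod (P b j a c \<omega>))\<^sup>2) \<in> borel_measurable M"
      using i by (intro borel_measurable_sum borel_measurable_integrable) auto
    show "AE \<omega> in M. (\<Sum>a<N. \<Sum>c<N. (cmod (P b j a c \<omega>))\<^sup>2) = real (N - nu G K j)"
      using AE_P_trace[OF j, of b]
    proof eventually_elim
      case (elim \<omega>)
      have "complex_of_real (\<Sum>a<N. \<Sum>c<N. (cmod (P b j a c \<omega>))\<^sup>2) = (\<Sum>a<N. P b j a a \<omega>)"
        unfolding of_real_sum[of "\<lambda>a. \<Sum>c<N. (cmod (P b j a c \<omega>))\<^sup>2"]
        by (intro sum.cong refl P_row[OF j]) simp
      also have "\<dots> = complex_of_real (real (N - nu G K j))" using elim by simp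
      finally show ?case by (simp only: of_real_eq_iff)
    qed
  qed simp
  finally show ?thesis by (simp add: prob_space)
qed

text \<open>The normalization of \<open>\<mu>\<close> is made for this: user \<open>m\<close>
  contributes \<open>gam j m * \<mu> j m\<close> times the mean squared Frobenius norm of the
  projector, and that product is its downlink power.\<close>

lemma w_power:
  assumes j: "j \<in> {1..G}"
  shows "(\<Sum>a<N. expectation (\<lambda>\<omega>. (cmod (w b j a \<omega>))\<^sup>2)) = (\<Sum>m=1..K j. p_dl j m)"
proof -
  let ?E = "{1..K j} \<times> {..<N}"
  have "expectation (\<lambda>\<omega>. (cmod (w b j a \<omega>))\<^sup>2) =
      (\<Sum>e\<in>?E. gam j (fst e) * (\<mu> j (fst e) * expectation (\<lambda>\<omega>. (cmod (P b j a (snd e) \<omega>))\<^sup>2)))" if a: "a < N" for a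
  proof -
    have "expectation (\<lambda>\<omega>. (cmod (0 + (\<Sum>e\<in>?E. (complex_of_real (sqrt (\<mu> j (fst e))) * P b j a (snd e) \<omega>) *
          Z (Pilot_Noise b j (fst e) (snd e)) \<omega>)))\<^sup>2) = expectation (\<lambda>\<omega>. (cmod 0)\<^sup>2) +
        (\<Sum>e\<in>?E. vr (Pilot_Noise b j (fst e) (snd e)) *
           expectation (\<lambda>\<omega>. (cmod (complex_of_real (sqrt (\<mu> j (fst e))) * P b j a (snd e) \<omega>))\<^sup>2))"
    proof (rule GF.pythagoras_inj)
      show "IP b j \<subseteq> S" by (rule IP_S)
      show "integrable M (\<lambda>\<omega>. (cmod (complex_of_real (sqrt (\<mu> j (fst e))) * P b j a (snd e) \<omega>))\<^sup>2)" if "e \<in> ?E" for e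
        by (rule bounded_moments_sq) (use that a j in \<open>auto intro!: bounded_moments_mult bounded_moments_const bounded_moments_P\<close>)
      show "(\<lambda>\<omega>. complex_of_real (sqrt (\<mu> j (fst e))) * P b j a (snd e) \<omega>) \<in> borel_measurable (GF.Sg (IP b j))" if "e \<in> ?E" for e
        using that a j by (intro borel_measurable_times borel_measurable_const P_meas) auto
    qed (use j in \<open>auto simp: inj_on_def IP_def\<close>)
    also have "\<dots> = (\<Sum>e\<in>?E. gam j (fst e) * (\<mu> j (fst e) * expectation (\<lambda>\<omega>. (cmod (P b j a (snd e) \<omega>))\<^sup>2)))"
      using norm_sqrt_mu[OF j] by (auto simp: vr_def intro!: sum.cong)
    finally show ?thesis by (simp add: w_def)
  qed
  then have "(\<Sum>a<N. expectation (\<lambda>\<omega>. (cmod (w b j a \<omega>))\<^sup>2)) =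
      (\<Sum>a<N. \<Sum>e\<in>?E. gam j (fst e) * (\<mu> j (fst e) * expectation (\<lambda>\<omega>. (cmod (P b j a (snd e) \<omega>))\<^sup>2)))"
    by (intro sum.cong) auto
  also have "\<dots> = (\<Sum>a<N. \<Sum>m=1..K j. \<Sum>c<N. gam j m * (\<mu> j m * expectation (\<lambda>\<omega>. (cmod (P b j a c \<omega>))\<^sup>2)))"
    by (simp add: sum.cartesian_product split_beta)
  also have "\<dots> = (\<Sum>m=1..K j. \<Sum>a<N. \<Sum>c<N. gam j m * (\<mu> j m * expectation (\<lambda>\<omega>. (cmod (P b j a c \<omega>))\<^sup>2)))"
    by (rule sum.swap)
  also have "\<dots> = (\<Sum>m=1..K j. gam j m * (\<mu> j m * real (N - nu G K j)))"
    by (simp only: sum_distrib_left[symmetric] P_frobenius[OF j])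
  also have "\<dots> = (\<Sum>m=1..K j. p_dl j m)"
    using mu_gam[OF j] by (intro sum.cong) (auto simp: mult_ac)
  finally show ?thesis .
qed

text \<open>The errors of the user are independent of all estimates, hence of the precoder and of
  \<open>\<phi>\<close>, and add their variance times the mean squared norm of the precoder. The
  expression is conjugated first, because the errors occur conjugated whereas
  \<open>pythagoras_inj\<close> speaks of plain variables.\<close>

lemma error_pythagoras:
  assumes j: "j \<in> {1..G}" and \<phi>: "\<phi> \<in> borel_measurable (GF.Sg (IB b))" "integrable M (\<lambda>\<omega>. (cmod (\<phi> \<omega>))\<^sup>2)"
  shows "expectation (\<lambda>\<omega>. (cmod (\<phi> \<omega> - (\<Sum>a<N. w b j a \<omega> * cnj (Z (Channel b i k a) \<omega>))))\<^sup>2) =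
     expectation (\<lambda>\<omega>. (cmod (\<phi> \<omega>))\<^sup>2) + (\<beta> i k - gam i k) * (\<Sum>m=1..K j. p_dl j m)"
proof -
  have "expectation (\<lambda>\<omega>. (cmod (cnj (\<phi> \<omega>) + (\<Sum>a<N. (- cnj (w b j a \<omega>)) * Z (Channel b i k a) \<omega>)))\<^sup>2) =
     expectation (\<lambda>\<omega>. (cmod (cnj (\<phi> \<omega>)))\<^sup>2) + (\<Sum>a<N. vr (Channel b i k a) * expectation (\<lambda>\<omega>. (cmod (- cnj (w b j a \<omega>)))\<^sup>2))"
  proof (rule GF.pythagoras_inj)
    show "IB b \<subseteq> S" by (rule IB_S)
    show "(\<lambda>\<omega>. cnj (\<phi> \<omega>)) \<in> borel_measurable (GF.Sg (IB b))"
      by (intro borel_measurable_cnj \<phi>)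
    show "(\<lambda>\<omega>. - cnj (w b j a \<omega>)) \<in> borel_measurable (GF.Sg (IB b))" if "a \<in> {..<N}" for a
      using that by (intro borel_measurable_uminus borel_measurable_cnj w_IB j) auto
    show "integrable M (\<lambda>\<omega>. (cmod (- cnj (w b j a \<omega>)))\<^sup>2)" if "a \<in> {..<N}" for a
      using bounded_moments_sq[OF bounded_moments_w[OF j, of a], of b] that by simp
  qed (use user \<phi> in \<open>auto simp: inj_on_def IB_def\<close>)
  also have "\<dots> = expectation (\<lambda>\<omega>. (cmod (\<phi> \<omega>))\<^sup>2) + (\<beta> i k - gam i k) * (\<Sum>a<N. expectation (\<lambda>\<omega>. (cmod (w b j a \<omega>))\<^sup>2))"
    by (simp add: vr_def sum_distrib_left)
  finally have e: "expectation (\<lambda>\<omega>. (cmod (cnj (\<phi> \<omega>) + (\<Sum>a<N. (- cnj (w b j a \<omega>)) * Z (Channel b i k a) \<omega>)))\<^sup>2) =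
     expectation (\<lambda>\<omega>. (cmod (\<phi> \<omega>))\<^sup>2) + (\<beta> i k - gam i k) * (\<Sum>m=1..K j. p_dl j m)"
    by (simp only: w_power[OF j])
  have "cmod (\<phi> \<omega> - (\<Sum>a<N. w b j a \<omega> * cnj (Z (Channel b i k a) \<omega>))) =
     cmod (cnj (\<phi> \<omega>) + (\<Sum>a<N. (- cnj (w b j a \<omega>)) * Z (Channel b i k a) \<omega>))" for \<omega>
  proof -
    have "cnj (\<phi> \<omega> - (\<Sum>a<N. w b j a \<omega> * cnj (Z (Channel b i k a) \<omega>))) =
        cnj (\<phi> \<omega>) + (\<Sum>a<N. (- cnj (w b j a \<omega>)) * Z (Channel b i k a) \<omega>)"
      by (simp add: sum_negf)
    then show ?thesis by (metis complex_mod_cnj)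
  qed
  then show ?thesis using e by simp
qed

text \<open>Estimate and error parts of the channel are separated, and the estimate part is
  reordered so that the estimates of group \<open>j\<close> stand outside, with conjugated entries
  of the projected estimate of user \<open>k\<close> as coefficients.\<close>

lemma gain_split:
  "gain b j \<omega> = (\<Sum>e\<in>{1..K j} \<times> {..<N}. complex_of_real (sqrt (\<mu> j (fst e))) *
        (\<Sum>a<N. P b j a (snd e) \<omega> * cnj (Z (Pilot_Noise b i k a) \<omega>)) * Z (Pilot_Noise b j (fst e) (snd e)) \<omega>)
     - (\<Sum>a<N. w b j a \<omega> * cnj (Z (Channel b i k a) \<omega>))"
proof -
  have "(\<Sum>a<N. w b j a \<omega> * cnj (Z (Pilot_Noise b i k a) \<omega>)) =
    (\<Sum>a<N. \<Sum>e\<in>{1..K j} \<times> {..<N}. complex_of_real (sqrt (\<mu> j (fst e))) *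
        (P b j a (snd e) \<omega> * cnj (Z (Pilot_Noise b i k a) \<omega>)) * Z (Pilot_Noise b j (fst e) (snd e)) \<omega>)"
    unfolding w_def sum_distrib_right by (intro sum.cong refl) (simp add: mult_ac)
  also have "\<dots> = (\<Sum>e\<in>{1..K j} \<times> {..<N}. \<Sum>a<N. complex_of_real (sqrt (\<mu> j (fst e))) *
        (P b j a (snd e) \<omega> * cnj (Z (Pilot_Noise b i k a) \<omega>)) * Z (Pilot_Noise b j (fst e) (snd e)) \<omega>)"
    by (rule sum.swap)
  also have "\<dots> = (\<Sum>e\<in>{1..K j} \<times> {..<N}. complex_of_real (sqrt (\<mu> j (fst e))) *
        (\<Sum>a<N. P b j a (snd e) \<omega> * cnj (Z (Pilot_Noise b i k a) \<omega>)) * Z (Pilot_Noise b j (fst e) (snd e)) \<omega>)"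
    by (simp only: sum_distrib_left sum_distrib_right)
  finally show ?thesis
    by (simp add: gain_def right_diff_distrib sum_subtractf)
qed

text \<open>Nulling removes the estimate part almost surely: by Hermitian symmetry its coefficients
  in \<open>gain_split\<close> are conjugated entries of the projector of group \<open>j\<close>
  applied to the estimate of a user outside that group. What leaks through is the estimation
  error.\<close>

lemma interference_power:
  assumes j: "j \<in> {1..G}" "j \<noteq> i"
  shows "expectation (\<lambda>\<omega>. (cmod (gain b j \<omega>))\<^sup>2) = (\<beta> i k - gam i k) * (\<Sum>m=1..K j. p_dl j m)"
proof -
  have m: "gain b j \<in> borel_measurable M" "(\<lambda>\<omega>. 0 - (\<Sum>a<N. w b j a \<omega> * cnj (Z (Channel b i k a) \<omega>))) \<in> borel_measurable M"
  proof -
    show "gain b j \<in> borel_measurable M" by (rule bounded_moments_measurable[OF bounded_moments_gain[OF j(1)]])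
    have "w b j a \<in> borel_measurable M" "Z (Channel b i k a) \<in> borel_measurable M" if "a < N" for a
      using bounded_moments_measurable[OF bounded_moments_w[OF j(1) that]] bounded_moments_measurable[OF bounded_moments_err[OF that]] by auto
    then show "(\<lambda>\<omega>. 0 - (\<Sum>a<N. w b j a \<omega> * cnj (Z (Channel b i k a) \<omega>))) \<in> borel_measurable M"
      by measurable
  qed
  have "AE \<omega> in M. gain b j \<omega> = 0 - (\<Sum>a<N. w b j a \<omega> * cnj (Z (Channel b i k a) \<omega>))"
    using AE_P_null[OF j(1) user(1) j(2)[symmetric] user(2), of b]
  proof eventually_elim
    case (elim \<omega>)
    have "(\<Sum>a<N. P b j a c \<omega> * cnj (Z (Pilot_Noise b i k a) \<omega>)) = 0" if c: "c < N" for c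
    proof -
      have "(\<Sum>a<N. P b j a c \<omega> * cnj (Z (Pilot_Noise b i k a) \<omega>)) =
          (\<Sum>a<N. cnj (P b j c a \<omega> * Z (Pilot_Noise b i k a) \<omega>))"
      proof (rule sum.cong[OF refl])
        fix a assume "a \<in> {..<N}"
        then have "P b j a c \<omega> = cnj (P b j c a \<omega>)" using c by (intro P_herm j) auto
        then show "P b j a c \<omega> * cnj (Z (Pilot_Noise b i k a) \<omega>) = cnj (P b j c a \<omega> * Z (Pilot_Noise b i k a) \<omega>)" by simp
      qed
      also have "\<dots> = cnj (\<Sum>a<N. P b j c a \<omega> * Z (Pilot_Noise b i k a) \<omega>)" by (rule cnj_sum[symmetric])
      finally show ?thesis using elim c by simp
    qed
    then show ?case unfolding gain_split[of b j] by (auto intro!: sum.neutral)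
  qed
  then have "expectation (\<lambda>\<omega>. (cmod (gain b j \<omega>))\<^sup>2) =
      expectation (\<lambda>\<omega>. (cmod (0 - (\<Sum>a<N. w b j a \<omega> * cnj (Z (Channel b i k a) \<omega>))))\<^sup>2)"
    using m by (intro integral_cong_AE) auto
  also have "\<dots> = (\<beta> i k - gam i k) * (\<Sum>m=1..K j. p_dl j m)"
    by (subst error_pythagoras[OF j(1)]) auto
  finally show ?thesis .
qed

text \<open>The mean of \<open>gain b i\<close>: the quadratic form of the user's own estimate has
  mean \<open>gam i k\<close> times the trace of the projector.\<close>

definition h :: real where
  "h = sqrt (\<mu> i k) * gam i k * real (N - nu G K i)"

text \<open>The free parameter \<open>\<kappa>\<close> yields both the power
  (\<open>\<kappa> = 0\<close>) and the variance (\<open>\<kappa> = h\<close>) from one computation.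
  The gain has three layers: the quadratic form \<open>q\<close> in the estimate of user
  \<open>k\<close>, terms linear in the estimates of the other users of the group, and the error
  part. The first contributes \<open>(\<kappa> - h)\<^sup>2 + gam i k * p_dl i k\<close>, the second
  \<open>gam i k * p_dl i m\<close> for every other user \<open>m\<close>, and the third comes from
  \<open>error_pythagoras\<close>.\<close>

lemma gain_power:
  fixes \<kappa> :: real
  shows "expectation (\<lambda>\<omega>. (cmod (gain b i \<omega> - complex_of_real \<kappa>))\<^sup>2) =
    (\<kappa> - h)\<^sup>2 + gam i k * (\<Sum>m=1..K i. p_dl i m) + (\<beta> i k - gam i k) * (\<Sum>m=1..K i. p_dl i m)"
proof -
  define x where "x a = Pilot_Noise b i k a" for a
  define V where "V c \<omega> = (\<Sum>a<N. P b i a c \<omega> * cnj (Z (x a) \<omega>))" for c \<omega>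
  define q where "q \<omega> = (\<Sum>a<N. \<Sum>c<N. cnj (Z (x a) \<omega>) * P b i a c \<omega> * Z (x c) \<omega>)" for \<omega>
  let ?E = "({1..K i} - {k}) \<times> {..<N}"
  define f where "f e \<omega> = complex_of_real (sqrt (\<mu> i (fst e))) * V (snd e) \<omega>" for e :: "nat \<times> nat" and \<omega>
  define \<phi> where "\<phi> \<omega> = complex_of_real (sqrt (\<mu> i k)) * q \<omega> - complex_of_real \<kappa>" for \<omega>
  define \<psi> where "\<psi> \<omega> = \<phi> \<omega> + (\<Sum>e\<in>?E. f e \<omega> * Z (Pilot_Noise b i (fst e) (snd e)) \<omega>)" for \<omega>
  \<comment> \<open>The labels of the projector and of the estimate of user \<open>k\<close>. They
    determine \<open>\<phi>\<close> and the coefficients \<open>f e\<close>, and the estimates of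
    the remaining users of group \<open>i\<close> are independent of them.\<close>
  define I0 where "I0 = IP b i \<union> x ` {..<N}"
  have I0: "I0 \<subseteq> S" using IP_S user by (auto simp: I0_def x_def)
  have xS: "x a \<in> S" "vr (x a) = gam i k" if "a < N" for a using that user by (auto simp: x_def vr_def)
  have PI0: "P b i a c \<in> borel_measurable (GF.Sg I0)" if "a < N" "c < N" for a c
    by (rule GF.measurable_Sg_mono[OF _ P_meas[OF user(1) that]]) (auto simp: I0_def)
  have xI0: "Z (x a) \<in> borel_measurable (GF.Sg I0)" if "a < N" for a
    using that by (intro GF.Z_Sg) (auto simp: I0_def)
  have VI0: "V c \<in> borel_measurable (GF.Sg I0)" if "c < N" for c
    unfolding V_def using that
    by (intro borel_measurable_sum borel_measurable_times borel_measurable_cnj PI0 xI0) auto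
  have qI0: "q \<in> borel_measurable (GF.Sg I0)"
    unfolding q_def
    by (intro borel_measurable_sum borel_measurable_times borel_measurable_cnj PI0 xI0) auto
  have \<phi>I0: "\<phi> \<in> borel_measurable (GF.Sg I0)"
    unfolding \<phi>_def by (intro borel_measurable_diff borel_measurable_times borel_measurable_const qI0)
  have fI0: "f e \<in> borel_measurable (GF.Sg I0)" if "e \<in> ?E" for e
    unfolding f_def using that by (intro borel_measurable_times borel_measurable_const VI0) auto
  have uV: "integrable M (\<lambda>\<omega>. (cmod (V c \<omega>))\<^sup>2)" if c: "c < N" for c
    unfolding V_def x_def
    by (rule bounded_moments_sq[where f="\<lambda>b \<omega>. \<Sum>a<N. P b i a c \<omega> * cnj (Z (Pilot_Noise b i k a) \<omega>)"])
       (use user c in \<open>auto intro!: bounded_moments_sum bounded_moments_mult bounded_moments_cnj bounded_moments_P bounded_moments_est\<close>)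
  have uf: "integrable M (\<lambda>\<omega>. (cmod (f e \<omega>))\<^sup>2)" if "e \<in> ?E" for e
    using uV[of "snd e"] that norm_sqrt_mu[OF user(1), of "fst e"] unfolding f_def by auto
  have umq: "bounded_moments M (\<lambda>b \<omega>. \<Sum>a<N. \<Sum>c<N. cnj (Z (Pilot_Noise b i k a) \<omega>) * P b i a c \<omega> * Z (Pilot_Noise b i k c) \<omega>)"
    using user by (intro bounded_moments_sum bounded_moments_mult bounded_moments_cnj bounded_moments_P bounded_moments_est) auto
  have uq: "integrable M (\<lambda>\<omega>. (cmod (q \<omega>))\<^sup>2)"
    unfolding q_def x_def by (rule bounded_moments_sq[OF umq])
  have qi: "integrable M q"
    unfolding q_def x_def by (rule bounded_moments_integrable[OF umq])
  have u\<phi>: "integrable M (\<lambda>\<omega>. (cmod (\<phi> \<omega>))\<^sup>2)"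
    unfolding \<phi>_def q_def x_def
    by (rule bounded_moments_sq[where f="\<lambda>b \<omega>. complex_of_real (sqrt (\<mu> i k)) * (\<Sum>a<N. \<Sum>c<N. cnj (Z (Pilot_Noise b i k a) \<omega>) * P b i a c \<omega> * Z (Pilot_Noise b i k c) \<omega>) - complex_of_real \<kappa>"])
       (intro bounded_moments_minus bounded_moments_mult bounded_moments_const umq)
  have EV: "expectation (\<lambda>\<omega>. (cmod (V c \<omega>))\<^sup>2) = gam i k * (\<Sum>a<N. expectation (\<lambda>\<omega>. (cmod (P b i a c \<omega>))\<^sup>2))" if c: "c < N" for c
  proof -
    have "expectation (\<lambda>\<omega>. (cmod (0 + (\<Sum>a<N. cnj (P b i a c \<omega>) * Z (x a) \<omega>)))\<^sup>2) =
       expectation (\<lambda>\<omega>. (cmod 0)\<^sup>2) + (\<Sum>a<N. vr (x a) * expectation (\<lambda>\<omega>. (cmod (cnj (P b i a c \<omega>)))\<^sup>2))"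
    proof (rule GF.pythagoras_inj)
      show "IP b i \<subseteq> S" by (rule IP_S)
      show "(\<lambda>\<omega>. cnj (P b i a c \<omega>)) \<in> borel_measurable (GF.Sg (IP b i))" if "a \<in> {..<N}" for a
        using that c by (intro borel_measurable_cnj P_meas user) auto
      show "integrable M (\<lambda>\<omega>. (cmod (cnj (P b i a c \<omega>)))\<^sup>2)" if "a \<in> {..<N}" for a
        using that c bounded_moments_sq[OF bounded_moments_P[OF user(1)], of a c b] by simp
    qed (use user in \<open>auto simp: inj_on_def IP_def x_def\<close>)
    also have "\<dots> = gam i k * (\<Sum>a<N. expectation (\<lambda>\<omega>. (cmod (P b i a c \<omega>))\<^sup>2))"
      using xS by (simp add: sum_distrib_left)
    finally have e: "expectation (\<lambda>\<omega>. (cmod (\<Sum>a<N. cnj (P b i a c \<omega>) * Z (x a) \<omega>))\<^sup>2) =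
      gam i k * (\<Sum>a<N. expectation (\<lambda>\<omega>. (cmod (P b i a c \<omega>))\<^sup>2))" by simp
    have "cmod (V c \<omega>) = cmod (\<Sum>a<N. cnj (P b i a c \<omega>) * Z (x a) \<omega>)" for \<omega>
    proof -
      have "cnj (V c \<omega>) = (\<Sum>a<N. cnj (P b i a c \<omega>) * Z (x a) \<omega>)" by (simp add: V_def)
      then show ?thesis by (metis complex_mod_cnj)
    qed
    then show ?thesis using e by simp
  qed
  have "expectation (\<lambda>\<omega>. (cmod (\<psi> \<omega>))\<^sup>2) = expectation (\<lambda>\<omega>. (cmod (\<phi> \<omega>))\<^sup>2) +
      (\<Sum>e\<in>?E. vr (Pilot_Noise b i (fst e) (snd e)) * expectation (\<lambda>\<omega>. (cmod (f e \<omega>))\<^sup>2))"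
    unfolding \<psi>_def
    by (rule GF.pythagoras_inj[OF _ _ _ I0 _ \<phi>I0 u\<phi> fI0 uf])
       (use user in \<open>auto simp: inj_on_def I0_def IP_def x_def\<close>)
  also have "(\<Sum>e\<in>?E. vr (Pilot_Noise b i (fst e) (snd e)) * expectation (\<lambda>\<omega>. (cmod (f e \<omega>))\<^sup>2)) =
      (\<Sum>e\<in>?E. gam i (fst e) * (\<mu> i (fst e) * (gam i k * (\<Sum>a<N. expectation (\<lambda>\<omega>. (cmod (P b i a (snd e) \<omega>))\<^sup>2)))))"
  proof (rule sum.cong[OF refl])
    fix e assume e: "e \<in> ?E"
    have "expectation (\<lambda>\<omega>. (cmod (f e \<omega>))\<^sup>2) = \<mu> i (fst e) * expectation (\<lambda>\<omega>. (cmod (V (snd e) \<omega>))\<^sup>2)"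
      using e norm_sqrt_mu[OF user(1), of "fst e"] by (auto simp: f_def)
    then show "vr (Pilot_Noise b i (fst e) (snd e)) * expectation (\<lambda>\<omega>. (cmod (f e \<omega>))\<^sup>2) =
      gam i (fst e) * (\<mu> i (fst e) * (gam i k * (\<Sum>a<N. expectation (\<lambda>\<omega>. (cmod (P b i a (snd e) \<omega>))\<^sup>2))))"
      using EV[of "snd e"] e by (auto simp: vr_def)
  qed
  also have "\<dots> = (\<Sum>m\<in>{1..K i} - {k}. \<Sum>c<N. gam i m * (\<mu> i m * (gam i k * (\<Sum>a<N. expectation (\<lambda>\<omega>. (cmod (P b i a c \<omega>))\<^sup>2)))))"
    by (simp add: sum.cartesian_product split_beta)
  also have "\<dots> = (\<Sum>m\<in>{1..K i} - {k}. gam i m * (\<mu> i m * (gam i k * real (N - nu G K i))))"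
  proof -
    have "(\<Sum>c<N. \<Sum>a<N. expectation (\<lambda>\<omega>. (cmod (P b i a c \<omega>))\<^sup>2)) = real (N - nu G K i)"
      by (subst sum.swap) (rule P_frobenius[OF user(1)])
    then show ?thesis by (simp only: sum_distrib_left[symmetric])
  qed
  also have "\<dots> = (\<Sum>m\<in>{1..K i} - {k}. gam i k * p_dl i m)"
  proof (rule sum.cong[OF refl])
    fix m assume "m \<in> {1..K i} - {k}"
    then have "\<mu> i m * gam i m * real (N - nu G K i) = p_dl i m" using mu_gam[OF user(1)] by auto
    then show "gam i m * (\<mu> i m * (gam i k * real (N - nu G K i))) = gam i k * p_dl i m"
      by (metis mult.assoc mult.commute)
  qed
  also have "expectation (\<lambda>\<omega>. (cmod (\<phi> \<omega>))\<^sup>2) = (\<kappa> - h)\<^sup>2 + gam i k * p_dl i k"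
  proof -
    define u where "u = sqrt (\<mu> i k)"
    have u2: "u\<^sup>2 = \<mu> i k" using mu_nonneg[OF user] by (simp add: u_def)
    have Q: "expectation (\<lambda>\<omega>. (cmod (q \<omega>))\<^sup>2) = (gam i k)\<^sup>2 * ((real (N - nu G K i))\<^sup>2 + real (N - nu G K i))"
      "expectation q = of_real (gam i k * real (N - nu G K i))"
    proof -
      have hyp: "inj_on x {..<N}" "\<And>a. a < N \<Longrightarrow> x a \<in> S" "\<And>a. a < N \<Longrightarrow> vr (x a) = gam i k"
        "IP b i \<subseteq> S" "IP b i \<inter> x ` {..<N} = {}"
        using xS IP_S by (auto simp: inj_on_def x_def IP_def)
      note qf = GF.quadratic_form_moment2[OF hyp P_meas[OF user(1)] P_bound[OF user(1)] P_row[OF user(1)] AE_P_trace[OF user(1), of b]]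
      show "expectation (\<lambda>\<omega>. (cmod (q \<omega>))\<^sup>2) = (gam i k)\<^sup>2 * ((real (N - nu G K i))\<^sup>2 + real (N - nu G K i))"
        unfolding q_def by (rule qf(1))
      show "expectation q = of_real (gam i k * real (N - nu G K i))"
        unfolding q_def by (rule qf(3))
    qed
    have ex: "(cmod (\<phi> \<omega>))\<^sup>2 = u\<^sup>2 * (cmod (q \<omega>))\<^sup>2 - 2 * \<kappa> * u * Re (q \<omega>) + \<kappa>\<^sup>2" for \<omega>
      unfolding \<phi>_def u_def[symmetric] by (simp add: cmod_power2) (simp add: power2_eq_square algebra_simps)
    have "expectation (\<lambda>\<omega>. (cmod (\<phi> \<omega>))\<^sup>2) = u\<^sup>2 * expectation (\<lambda>\<omega>. (cmod (q \<omega>))\<^sup>2) - 2 * \<kappa> * u * expectation (\<lambda>\<omega>. Re (q \<omega>)) + \<kappa>\<^sup>2"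
      unfolding ex using uq qi by (simp add: prob_space)
    also have "expectation (\<lambda>\<omega>. Re (q \<omega>)) = gam i k * real (N - nu G K i)"
      using Q(2) integral_Re[OF qi] by simp
    \<comment> \<open>With \<open>n = N - nu G K i\<close>, the part of the fourth moment
      proportional to \<open>n\<^sup>2\<close> completes the square; the part proportional to
      \<open>n\<close> is the variance of the quadratic form and turns into
      \<open>gam i k * p_dl i k\<close>.\<close>
    also have "u\<^sup>2 * expectation (\<lambda>\<omega>. (cmod (q \<omega>))\<^sup>2) - 2 * \<kappa> * u * (gam i k * real (N - nu G K i)) + \<kappa>\<^sup>2 =
       (\<kappa> - h)\<^sup>2 + gam i k * (u\<^sup>2 * gam i k * real (N - nu G K i))"
      unfolding Q(1) h_def u_def[symmetric] by (simp add: power2_eq_square algebra_simps)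
    also have "u\<^sup>2 * gam i k * real (N - nu G K i) = p_dl i k"
      unfolding u2 by (rule mu_gam[OF user])
    finally show ?thesis .
  qed
  also have "(\<kappa> - h)\<^sup>2 + gam i k * p_dl i k + (\<Sum>m\<in>{1..K i} - {k}. gam i k * p_dl i m) =
      (\<kappa> - h)\<^sup>2 + gam i k * (\<Sum>m=1..K i. p_dl i m)"
    using user by (subst (2) sum.remove[of _ k]) (auto simp: sum_distrib_left distrib_left)
  finally have E\<psi>: "expectation (\<lambda>\<omega>. (cmod (\<psi> \<omega>))\<^sup>2) = (\<kappa> - h)\<^sup>2 + gam i k * (\<Sum>m=1..K i. p_dl i m)" .
  have \<psi>_eq: "gain b i \<omega> - complex_of_real \<kappa> = \<psi> \<omega> - (\<Sum>a<N. w b i a \<omega> * cnj (Z (Channel b i k a) \<omega>))" for \<omega>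
  proof -
    define T where "T m c = complex_of_real (sqrt (\<mu> i m)) * V c \<omega> * Z (Pilot_Noise b i m c) \<omega>" for m c
    have "(\<Sum>e\<in>{1..K i} \<times> {..<N}. complex_of_real (sqrt (\<mu> i (fst e))) *
        (\<Sum>a<N. P b i a (snd e) \<omega> * cnj (Z (Pilot_Noise b i k a) \<omega>)) * Z (Pilot_Noise b i (fst e) (snd e)) \<omega>) =
      (\<Sum>m=1..K i. \<Sum>c<N. T m c)"
      by (simp add: sum.cartesian_product split_beta T_def V_def x_def)
    also have "\<dots> = (\<Sum>c<N. T k c) + (\<Sum>m\<in>{1..K i} - {k}. \<Sum>c<N. T m c)"
      using user by (subst sum.remove[of _ k]) auto
    also have "(\<Sum>m\<in>{1..K i} - {k}. \<Sum>c<N. T m c) = (\<Sum>e\<in>?E. f e \<omega> * Z (Pilot_Noise b i (fst e) (snd e)) \<omega>)"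
      by (simp add: sum.cartesian_product split_beta T_def f_def)
    also have "(\<Sum>c<N. T k c) = complex_of_real (sqrt (\<mu> i k)) * q \<omega>"
    proof -
      have "q \<omega> = (\<Sum>c<N. \<Sum>a<N. cnj (Z (x a) \<omega>) * P b i a c \<omega> * Z (x c) \<omega>)"
        unfolding q_def by (rule sum.swap)
      also have "\<dots> = (\<Sum>c<N. V c \<omega> * Z (x c) \<omega>)"
        by (simp add: V_def sum_distrib_left mult_ac)
      finally show ?thesis by (simp add: T_def x_def sum_distrib_left mult.assoc)
    qed
    finally show ?thesis
      unfolding gain_split[of b i] \<psi>_def \<phi>_def by simp
  qed
  have monoB: "F \<in> borel_measurable (GF.Sg I0) \<Longrightarrow> F \<in> borel_measurable (GF.Sg (IB b))" for F :: "'w \<Rightarrow> complex"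
    by (rule GF.measurable_Sg_mono) (use user in \<open>auto simp: I0_def IB_def IP_def x_def\<close>)
  have "\<psi> \<in> borel_measurable (GF.Sg (IB b))"
    unfolding \<psi>_def by (intro borel_measurable_add borel_measurable_sum borel_measurable_times monoB[OF \<phi>I0] monoB[OF fI0] est_IB)
      (use user in auto)
  moreover have "integrable M (\<lambda>\<omega>. (cmod (\<psi> \<omega>))\<^sup>2)"
  proof -
    have "\<psi> \<omega> = gain b i \<omega> - complex_of_real \<kappa> + (\<Sum>a<N. w b i a \<omega> * cnj (Z (Channel b i k a) \<omega>))" for \<omega>
      using \<psi>_eq[of \<omega>] by simp
    then show ?thesis
      by (simp only:) (rule bounded_moments_sq[where f="\<lambda>b \<omega>. gain b i \<omega> - complex_of_real \<kappa> + (\<Sum>a<N. w b i a \<omega> * cnj (Z (Channel b i k a) \<omega>))"],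
        intro bounded_moments_add bounded_moments_minus bounded_moments_gain bounded_moments_const bounded_moments_sum bounded_moments_mult bounded_moments_w bounded_moments_cnj bounded_moments_err user, auto)
  qed
  ultimately show ?thesis
    unfolding \<psi>_eq using E\<psi> by (subst error_pythagoras[OF user(1)]) auto
qed

end

lemma (in prob_space) indep_vars_reindex_inj:
  assumes ind: "indep_vars (\<lambda>_. N) X (f ` I)" and f: "inj_on f I"
  shows "indep_vars (\<lambda>_. N) (\<lambda>i. X (f i)) I"
  unfolding indep_vars_def2
proof (intro conjI ballI)
  show "X (f i) \<in> M \<rightarrow>\<^sub>M N" if "i \<in> I" for i using ind that by (auto simp: indep_vars_def)
  have ind': "indep_sets (\<lambda>i. {X i -` A \<inter> space M | A. A \<in> sets N}) (f ` I)"
    using ind by (simp add: indep_vars_def2)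
  show "indep_sets (\<lambda>i. {X (f i) -` A \<inter> space M | A. A \<in> sets N}) I"
  proof (rule indep_setsI)
    show "{X (f i) -` A \<inter> space M | A. A \<in> sets N} \<subseteq> events" if "i \<in> I" for i
      using ind that by (auto simp: indep_vars_def measurable_sets)
    fix A J assume J: "J \<noteq> {}" "J \<subseteq> I" "finite J" and A: "\<forall>j\<in>J. A j \<in> {X (f j) -` A \<inter> space M | A. A \<in> sets N}"
    have inj: "inj_on f J" using f J by (auto intro: inj_on_subset)
    define A' where "A' x = A (the_inv_into J f x)" for x
    have A'[simp]: "A' (f j) = A j" if "j \<in> J" for j
      using the_inv_into_f_f[OF inj that] by (simp add: A'_def)
    have "prob (\<Inter>x\<in>f ` J. A' x) = (\<Prod>x\<in>f ` J. prob (A' x))"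
      using J A by (intro indep_setsD[OF ind']) auto
    then show "prob (\<Inter>j\<in>J. A j) = (\<Prod>j\<in>J. prob (A j))"
      using inj by (simp add: prod.reindex)
  qed
qed

lemma sum_split_zero:
  fixes F :: "nat \<Rightarrow> 'a::comm_monoid_add"
  assumes "i \<in> {1..G}"
  shows "(\<Sum>j\<in>{0..G}. F j) = F 0 + (F i + (\<Sum>j\<in>{1..G} - {i}. F j))"
proof -
  have "(\<Sum>j\<in>{0..G}. F j) = F 0 + (\<Sum>j\<in>{1..G}. F j)"
    by (simp add: sum.atLeast_Suc_atMost)
  then show ?thesis using assms by (simp add: sum.remove)
qed

lemma bounded_moments_norm_sq: "bounded_moments M f \<Longrightarrow> bounded_moments M (\<lambda>b \<omega>. complex_of_real ((cmod (f b \<omega>))\<^sup>2))"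
  unfolding complex_norm_square by (intro bounded_moments_mult bounded_moments_cnj)

text \<open>With a single message the constant decoder is always right, and the constant input 1 has
  exactly the required energy. This serves the degenerate cases in which the claimed efficiency is
  0.\<close>

lemma achievable_rate_nonpos:
  assumes M: "prob_space M" and D: "finite D" and R: "R \<le> 0"
  shows "achievable_rate M T D Y R"
  unfolding achievable_rate_def
proof (intro allI impI always_eventually exI conjI)
  fix \<epsilon> :: real and B assume eps: "0 < \<epsilon>"
  show "1 \<le> (1::nat)" by simp
  show "R * (real B * real T) \<le> log 2 (real 1)" using R by (simp add: mult_nonpos_nonneg)
  show "block_code M D Y B 1 \<epsilon>"
    unfolding block_code_def
    using eps prob_space.prob_space[OF M]
    by (intro exI[of _ "\<lambda>_ _ _. 1"] bexI[of _ "\<lambda>_. 0"]) (auto simp: D)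
qed

section \<open>Information density of an interval and the achievable rates\<close>

context multicast_user
begin

text \<open>The denominator of the SINR: receiver noise, fluctuation of the own gain due to the
  estimates of the group, and leakage through the estimation error. The double sum includes the own
  group, whose error part belongs to the fluctuation of the gain.\<close>

definition s2 :: real where
  "s2 = 1 + gam i k * (\<Sum>m=1..K i. p_dl i m) + (\<beta> i k - gam i k) * (\<Sum>j=1..G. \<Sum>m=1..K j. p_dl j m)"

lemma s2_pos: "0 < s2"
proof -
  have "0 \<le> gam i k * (\<Sum>m=1..K i. p_dl i m)"
    using beta_minus_gam(2)[OF user] user powers by (intro mult_nonneg_nonneg sum_nonneg) auto
  moreover have "0 \<le> (\<beta> i k - gam i k) * (\<Sum>j=1..G. \<Sum>m=1..K j. p_dl j m)"
    using beta_minus_gam(3)[OF user] powers by (intro mult_nonneg_nonneg sum_nonneg) auto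
  ultimately show ?thesis unfolding s2_def by linarith
qed

abbreviation xi :: "nat \<Rightarrow> nat \<Rightarrow> 'w \<Rightarrow> complex" where
  "xi b t \<equiv> Z (Data b t i)"

abbreviation residual :: "real \<Rightarrow> nat \<Rightarrow> nat \<Rightarrow> 'w \<Rightarrow> complex" where
  "residual \<kappa> b t \<omega> \<equiv> (gain b i \<omega> - complex_of_real \<kappa>) * xi b t \<omega> + interf b t \<omega>"

text \<open>Receiver noise and data symbols are independent and centered, with coefficients
  depending on \<open>IC b\<close>, so their powers add. Taking \<open>\<kappa> = 0\<close> gives
  the output power \<open>h\<^sup>2 + s2\<close>, and \<open>\<kappa> = h\<close> the effective
  noise power \<open>s2\<close>.\<close>

lemma output_power:
  fixes \<kappa> :: real
  assumes t: "t \<in> D"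
  shows "expectation (\<lambda>\<omega>. (cmod (residual \<kappa> b t \<omega>))\<^sup>2) = (\<kappa> - h)\<^sup>2 + s2"
proof -
  \<comment> \<open>Groups are numbered from 1, so index 0 is free for the receiver noise, with
    coefficient 1.\<close>
  define l where "l j = (if j = 0 then Receiver_Noise b t else Data b t j)" for j
  define f where "f j \<omega> = (if j = 0 then 1 else gain b j \<omega> - (if j = i then complex_of_real \<kappa> else 0))" for j \<omega>
  have i0: "i \<noteq> 0" using user by simp
  have "expectation (\<lambda>\<omega>. (cmod (0 + (\<Sum>j\<in>{0..G}. f j \<omega> * Z (l j) \<omega>)))\<^sup>2) =
      expectation (\<lambda>\<omega>. (cmod 0)\<^sup>2) + (\<Sum>j\<in>{0..G}. vr (l j) * expectation (\<lambda>\<omega>. (cmod (f j \<omega>))\<^sup>2))"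
  proof (rule GF.pythagoras_inj)
    show "IC b \<subseteq> S" by (rule IC_S)
    show "l ` {0..G} \<subseteq> S" "IC b \<inter> l ` {0..G} = {}" "inj_on l {0..G}"
      using t by (auto simp: l_def IC_def IB_def inj_on_def)
    fix j assume j: "j \<in> {0..G}"
    show "f j \<in> borel_measurable (GF.Sg (IC b))"
      using j gain_IC[of j b] unfolding f_def[abs_def] by (cases "j = 0") auto
    show "integrable M (\<lambda>\<omega>. (cmod (f j \<omega>))\<^sup>2)"
    proof (cases "j = 0")
      case True
      then show ?thesis by (simp add: f_def)
    next
      case False
      have "bounded_moments M (\<lambda>b \<omega>. gain b j \<omega> - (if j = i then complex_of_real \<kappa> else 0))"
        by (rule bounded_moments_minus[OF bounded_moments_gain bounded_moments_const]) (use False j in auto)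
      from bounded_moments_sq[OF this, of b] show ?thesis using False by (simp add: f_def)
    qed
  qed auto
  also have "(\<Sum>j\<in>{0..G}. vr (l j) * expectation (\<lambda>\<omega>. (cmod (f j \<omega>))\<^sup>2)) =
      1 + ((\<kappa> - h)\<^sup>2 + gam i k * (\<Sum>m=1..K i. p_dl i m) + (\<beta> i k - gam i k) * (\<Sum>m=1..K i. p_dl i m)
       + (\<Sum>j\<in>{1..G} - {i}. (\<beta> i k - gam i k) * (\<Sum>m=1..K j. p_dl j m)))"
  proof -
    have "vr (l 0) * expectation (\<lambda>\<omega>. (cmod (f 0 \<omega>))\<^sup>2) = 1"
      by (simp add: l_def f_def vr_def prob_space)
    moreover have "vr (l i) * expectation (\<lambda>\<omega>. (cmod (f i \<omega>))\<^sup>2) =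
       (\<kappa> - h)\<^sup>2 + gam i k * (\<Sum>m=1..K i. p_dl i m) + (\<beta> i k - gam i k) * (\<Sum>m=1..K i. p_dl i m)"
      using i0 gain_power[of b \<kappa>] by (simp add: l_def f_def vr_def)
    moreover have "(\<Sum>j\<in>{1..G} - {i}. vr (l j) * expectation (\<lambda>\<omega>. (cmod (f j \<omega>))\<^sup>2)) =
        (\<Sum>j\<in>{1..G} - {i}. (\<beta> i k - gam i k) * (\<Sum>m=1..K j. p_dl j m))"
    proof (rule sum.cong[OF refl])
      fix j assume "j \<in> {1..G} - {i}"
      then show "vr (l j) * expectation (\<lambda>\<omega>. (cmod (f j \<omega>))\<^sup>2) = (\<beta> i k - gam i k) * (\<Sum>m=1..K j. p_dl j m)"
        using interference_power[of j b] by (simp add: l_def f_def vr_def)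
    qed
    ultimately show ?thesis
      unfolding sum_split_zero[OF user(1)] by (simp only:)
  qed
  also have "expectation (\<lambda>\<omega>. (cmod 0)\<^sup>2) + (1 + ((\<kappa> - h)\<^sup>2 + gam i k * (\<Sum>m=1..K i. p_dl i m) + (\<beta> i k - gam i k) * (\<Sum>m=1..K i. p_dl i m)
       + (\<Sum>j\<in>{1..G} - {i}. (\<beta> i k - gam i k) * (\<Sum>m=1..K j. p_dl j m)))) = (\<kappa> - h)\<^sup>2 + s2"
    unfolding s2_def using user(1)
    by (subst (5) sum.remove[of _ i]) (auto simp: sum_distrib_left distrib_left)
  finally have e: "expectation (\<lambda>\<omega>. (cmod (0 + (\<Sum>j\<in>{0..G}. f j \<omega> * Z (l j) \<omega>)))\<^sup>2) = (\<kappa> - h)\<^sup>2 + s2" .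
  have "0 + (\<Sum>j\<in>{0..G}. f j \<omega> * Z (l j) \<omega>) = residual \<kappa> b t \<omega>" for \<omega>
  proof -
    have "(\<Sum>j\<in>{1..G} - {i}. f j \<omega> * Z (l j) \<omega>) = (\<Sum>j\<in>{1..G} - {i}. gain b j \<omega> * Z (Data b t j) \<omega>)"
      by (intro sum.cong) (auto simp: f_def l_def)
    then show ?thesis using i0 unfolding sum_split_zero[OF user(1)] interf_def by (simp add: f_def l_def)
  qed
  then show ?thesis using e by simp
qed

definition W :: "nat \<Rightarrow> 'w \<Rightarrow> real" where
  "W b \<omega> = (\<Sum>t\<in>D. info_density h s2 (xi b t \<omega>) (gain b i \<omega> * xi b t \<omega> + interf b t \<omega>))"

lemma W_eq: "W b \<omega> = (\<Sum>t\<in>D. ln (1 + h\<^sup>2 / s2) +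
    (cmod (residual 0 b t \<omega>))\<^sup>2 / (h\<^sup>2 + s2) -
    (cmod (residual h b t \<omega>))\<^sup>2 / s2)"
  unfolding W_def info_density_def by (simp add: algebra_simps)

lemma bounded_moments_output: "t \<in> D \<Longrightarrow> bounded_moments M (\<lambda>b \<omega>. residual \<kappa> b t \<omega>)"
  by (intro bounded_moments_add bounded_moments_mult bounded_moments_minus bounded_moments_gain bounded_moments_const bounded_moments_data bounded_moments_interf user)

text \<open>The two quadratic terms, each normalized by its own mean, have mean 1 and cancel, which
  leaves the logarithm. This is the reason for using exactly these \<open>h\<close> and
  \<open>s2\<close> in the metric.\<close>

lemma W_mean: "expectation (W b) = real (card D) * ln (1 + h\<^sup>2 / s2)"
proof -
  have i: "integrable M (\<lambda>\<omega>. (cmod (residual \<kappa> b t \<omega>))\<^sup>2)" if "t \<in> D" for \<kappa> t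
    by (rule bounded_moments_sq[OF bounded_moments_output[OF that]])
  have pos: "0 < h\<^sup>2 + s2" using s2_pos by (simp add: add_nonneg_pos)
  have "expectation (W b) = (\<Sum>t\<in>D. expectation (\<lambda>\<omega>. ln (1 + h\<^sup>2 / s2) +
    (cmod (residual 0 b t \<omega>))\<^sup>2 / (h\<^sup>2 + s2) -
    (cmod (residual h b t \<omega>))\<^sup>2 / s2))"
    unfolding W_eq[abs_def]
    by (intro Bochner_Integration.integral_sum Bochner_Integration.integrable_diff Bochner_Integration.integrable_add
        integrable_divide i) auto
  also have "\<dots> = (\<Sum>t\<in>D. ln (1 + h\<^sup>2 / s2))"
  proof (rule sum.cong[OF refl])
    fix t assume t: "t \<in> D"
    have "expectation (\<lambda>\<omega>. ln (1 + h\<^sup>2 / s2) +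
      (cmod (residual 0 b t \<omega>))\<^sup>2 / (h\<^sup>2 + s2) -
      (cmod (residual h b t \<omega>))\<^sup>2 / s2) =
      ln (1 + h\<^sup>2 / s2) + expectation (\<lambda>\<omega>. (cmod (residual 0 b t \<omega>))\<^sup>2) / (h\<^sup>2 + s2) -
      expectation (\<lambda>\<omega>. (cmod (residual h b t \<omega>))\<^sup>2) / s2"
      using i[OF t, of 0] i[OF t, of h]
      by (subst Bochner_Integration.integral_diff Bochner_Integration.integral_add; simp add: prob_space)
    then show "expectation (\<lambda>\<omega>. ln (1 + h\<^sup>2 / s2) +
      (cmod (residual 0 b t \<omega>))\<^sup>2 / (h\<^sup>2 + s2) -
      (cmod (residual h b t \<omega>))\<^sup>2 / s2) = ln (1 + h\<^sup>2 / s2)"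
      using output_power[OF t, of b 0] output_power[OF t, of b h] pos s2_pos by simp
  qed
  finally show ?thesis by simp
qed

text \<open>\<open>W b\<close> is built by sums and products from variables with bounded moments;
  the cast to complex numbers brings it into the class \<open>bounded_moments\<close>.\<close>

lemma W_moment2: "\<exists>C. \<forall>b. integrable M (\<lambda>\<omega>. (W b \<omega>)\<^sup>2) \<and> expectation (\<lambda>\<omega>. (W b \<omega>)\<^sup>2) \<le> C"
proof -
  have eq: "complex_of_real (W b \<omega>) = (\<Sum>t\<in>D. complex_of_real (ln (1 + h\<^sup>2 / s2)) +
    complex_of_real ((cmod (residual 0 b t \<omega>))\<^sup>2) * complex_of_real (1 / (h\<^sup>2 + s2)) -
    complex_of_real ((cmod (residual h b t \<omega>))\<^sup>2) * complex_of_real (1 / s2))" for b \<omega>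
    unfolding W_eq by (simp add: divide_inverse)
  have "bounded_moments M (\<lambda>b \<omega>. complex_of_real (W b \<omega>))"
    unfolding eq by (intro bounded_moments_sum bounded_moments_minus bounded_moments_add bounded_moments_mult[OF bounded_moments_norm_sq[OF bounded_moments_output] bounded_moments_const] bounded_moments_const)
  then have "\<exists>C. \<forall>b. integrable M (\<lambda>\<omega>. cmod (complex_of_real (W b \<omega>)) ^ 2) \<and> expectation (\<lambda>\<omega>. cmod (complex_of_real (W b \<omega>)) ^ 2) \<le> C"
    unfolding bounded_moments_def by blast
  then show ?thesis by simp
qed

text \<open>The labels on which the metric of interval \<open>b\<close> depends. They are disjoint
  for different intervals, whence the independence of the sums \<open>W b\<close>.\<close>

definition blk :: "nat \<Rightarrow> source set" where
  "blk b = IC b \<union> {Data b t j | t j. t \<in> D \<and> j \<in> {1..G}} \<union> {Receiver_Noise b t | t. t \<in> D}"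

lemma blk_S: "blk b \<subseteq> S"
  using IC_S by (auto simp: blk_def)

lemma gain_mono: "IC b \<subseteq> I \<Longrightarrow> j \<in> {1..G} \<Longrightarrow> gain b j \<in> borel_measurable (GF.Sg I)"
  by (rule GF.measurable_Sg_mono[OF _ gain_IC])

lemma interf_Sg:
  assumes "t \<in> D" "IC b \<subseteq> I" "Receiver_Noise b t \<in> I" "\<And>j. j \<in> {1..G} - {i} \<Longrightarrow> Data b t j \<in> I"
  shows "interf b t \<in> borel_measurable (GF.Sg I)"
  unfolding interf_def[abs_def]
  by (intro borel_measurable_add borel_measurable_sum borel_measurable_times gain_mono GF.Z_Sg) (use assms in auto)

lemma W_blk: "W b \<in> borel_measurable (GF.Sg (blk b))"
proof -
  have [measurable]: "gain b i \<in> borel_measurable (GF.Sg (blk b))"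
    by (rule gain_mono) (use user in \<open>auto simp: blk_def\<close>)
  have "interf b t \<in> borel_measurable (GF.Sg (blk b))" "xi b t \<in> borel_measurable (GF.Sg (blk b))" if "t \<in> D" for t
    using that user by (auto intro!: interf_Sg GF.Z_Sg simp: blk_def)
  note [measurable] = this
  show ?thesis
    unfolding W_def[abs_def] by measurable
qed

lemma blk_disjoint: "b \<noteq> b' \<Longrightarrow> blk b \<inter> blk b' = {}"
  by (auto simp: blk_def IC_def IB_def)

lemma W_indep: "b \<noteq> b' \<Longrightarrow> indep_var borel (W b) borel (W b')"
  by (rule GF.indep_var_Sg[OF blk_S blk_S blk_disjoint W_blk W_blk])

lemma h_sq: "h\<^sup>2 = real (N - nu G K i) * gam i k * p_dl i k"
  unfolding h_def using mu_gam[OF user] mu_nonneg[OF user] by (simp add: power_mult_distrib) (simp add: power2_eq_square mult_ac)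

lemma achievable_below_capacity:
  assumes D: "\<tau> < T" and h: "h \<noteq> 0" and R: "R * real T * ln 2 < real (card D) * ln (1 + h\<^sup>2 / s2)"
  shows "achievable_rate M T D (multicast_channel N G \<tau> K \<beta> p_ul \<mu> g n s z i k) R"
proof -
  obtain C where C: "\<And>b. integrable M (\<lambda>\<omega>. (W b \<omega>)\<^sup>2)" "\<And>b. expectation (\<lambda>\<omega>. (W b \<omega>)\<^sup>2) \<le> C"
    using W_moment2 by blast
  \<comment> \<open>The symbols of group \<open>i\<close> at all times act as the random codebook.
    Gains and interference depend on labels outside \<open>Xi\<close>, which supplies the
    independence of input and channel state.\<close>
  define Xi where "Xi = {Data b t i | b t. t \<in> D}"
  have Xi: "Xi \<subseteq> S" using user by (auto simp: Xi_def)
  have IC_Xi: "IC b \<subseteq> S - Xi" for b using IC_S[of b] user by (auto simp: Xi_def IC_def IB_def)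
  have gm: "gain b i \<in> borel_measurable (GF.Sg (S - Xi))" for b
    by (rule gain_mono[OF IC_Xi user(1)])
  have im: "interf b t \<in> borel_measurable (GF.Sg (S - Xi))" if "t \<in> D" for b t
    by (rule interf_Sg[OF that IC_Xi]) (use that in \<open>auto simp: Xi_def\<close>)
  show ?thesis
  proof (rule achievable_rate_mismatched[where a="\<lambda>b. gain b i" and v=interf and xi=xi and ?s2.0=s2 and h=h and C=C])
    show "finite D" "D \<noteq> {}" using D by auto
    show "multicast_channel N G \<tau> K \<beta> p_ul \<mu> g n s z i k x b t \<omega> = gain b i \<omega> * x b t + interf b t \<omega>"
      if "t \<in> D" "\<omega> \<in> space M" for x b t \<omega> by (rule channel_eq[OF that])
    show "distr M borel (xi b t) = CN 1" if "t \<in> D" for b t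
      using GF.law_Z[of "Data b t i"] that user by (simp add: vr_def)
    show "indep_vars (\<lambda>_. borel) (\<lambda>u. xi (fst u) (snd u)) (UNIV \<times> D)"
      by (rule indep_vars_reindex_inj[where X=Z and f="\<lambda>u. Data (fst u) (snd u) i", OF indep_vars_subset[OF indep_Z]])
         (use user in \<open>auto simp: inj_on_def\<close>)
    show "gain b i \<in> borel_measurable M" for b by (rule bounded_moments_measurable[OF bounded_moments_gain[OF user(1)]])
    show "interf b t \<in> borel_measurable M" if "t \<in> D" for b t by (rule bounded_moments_measurable[OF bounded_moments_interf[OF that]])
    show "distr M (PiM ({..<B} \<times> D) (\<lambda>_. borel) \<Otimes>\<^sub>M PiM ({..<B} \<times> D) (\<lambda>_. borel \<Otimes>\<^sub>M borel))
          (\<lambda>\<omega>. (\<lambda>u\<in>{..<B} \<times> D. xi (fst u) (snd u) \<omega>, \<lambda>u\<in>{..<B} \<times> D. (gain (fst u) i \<omega>, interf (fst u) (snd u) \<omega>))) =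
        distr M (PiM ({..<B} \<times> D) (\<lambda>_. borel)) (\<lambda>\<omega>. \<lambda>u\<in>{..<B} \<times> D. xi (fst u) (snd u) \<omega>) \<Otimes>\<^sub>M
        distr M (PiM ({..<B} \<times> D) (\<lambda>_. borel \<Otimes>\<^sub>M borel)) (\<lambda>\<omega>. \<lambda>u\<in>{..<B} \<times> D. (gain (fst u) i \<omega>, interf (fst u) (snd u) \<omega>))" for B
    proof (rule GF.distr_Sg_indep[OF Xi, of "S - Xi"])
      show "(\<lambda>\<omega>. \<lambda>u\<in>{..<B} \<times> D. xi (fst u) (snd u) \<omega>) \<in> GF.Sg Xi \<rightarrow>\<^sub>M PiM ({..<B} \<times> D) (\<lambda>_. borel)"
        by (intro measurable_restrict GF.Z_Sg) (auto simp: Xi_def)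
      show "(\<lambda>\<omega>. \<lambda>u\<in>{..<B} \<times> D. (gain (fst u) i \<omega>, interf (fst u) (snd u) \<omega>)) \<in> GF.Sg (S - Xi) \<rightarrow>\<^sub>M PiM ({..<B} \<times> D) (\<lambda>_. borel \<Otimes>\<^sub>M borel)"
        by (intro measurable_restrict measurable_Pair gm im) auto
    qed auto
    show "0 < s2" by (rule s2_pos)
    show "h \<noteq> 0" by fact
    show "R * real T * ln 2 < real (card D) * ln (1 + h\<^sup>2 / s2)" by fact
    show "integrable M (\<lambda>\<omega>. (\<Sum>t\<in>D. info_density h s2 (xi b t \<omega>) (gain b i \<omega> * xi b t \<omega> + interf b t \<omega>))\<^sup>2)" for b
      using C(1)[of b] by (simp add: W_def)
    show "expectation (\<lambda>\<omega>. (\<Sum>t\<in>D. info_density h s2 (xi b t \<omega>) (gain b i \<omega> * xi b t \<omega> + interf b t \<omega>))\<^sup>2) \<le> C" for b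
      using C(2)[of b] by (simp add: W_def)
    show "expectation (\<lambda>\<omega>. \<Sum>t\<in>D. info_density h s2 (xi b t \<omega>) (gain b i \<omega> * xi b t \<omega> + interf b t \<omega>)) = real (card D) * ln (1 + h\<^sup>2 / s2)" for b
      using W_mean[of b] by (simp add: W_def[abs_def])
    show "indep_var borel (\<lambda>\<omega>. \<Sum>t\<in>D. info_density h s2 (xi b t \<omega>) (gain b i \<omega> * xi b t \<omega> + interf b t \<omega>))
       borel (\<lambda>\<omega>. \<Sum>t\<in>D. info_density h s2 (xi b' t \<omega>) (gain b' i \<omega> * xi b' t \<omega> + interf b' t \<omega>))" if "b \<noteq> b'" for b b'
      using W_indep[OF that] by (simp add: W_def[abs_def])
  qed
qed

lemma achievable_SE_bound:
  "achievable_SE M T D (multicast_channel N G \<tau> K \<beta> p_ul \<mu> g n s z i k)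
     ((1 - real \<tau> / real T) * log 2 (1 + h\<^sup>2 / s2))"
proof -
  let ?Y = "multicast_channel N G \<tau> K \<beta> p_ul \<mu> g n s z i k"
  let ?SE = "(1 - real \<tau> / real T) * log 2 (1 + h\<^sup>2 / s2)"
  have T: "0 < T" "\<tau> \<le> T" using tau_pos pilots by auto
  \<comment> \<open>Rates strictly below the claimed value suffice, because the capacity is a
    supremum.\<close>
  have key: "achievable_rate M T D ?Y R" if R: "R < ?SE" for R
  proof (cases "\<tau> < T \<and> h \<noteq> 0")
    case True
    have "R * real T < ?SE * real T" using R T by simp
    also have "?SE * real T = (real T - real \<tau>) * log 2 (1 + h\<^sup>2 / s2)"
      using T by (simp add: field_simps)
    finally have "R * real T * ln 2 < (real T - real \<tau>) * log 2 (1 + h\<^sup>2 / s2) * ln 2"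
      by (simp add: mult_strict_right_mono)
    also have "\<dots> = real (card D) * ln (1 + h\<^sup>2 / s2)"
      using T by (simp add: log_def of_nat_diff)
    finally show ?thesis using True by (intro achievable_below_capacity) auto
  next
    \<comment> \<open>Without data symbols, or with mean gain zero, the claimed efficiency is 0 and
      only negative rates remain to be achieved.\<close>
    case False
    then have "?SE = 0" using T by auto
    with R show ?thesis by (intro achievable_rate_nonpos prob_space_axioms) auto
  qed
  show ?thesis
    unfolding achievable_SE_def ergodic_capacity_def
  proof (rule dense_le)
    fix e :: ereal assume e: "e < ereal ?SE"
    show "e \<le> Sup (ereal ` {R. achievable_rate M T D ?Y R})"
    proof (cases e)
      case (real r)
      with e key show ?thesis by (auto intro!: SUP_upper)
    qed (use e in auto)
  qed
qed

end

theorem theorem1: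
  fixes M :: "'w measure"
    and N G T \<tau> :: nat
    and K :: "nat \<Rightarrow> nat"
    and \<beta> \<gamma> \<mu> p_ul p_dl :: "nat \<Rightarrow> nat \<Rightarrow> real"
    and P :: real
    and g n :: "nat \<Rightarrow> nat \<Rightarrow> nat \<Rightarrow> 'w \<Rightarrow> complex vec"
    and s :: "nat \<Rightarrow> nat \<Rightarrow> nat \<Rightarrow> 'w \<Rightarrow> complex"
    and z :: "nat \<Rightarrow> nat \<Rightarrow> nat \<Rightarrow> nat \<Rightarrow> 'w \<Rightarrow> complex"
    and i k :: nat
  assumes system: "multicast_system M N G T \<tau> K \<beta> p_ul g n s z"
    and antennas: "\<forall>j\<in>{1..G}. nu G K j < N"
    and powers: "\<forall>j\<in>{1..G}. \<forall>m\<in>{1..K j}. 0 \<le> p_dl j m"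
    and gamma: "\<forall>j\<in>{1..G}. \<forall>m\<in>{1..K j}. \<gamma> j m = estimate_var \<tau> (p_ul j m) (\<beta> j m)"
    and mu: "\<forall>j\<in>{1..G}. \<forall>m\<in>{1..K j}. \<mu> j m = p_dl j m / (real (N - nu G K j) * \<gamma> j m)"
    and total_power: "P = (\<Sum>j=1..G. \<Sum>m=1..K j. p_dl j m)"
    and user: "i \<in> {1..G}" "k \<in> {1..K i}"
  shows "achievable_SE M T {\<tau><..T}
           (multicast_channel N G \<tau> K \<beta> p_ul \<mu> g n s z i k)
           ((1 - real \<tau> / real T) *
            log 2 (1 + real (N - nu G K i) * \<gamma> i k * p_dl i k /
                       (1 + \<gamma> i k * (\<Sum>m=1..K i. p_dl i m) + (\<beta> i k - \<gamma> i k) * P)))"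
proof -
  interpret multicast_user M N G T \<tau> K \<beta> p_ul g n s z p_dl \<mu> i k
    using system antennas powers gamma mu user
    by (intro multicast_user.intro multicast_user_axioms.intro) auto
  have "\<gamma> i k = estimate_var \<tau> (p_ul i k) (\<beta> i k)" using gamma user by blast
  then show ?thesis
    using achievable_SE_bound unfolding h_sq s2_def total_power by simp
qed

end
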